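(* Let $k\in\mathbb{N}$ ($k\geq 1$) and let $p$ be a prime number such that $k$ divides $p-1$. Let $m$ and $n_{ij}$ ($0\le i,j\le k-1$) be the integers associated with $p$, $k$ and a generator $g$ of $\mathbb{Z}_p^*$ as described in the context. Then the function $\chi:(\mathbb{C}^* )^k\to\mathbb{C}^k$ given by $$\chi(c_0,\ldots,c_{k-1})_a=c_a+\frac{1}{c_{a+m}}+\sum_{i,j=0}^{k-1}n_{ij}\frac{c_{a+j}}{c_{a+i}},\qquad 0\le a\le k-1$$ (indices of $c$ calculated modulo $k$) is a proper holomorphic function of multiplicity $\binom{2k}{k}$. In particular, the number of solutions $(c_0,\ldots,c_{k-1})\in(\mathbb{C}^* )^k$ to $$c_a+\frac{1}{c_{a+m}}+\sum_{i,j=0}^{k-1}n_{ij}\frac{c_{a+j}}{c_{a+i}}=0\qquad(0\le a\le k-1)$$ counted with multiplicity is equal to $\binom{2k}{k}$.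
   Context: $\mathbb{C}^*=\mathbb{C}\setminus\{0\}$, $\mathbb{Z}_p=\mathbb{Z}/p\mathbb{Z}$, $\mathbb{Z}_p^*=\mathbb{Z}_p\setminus\{0\}$ (a cyclic group under multiplication). Let $G_0=\{h^k: h\in\mathbb{Z}_p^*\}$ be the unique subgroup of index $k$ of $\mathbb{Z}_p^*$, let $g$ be a generator of $\mathbb{Z}_p^*$, and let $G_l=g^lG_0$, $1\le l\le k-1$, be the non-trivial cosets. The number $m\in\{0,\ldots,k-1\}$ is determined by $p-1\in G_m$ (i.e. $-1\in G_m$), and $n_{ij}$ is the number of $b\in G_i$ for which $b+1\in G_j$ ($0\le i,j\le k-1$). A region in $\mathbb{C}^n$ is a non-empty connected open subset. A holomorphic map $\varphi:U\to V$ between regions in $\mathbb{C}^n$ is proper if $\varphi^{-1}(K)$ is a compact subset of $U$ for every compact $K\subseteq V$. Let $M=\{z\in U:\det\varphi'(z)=0\}$; the points of $\varphi(M)$ are the critical values of $\varphi$ and those of $V\setminus\varphi(M)$ the regular values. For a proper holomorphic $\varphi$ there is a unique natural number, called the multiplicity of $\varphi$, which equals $|\varphi^{-1}(w)|$ for every regular value $w\in V$ and is strictly larger than $|\varphi^{-1}(w)|$ for every critical value $w$. Multiplicity of an isolated zero $a$ of a holomorphic map $f:U\to\mathbb{C}^n$: choose a neighbourhood $U_a$ of $a$ whose closure is a compact subset of $U$ containing no zero of $f$ other than $a$. Then there is $\varepsilon>0$ such that for Lebesgue almost all $w\in B(0,\varepsilon)$ the map $z\mapsto f(z)-w$ has only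 simple zeros in $U_a$ (zeros where the Jacobian determinant is non-zero), and their number depends neither on $w$ nor on $U_a$; this number is the multiplicity of $a$. (It coincides with $\dim_{\mathbb{C}}(O_a/I_a(f))$, where $O_a$ is the ring of holomorphic germs at $a$ and $I_a(f)$ the ideal generated by the coordinate functions of $f$.) The number of solutions of $\varphi(z)=w$ counted with multiplicity is the number of zeros of $z\mapsto\varphi(z)-w$ in $U$, each counted with its multiplicity. *)

theory Defs
  imports
    "HOL-Analysis.Analysis"
    "HOL-Number_Theory.Number_Theory"
    "Berlekamp_Zassenhaus.Finite_Field"
begin

section \<open>Cosets of the group of k-th powers modulo p\<close>

text \<open>Residue classes modulo \<open>p\<close> are represented by the numbers \<open>0, \<dots>, p - 1\<close>;
  a generator of the multiplicative group is a \<^const>\<open>residue_primroot\<close>.\<close>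

definition kth_powers :: "nat \<Rightarrow> nat \<Rightarrow> nat set" where
  "kth_powers p k = (\<lambda>h. h ^ k mod p) ` {1..<p}"

definition power_coset :: "nat \<Rightarrow> nat \<Rightarrow> nat \<Rightarrow> nat \<Rightarrow> nat set" where
  "power_coset p k g l = (\<lambda>x. g ^ l * x mod p) ` kth_powers p k"

definition coset_succ_count :: "nat \<Rightarrow> nat \<Rightarrow> nat \<Rightarrow> nat \<Rightarrow> nat \<Rightarrow> nat" where
  "coset_succ_count p k g i j =
     card {b \<in> power_coset p k g i. (b + 1) mod p \<in> power_coset p k g j}"


section \<open>Holomorphic maps in several variables\<close>

text \<open>Complex differentiability: the Frechet derivative exists and is
  given by a complex matrix.\<close>

definition holomorphic_map_on :: "(complex ^ 'm \<Rightarrow> complex ^ 'n) \<Rightarrow> (complex ^ 'm) set \<Rightarrow> bool"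
  where "holomorphic_map_on f U \<longleftrightarrow>
    (\<forall>z\<in>U. \<exists>A :: complex ^ 'm ^ 'n. (f has_derivative (\<lambda>h. A *v h)) (at z))"

definition jacobian_det :: "(complex ^ 'n \<Rightarrow> complex ^ 'n) \<Rightarrow> complex ^ 'n \<Rightarrow> complex" where
  "jacobian_det f z = det (jacobian f (at z))"

definition region :: "(complex ^ 'n) set \<Rightarrow> bool" where
  "region U \<longleftrightarrow> open U \<and> connected U \<and> U \<noteq> {}"

definition proper_holomorphic_map ::
    "(complex ^ 'n \<Rightarrow> complex ^ 'n) \<Rightarrow> (complex ^ 'n) set \<Rightarrow> (complex ^ 'n) set \<Rightarrow> bool" where
  "proper_holomorphic_map f U V \<longleftrightarrow>
     region U \<and> region V \<and> f ` U \<subseteq> V \<and> holomorphic_map_on f U \<and>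
     (\<forall>K. compact K \<and> K \<subseteq> V \<longrightarrow> compact {z \<in> U. f z \<in> K})"

definition critical_values ::
    "(complex ^ 'n \<Rightarrow> complex ^ 'n) \<Rightarrow> (complex ^ 'n) set \<Rightarrow> (complex ^ 'n) set" where
  "critical_values f U = f ` {z \<in> U. jacobian_det f z = 0}"

text \<open>Finiteness of the fibres is stated explicitly because \<^const>\<open>card\<close> is 0 on infinite sets.\<close>

definition has_multiplicity ::
    "(complex ^ 'n \<Rightarrow> complex ^ 'n) \<Rightarrow> (complex ^ 'n) set \<Rightarrow> (complex ^ 'n) set \<Rightarrow> nat \<Rightarrow> bool" where
  "has_multiplicity f U V N \<longleftrightarrow>
     (\<forall>w\<in>V - critical_values f U. finite {z \<in> U. f z = w} \<and> card {z \<in> U. f z = w} = N) \<and>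
     (\<forall>w\<in>critical_values f U. finite {z \<in> U. f z = w} \<and> card {z \<in> U. f z = w} < N)"


section \<open>Multiplicity of isolated zeros\<close>

definition zeros_on :: "(complex ^ 'n \<Rightarrow> complex ^ 'n) \<Rightarrow> (complex ^ 'n) set \<Rightarrow> (complex ^ 'n) set"
  where "zeros_on f U = {z \<in> U. f z = 0}"

text \<open>The count of simple zeros of \<open>f - w\<close> must be the same number \<open>\<mu>\<close> for every admissible
  neighbourhood \<open>N\<close> and almost every small \<open>w\<close>. Since \<open>a\<close> is an isolated zero, admissible
  neighbourhoods exist, so \<open>\<mu>\<close> is determined by \<open>f\<close> and \<open>a\<close>.\<close>

definition has_zero_multiplicity ::
    "(complex ^ 'n \<Rightarrow> complex ^ 'n) \<Rightarrow> (complex ^ 'n) set \<Rightarrow> complex ^ 'n \<Rightarrow> nat \<Rightarrow> bool" where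
  "has_zero_multiplicity f U a \<mu> \<longleftrightarrow>
     open U \<and> holomorphic_map_on f U \<and> a isolated_in zeros_on f U \<and>
     (\<forall>N. open N \<and> a \<in> N \<and> compact (closure N) \<and> closure N \<subseteq> U \<and> zeros_on f (closure N) = {a} \<longrightarrow>
       (\<exists>\<epsilon>>0. AE w in lebesgue. w \<in> ball 0 \<epsilon> \<longrightarrow>
          (\<forall>z\<in>zeros_on (\<lambda>z. f z - w) N. jacobian_det (\<lambda>z. f z - w) z \<noteq> 0) \<and>
          finite (zeros_on (\<lambda>z. f z - w) N) \<and> card (zeros_on (\<lambda>z. f z - w) N) = \<mu>))"

definition has_solution_count ::
    "(complex ^ 'n \<Rightarrow> complex ^ 'n) \<Rightarrow> (complex ^ 'n) set \<Rightarrow> complex ^ 'n \<Rightarrow> nat \<Rightarrow> bool" where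
  "has_solution_count f U w N \<longleftrightarrow>
     finite (zeros_on (\<lambda>z. f z - w) U) \<and>
     (\<exists>\<mu>. (\<forall>a\<in>zeros_on (\<lambda>z. f z - w) U. has_zero_multiplicity (\<lambda>z. f z - w) U a (\<mu> a)) \<and>
          N = (\<Sum>a\<in>zeros_on (\<lambda>z. f z - w) U. \<mu> a))"


section \<open>The map of the theorem\<close>

text \<open>Coordinates are indexed by the integers modulo \<open>k = CARD('k)\<close>, so that index
  addition is addition modulo \<open>k\<close>; \<open>mod_idx\<close> maps a natural number to its class.\<close>

definition mod_idx :: "nat \<Rightarrow> 'k::finite mod_ring" where
  "mod_idx i = of_int_mod_ring (int i)"

definition cstar_space :: "(complex ^ 'n) set" where
  "cstar_space = {c. \<forall>a. c $ a \<noteq> 0}"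

definition chi_map ::
    "nat \<Rightarrow> nat \<Rightarrow> nat \<Rightarrow> complex ^ ('k::finite mod_ring) \<Rightarrow> complex ^ ('k mod_ring)" where
  "chi_map p g m c = (\<chi> a.
     c $ a + 1 / c $ (a + mod_idx m) +
     (\<Sum>i<CARD('k). \<Sum>j<CARD('k).
        of_nat (coset_succ_count p CARD('k) g i j) * (c $ (a + mod_idx j) / c $ (a + mod_idx i))))"

end

theory Submission imports Defs "HOL-Complex_Analysis.Complex_Analysis" begin

no_notation fps_nth (infixl "$" 75)
hide_const (open) up_ring.monom up_ring.coeff module.smult

section \<open>S1\<close>

definition ieval :: "complex \<Rightarrow> int poly \<Rightarrow> complex" where
  "ieval z q = poly (of_int_poly q) z"

lemma ieval_hom [simp]:
  "ieval z 0 = 0" "ieval z 1 = 1"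
  "ieval z (q + r) = ieval z q + ieval z r"
  "ieval z (q - r) = ieval z q - ieval z r"
  "ieval z (- q) = - ieval z q"
  "ieval z (q * r) = ieval z q * ieval z r"
  "ieval z (q ^ n) = ieval z q ^ n"
  "ieval z [:c:] = of_int c"
  "ieval z (monom c n) = of_int c * z ^ n"
  by (simp_all add: ieval_def hom_distribs map_poly_monom poly_monom)

lemma ieval_pCons [simp]: "ieval z (pCons c q) = of_int c + z * ieval z q"
  by (simp add: ieval_def of_int_hom.map_poly_pCons_hom)

lemma ieval_smult [simp]: "ieval z (smult c q) = of_int c * ieval z q"
  by (simp add: ieval_def hom_distribs)

lemma ieval_sum [simp]: "ieval z (\<Sum>a\<in>A. q a) = (\<Sum>a\<in>A. ieval z (q a))"
  by (induction A rule: infinite_finite_induct) auto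

lemma ieval_reduce_degree:
  assumes "z ^ p = 1" and "p > 0"
  obtains r where "degree r < p" and "ieval z r = ieval z q"
proof
  let ?r = "\<Sum>i\<le>degree q. monom (coeff q i) (i mod p)"
  show "degree ?r < p"
  proof (rule degree_sum_less)
    fix i assume "i \<in> {..degree q}"
    have "degree (monom (coeff q i) (i mod p)) \<le> i mod p" by (rule degree_monom_le)
    also have "\<dots> < p" using assms by simp
    finally show "degree (monom (coeff q i) (i mod p)) < p" .
  qed (use assms in auto)
  have zmod: "z ^ (i mod p) = z ^ i" for i
  proof -
    have "z ^ i = z ^ (p * (i div p) + i mod p)" by simp
    then show ?thesis unfolding power_add power_mult using assms by simp
  qed
  have "ieval z q = ieval z (\<Sum>i\<le>degree q. monom (coeff q i) i)"
    by (simp only: poly_as_sum_of_monoms)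
  then show "ieval z ?r = ieval z q" by (simp add: zmod)
qed

lemma not_unit_in_cyclotomic_integers:
  assumes "z ^ p = 1" and p: "p \<ge> 2"
  shows "of_nat p * ieval z u \<noteq> 1"
proof
  assume u: "of_nat p * ieval z u = 1"
  define ann where "ann m \<longleftrightarrow> m \<noteq> 0 \<and> ieval z m = 0" for m
  have "ann (monom 1 p - 1)"
  proof -
    have "coeff (monom 1 p - 1 :: int poly) p = 1" using p by (simp add: coeff_1)
    then have "monom 1 p - 1 \<noteq> (0 :: int poly)" by force
    then show ?thesis using assms by (simp add: ann_def)
  qed
  then obtain m where m: "ann m" and least: "\<And>r. ann r \<Longrightarrow> degree m \<le> degree r"
    using ex_has_least_nat[of ann _ degree] by metis
  have dm: "degree m > 0"
    using m by (cases "degree m = 0") (auto simp: ann_def elim!: degree_eq_zeroE)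
  define L where "L = lead_coeff m"
  have L0: "L \<noteq> 0" using m by (simp add: ann_def L_def)
  have dvd: "int p ^ n dvd L ^ p" for n
  proof -
    obtain f where f: "degree f < p" "ieval z f = ieval z (u ^ n)"
      using ieval_reduce_degree[OF assms(1), of "u ^ n"] p by auto
    have fz: "of_nat p ^ n * ieval z f = 1"
      using u by (simp add: f power_mult_distrib[symmetric])
    define e where "e = Suc (degree f) - degree m"
    obtain q r where qr: "pseudo_divmod f m = (q, r)" by (cases "pseudo_divmod f m")
    have m0: "m \<noteq> 0" using m by (simp add: ann_def)
    have eq: "smult (L ^ e) f = m * q + r" and r: "r = 0 \<or> degree r < degree m"
      using pseudo_divmod[OF m0 qr] by (auto simp: L_def e_def)
    have Lf: "of_int (L ^ e) * ieval z f = ieval z r"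
      using arg_cong[OF eq, of "ieval z"] m by (simp add: ann_def)
    let ?g = "smult (int p ^ n) r - [:L ^ e:]"
    have "ieval z ?g = of_int (L ^ e) * (of_nat p ^ n * ieval z f) - of_int (L ^ e)"
      by (simp add: Lf[symmetric])
    then have "ieval z ?g = 0" by (simp add: fz)
    moreover have "degree ?g < degree m"
      using r dm by (intro degree_diff_less) (auto intro: le_less_trans[OF degree_smult_le])
    ultimately have "?g = 0" using least[of ?g] by (auto simp: ann_def)
    then have "coeff ?g 0 = 0" by simp
    then have "int p ^ n dvd L ^ e" by (metis coeff_diff coeff_pCons_0 coeff_smult dvd_triv_left
          eq_iff_diff_eq_0)
    also have "L ^ e dvd L ^ p" using f by (intro le_imp_power_dvd) (simp add: e_def)
    finally show ?thesis .
  qed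
  define N where "N = nat \<bar>L ^ p\<bar>"
  have "int p ^ N \<le> \<bar>L ^ p\<bar>"
    using dvd_imp_le_int[OF _ dvd[of N]] L0 by simp
  moreover have "N < p ^ N" using p by (simp add: power_gt_expt)
  then have "int N < int p ^ N" by (metis of_nat_less_iff of_nat_power)
  ultimately show False by (simp add: N_def)
qed

lemma prime_dvd_value_at_1:
  assumes p: "prime p" and z: "z ^ p = 1" and q: "ieval z q = 0"
  shows "int p dvd poly q 1"
proof (rule ccontr)
  assume nd: "\<not> int p dvd poly q 1"
  define c where "c = poly q 1"
  have "[:-1, 1:] dvd q - [:c:]"
    using poly_eq_0_iff_dvd[of "q - [:c:]" 1] by (simp add: c_def)
  then obtain q1 where "q - [:c:] = [:-1, 1:] * q1" by (auto elim: dvdE)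
  then have "q = [:c:] + [:-1, 1:] * q1" by (simp add: algebra_simps)
  from arg_cong[OF this, of "ieval z"] q have c: "of_int c = (1 - z) * ieval z q1"
    by (simp add: algebra_simps)
  have "\<exists>r. (1 - z) ^ p = of_nat p * ieval z r"
  proof -
    have p2: "p \<ge> 2" using p by (rule prime_ge_2_nat)
    have "\<exists>k. \<forall>i\<in>{1..<p}. p choose i = p * k i"
      using dvd_choose_prime[of _ p] p by (intro bchoice) (auto simp: dvd_def)
    then obtain k where k: "\<And>i. i \<in> {1..<p} \<Longrightarrow> p choose i = p * k i" by blast
    have "1 + (- 1) ^ p = (of_nat p * (if p = 2 then 1 else 0) :: complex)"
      using prime_odd_nat[OF p] p2 by (cases "p = 2") auto
    then obtain d :: int where d: "1 + (- 1) ^ p = (of_nat p * of_int d :: complex)"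
      by (metis of_int_0 of_int_1)
    have split: "{..p} = insert 0 (insert p {1..<p})" using p2 by auto
    have "(1 - z) ^ p = (\<Sum>i\<le>p. of_nat (p choose i) * (- z) ^ i)"
      using binomial_ring[of "- z" 1 p] by simp
    also have "\<dots> = 1 + (- z) ^ p + (\<Sum>i\<in>{1..<p}. of_nat (p choose i) * (- z) ^ i)"
      unfolding split using p2 by simp
    also have "(- z) ^ p = (- 1) ^ p" using z by (simp add: power_minus[of z])
    also have "(\<Sum>i\<in>{1..<p}. of_nat (p choose i) * (- z) ^ i)
      = of_nat p * ieval z (\<Sum>i\<in>{1..<p}. monom ((- 1) ^ i * int (k i)) i)"
      unfolding ieval_sum sum_distrib_left
      by (intro sum.cong refl) (simp add: k power_minus[of z] del: power_minus_odd)
    finally have "(1 - z) ^ p = of_nat p * ieval z ([:d:] + (\<Sum>i\<in>{1..<p}. monom ((- 1) ^ i * int (k i)) i))"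
      using d by (simp add: algebra_simps)
    then show ?thesis by blast
  qed
  then obtain r where r: "(1 - z) ^ p = of_nat p * ieval z r" by blast
  have cp: "of_int (c ^ p) = of_nat p * ieval z (r * q1 ^ p)"
    by (simp add: c power_mult_distrib r mult.assoc)
  have "coprime (c ^ p) (int p)"
    using nd p by (auto simp: c_def prime_imp_coprime coprime_commute)
  then obtain a b where "a * c ^ p + b * int p = 1"
    using bezout_int[of "c ^ p" "int p"] by (auto simp: coprime_iff_gcd_eq_1)
  then have "of_int (a * c ^ p + b * int p) = (1 :: complex)" by simp
  then have "of_nat p * ieval z ([:a:] * (r * q1 ^ p) + [:b:]) = 1"
    using cp by (simp add: algebra_simps)
  with not_unit_in_cyclotomic_integers[OF z prime_ge_2_nat[OF p]] show False by blast
qed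

lemma diagonal_mod_prime_nonsingular:
  assumes p: "prime p" and z: "z ^ p = 1" and "finite A"
    and "\<And>j. j \<in> A \<Longrightarrow> (\<Sum>a\<in>A. ieval z (G j a) * f a) = 0"
    and "\<And>j. j \<in> A \<Longrightarrow> \<not> int p dvd poly (G j j) 1"
    and "\<And>j a. j \<in> A \<Longrightarrow> a \<in> A \<Longrightarrow> j \<noteq> a \<Longrightarrow> int p dvd poly (G j a) 1"
  shows "\<forall>a\<in>A. f a = 0"
  using assms(3-)
proof (induction A arbitrary: G rule: finite_induct)
  case (insert b A)
  define G' where "G' j a = G j a * G b b - G j b * G b a" for j a
  have row: "(\<Sum>a\<in>A. ieval z (G j a) * f a) = - (ieval z (G j b) * f b)" if "j \<in> insert b A" for j
    using insert.prems(1)[OF that] insert.hyps by (simp add: add_eq_0_iff)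
  have pp: "prime (int p)" using p by simp
  have "\<forall>a\<in>A. f a = 0"
  proof (rule insert.IH)
    fix j assume j: "j \<in> A"
    have "(\<Sum>a\<in>A. ieval z (G' j a) * f a) =
      ieval z (G b b) * (\<Sum>a\<in>A. ieval z (G j a) * f a) -
      ieval z (G j b) * (\<Sum>a\<in>A. ieval z (G b a) * f a)"
      unfolding sum_distrib_left sum_subtractf[symmetric]
      by (intro sum.cong refl) (simp add: G'_def algebra_simps)
    also have "\<dots> = 0" using row[of j] row[of b] j by simp
    finally show "(\<Sum>a\<in>A. ieval z (G' j a) * f a) = 0" .
    have "j \<noteq> b" using j insert.hyps by auto
    then have 1: "int p dvd poly (G j b) 1" using insert.prems(3) j by auto
    then have "int p dvd poly (G j b) 1 * poly (G b j) 1" by simp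
    moreover have "\<not> int p dvd poly (G j j) 1 * poly (G b b) 1"
      using insert.prems(2)[of j] insert.prems(2)[of b] j prime_dvd_mult_iff[OF pp] by auto
    ultimately show "\<not> int p dvd poly (G' j j) 1"
      by (simp add: G'_def) (metis diff_add_cancel dvd_add)
    show "int p dvd poly (G' j a) 1" if "a \<in> A" "j \<noteq> a" for a
      using 1 insert.prems(3)[of j a] that j by (auto simp: G'_def intro!: dvd_diff)
  qed
  moreover from this have "ieval z (G b b) * f b = 0"
    using row[of b] by simp
  then have "f b = 0"
    using prime_dvd_value_at_1[OF p z, of "G b b"] insert.prems(2)[of b] by auto
  ultimately show ?case by simp
qed simp

fun divided_diff :: "(nat \<Rightarrow> 'a::comm_ring_1) \<Rightarrow> nat \<Rightarrow> nat \<Rightarrow> 'a" where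
  "divided_diff x 0 a = x 0 ^ a"
| "divided_diff x (Suc i) 0 = 0"
| "divided_diff x (Suc i) (Suc a) = divided_diff x i a + x (Suc i) * divided_diff x (Suc i) a"

lemma newton_partial:
  "(\<Sum>i\<le>j. divided_diff x i (Suc a) * (\<Prod>l<i. y - x l)) =
    y * (\<Sum>i\<le>j. divided_diff x i a * (\<Prod>l<i. y - x l)) - divided_diff x j a * (\<Prod>l<Suc j. y - x l)"
  by (induction j) (simp_all add: algebra_simps)

lemma newton_interpolation:
  "(\<Sum>i\<le>j. divided_diff x i a * (\<Prod>l<i. x j - x l)) = x j ^ a"
proof (induction a)
  case 0
  show ?case by (induction j) (auto simp: sum.atMost_shift)
next
  case (Suc a)
  then show ?case unfolding newton_partial by simp
qed

lemma ieval_divided_diff: "ieval z (divided_diff x i a) = divided_diff (\<lambda>n. ieval z (x n)) i a"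
  by (induction x i a rule: divided_diff.induct) simp_all

lemma divided_diff_at_1:
  assumes "\<And>n. poly (x n) 1 = (1::int)"
  shows "poly (divided_diff x i a) 1 = int (a choose i)"
  using assms by (induction x i a rule: divided_diff.induct) simp_all

lemma product_as_binomial_sum:
  assumes "finite S"
  shows "\<exists>c :: nat \<Rightarrow> int. \<forall>x. (\<Prod>s\<in>S. int x - int s) = (\<Sum>i\<le>card S. c i * int (x choose i))"
  using assms
proof (induction S rule: finite_induct)
  case empty
  show ?case by (rule exI[of _ "\<lambda>_. 1"]) simp
next
  case (insert s S)
  then obtain c where c: "\<And>x. (\<Prod>s\<in>S. int x - int s) = (\<Sum>i\<le>card S. c i * int (x choose i))" by blast
  have absorb: "(int x - int i) * int (x choose i) = int (Suc i) * int (x choose Suc i)" for x i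
  proof (cases "i \<le> x")
    case True
    have "Suc i * (x choose Suc i) = (x - i) * (x choose i)"
      using binomial_absorption[of i x] binomial_absorb_comp[of x i] by simp
    then have "int (Suc i * (x choose Suc i)) = int ((x - i) * (x choose i))" by simp
    then show ?thesis by (metis True of_nat_diff of_nat_mult)
  qed (simp add: binomial_eq_0)
  define d where "d i = (if i \<le> card S then c i * (int i - int s) else 0)
    + (case i of 0 \<Rightarrow> 0 | Suc j \<Rightarrow> c j * int (Suc j))" for i
  have "(\<Prod>s\<in>insert s S. int x - int s) = (\<Sum>i\<le>Suc (card S). d i * int (x choose i))" for x
  proof -
    have "(\<Prod>s\<in>insert s S. int x - int s) = (int x - int s) * (\<Sum>i\<le>card S. c i * int (x choose i))"
      using insert.hyps c by simp
    also have "\<dots> = (\<Sum>i\<le>card S. c i * (int i - int s) * int (x choose i))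
       + (\<Sum>i\<le>card S. c i * ((int x - int i) * int (x choose i)))"
      by (simp add: sum_distrib_left sum.distrib[symmetric] algebra_simps)
    also have "(\<Sum>i\<le>card S. c i * ((int x - int i) * int (x choose i)))
      = (\<Sum>i\<le>card S. c i * int (Suc i) * int (x choose Suc i))"
      by (simp only: absorb mult.assoc)
    also have "\<dots> = (\<Sum>i\<le>Suc (card S). (case i of 0 \<Rightarrow> 0 | Suc j \<Rightarrow> c j * int (Suc j)) * int (x choose i))"
      by (subst sum.atMost_Suc_shift) simp
    also have "(\<Sum>i\<le>card S. c i * (int i - int s) * int (x choose i))
      = (\<Sum>i\<le>Suc (card S). (if i \<le> card S then c i * (int i - int s) else 0) * int (x choose i))"
      by simp
    finally show ?thesis
      by (simp add: d_def sum.distrib[symmetric] algebra_simps del: sum.atMost_Suc)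
  qed
  then show ?case using insert.hyps by auto
qed

lemma root_of_unity_powers_distinct:
  fixes z :: complex
  assumes p: "prime p" and z: "z ^ p = 1" "z \<noteq> 1" and ij: "i < p" "j < p" "z ^ i = z ^ j"
  shows "i = j"
proof -
  have *: False if "i < j" "j < p" "z ^ i = z ^ j" for i j
  proof -
    have z0: "z \<noteq> 0" using z p by (auto simp: power_0_left split: if_splits)
    have "z ^ i * z ^ (j - i) = z ^ j"
      using that(1) by (metis le_add_diff_inverse less_imp_le power_add)
    then have 1: "z ^ (j - i) = 1" using z0 that(3) by simp
    have "coprime (j - i) p"
      using that by (metis coprime_commute diff_is_0_eq dvd_imp_le less_imp_diff_less not_less p
          prime_imp_coprime zero_less_diff)
    then obtain x where "[(j - i) * x = 1] (mod p)" using cong_solve_coprime_nat by auto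
    then have "((j - i) * x) mod p = 1" using prime_gt_1_nat[OF p] by (simp add: cong_def)
    then obtain y where y: "(j - i) * x = y * p + 1" by (metis div_mult_mod_eq)
    have "z ^ ((j - i) * x) = 1" "z ^ (y * p) = 1"
      using 1 z by (simp_all add: power_mult mult.commute[of y])
    then have "z ^ 1 = 1" unfolding y power_add by simp
    then show False using z by simp
  qed
  show ?thesis using *[of i j] *[of j i] ij by (metis linorder_neqE_nat)
qed

lemma chebotarev_minors:
  fixes f :: "nat \<Rightarrow> complex"
  assumes p: "prime p" and z: "z ^ p = 1" "z \<noteq> 1"
    and A: "A \<subseteq> {..<p}" "card A = r" and t: "inj_on t {..<r}" "t ` {..<r} \<subseteq> {..<p}"
    and f: "\<And>i. i < r \<Longrightarrow> (\<Sum>a\<in>A. f a * z ^ (a * t i)) = 0"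
  shows "\<forall>a\<in>A. f a = 0"
proof -
  have finA: "finite A" using A finite_subset by blast
  define x where "x i = (monom 1 (t i) :: int poly)" for i
  define y where "y i = z ^ t i" for i
  have y: "ieval z (x i) = y i" for i by (simp add: x_def y_def)
  have ydist: "y i \<noteq> y l" if "l < i" "i < r" for i l
  proof
    assume "y i = y l"
    then have "t i = t l"
      using root_of_unity_powers_distinct[OF p z, of "t i" "t l"] t(2) that
      by (simp add: y_def image_subset_iff)
    then have "i = l" by (rule inj_onD[OF t(1)]) (use that in auto)
    then show False using that by simp
  qed
  have dd0: "(\<Sum>a\<in>A. f a * divided_diff y j a) = 0" if "j < r" for j
    using that
  proof (induction j rule: less_induct)
    case (less j)
    define N where "N i = (\<Prod>l<i. y j - y l)" for i
    have "0 = (\<Sum>a\<in>A. f a * y j ^ a)"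
      using f[OF less.prems] by (simp add: y_def power_mult[symmetric] mult.commute)
    also have "\<dots> = (\<Sum>a\<in>A. \<Sum>i\<le>j. f a * divided_diff y i a * N i)"
      unfolding N_def mult.assoc sum_distrib_left[symmetric] newton_interpolation ..
    also have "\<dots> = (\<Sum>i\<le>j. \<Sum>a\<in>A. f a * divided_diff y i a * N i)"
      by (rule sum.swap)
    also have "\<dots> = (\<Sum>i\<le>j. (\<Sum>a\<in>A. f a * divided_diff y i a) * N i)"
      by (simp add: sum_distrib_right)
    also have "\<dots> = (\<Sum>i\<in>{j}. (\<Sum>a\<in>A. f a * divided_diff y i a) * N i)"
      by (rule sum.mono_neutral_right) (use less in auto)
    finally have "(\<Sum>a\<in>A. f a * divided_diff y j a) * N j = 0" by simp
    moreover have "N j \<noteq> 0" using ydist less.prems by (simp add: N_def)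
    ultimately show ?case by simp
  qed
  have "\<forall>j. \<exists>c :: nat \<Rightarrow> int. \<forall>x. (\<Prod>s\<in>A - {j}. int x - int s) = (\<Sum>i\<le>card (A - {j}). c i * int (x choose i))"
    using product_as_binomial_sum finA by blast
  then obtain c :: "nat \<Rightarrow> nat \<Rightarrow> int" where
    c: "\<And>j x. (\<Prod>s\<in>A - {j}. int x - int s) = (\<Sum>i\<le>card (A - {j}). c j i * int (x choose i))"
    by metis
  define G where "G j a = (\<Sum>i<r. [:c j i:] * divided_diff x i a)" for j a
  have G1: "poly (G j a) 1 = (\<Prod>s\<in>A - {j}. int a - int s)" if "j \<in> A" for j a
  proof -
    have "r > 0" using that A finA by (metis card_gt_0_iff empty_iff)
    then have "{..card (A - {j})} = {..<r}" using that A finA by auto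
    then show ?thesis
      by (simp add: G_def c poly_sum divided_diff_at_1 x_def poly_monom)
  qed
  show ?thesis
  proof (rule diagonal_mod_prime_nonsingular[OF p z(1) finA, where G = G])
    fix j assume j: "j \<in> A"
    have "(\<Sum>a\<in>A. ieval z (G j a) * f a) = (\<Sum>a\<in>A. \<Sum>i<r. of_int (c j i) * (f a * divided_diff y i a))"
      by (simp add: G_def ieval_divided_diff y sum_distrib_left mult_ac)
    also have "\<dots> = (\<Sum>i<r. \<Sum>a\<in>A. of_int (c j i) * (f a * divided_diff y i a))"
      by (rule sum.swap)
    also have "\<dots> = 0" by (simp add: dd0 sum_distrib_left[symmetric])
    finally show "(\<Sum>a\<in>A. ieval z (G j a) * f a) = 0" .
    show "\<not> int p dvd poly (G j j) 1"
    proof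
      assume "int p dvd poly (G j j) 1"
      then obtain s where s: "s \<in> A - {j}" "int p dvd int j - int s"
        using p finA by (auto simp: G1[OF j] prime_dvd_prod_iff)
      then have "s = j"
        using j A(1) zdvd_not_zless[of "int j - int s" "int p"] zdvd_not_zless[of "int s - int j" "int p"]
        by (force simp: dvd_diff_commute)
      then show False using s by simp
    qed
  next
    fix j a assume "j \<in> A" "a \<in> A" "j \<noteq> a"
    then have "(\<Prod>s\<in>A - {j}. int a - int s) = 0" using finA by (intro prod_zero) auto
    then show "int p dvd poly (G j a) 1" using \<open>j \<in> A\<close> by (simp add: G1)
  qed
qed

theorem uncertainty_principle_prime:
  fixes f :: "nat \<Rightarrow> complex"
  assumes p: "prime p" and z: "z ^ p = 1" "z \<noteq> 1" and "b < p" "f b \<noteq> 0"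
  shows "p + 1 \<le> card {b. b < p \<and> f b \<noteq> 0} + card {t. t < p \<and> (\<Sum>b<p. f b * z ^ (b * t)) \<noteq> 0}"
proof (rule ccontr)
  define A where "A = {b. b < p \<and> f b \<noteq> 0}"
  define r where "r = card A"
  define T where "T = {t. t < p \<and> (\<Sum>b<p. f b * z ^ (b * t)) = 0}"
  assume "\<not> ?thesis"
  moreover have "card {t. t < p \<and> (\<Sum>b<p. f b * z ^ (b * t)) \<noteq> 0} + card T = p"
  proof -
    have "{t. t < p \<and> (\<Sum>b<p. f b * z ^ (b * t)) \<noteq> 0} = {..<p} - T" by (auto simp: T_def)
    moreover have "card ({..<p} - T) = p - card T"
      by (subst card_Diff_subset) (auto simp: T_def)
    moreover have "card T \<le> card {..<p}" by (intro card_mono) (auto simp: T_def)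
    ultimately show ?thesis by simp
  qed
  ultimately have "r \<le> card T" by (simp add: A_def r_def)
  then obtain T' where T': "T' \<subseteq> T" "card T' = r" by (meson obtain_subset_with_card_n)
  have "finite T'" using T'(1) by (rule finite_subset) (auto simp: T_def)
  then obtain t where t: "bij_betw t {..<r} T'"
    using T'(2) by (metis ex_bij_betw_nat_finite lessThan_atLeast0)
  have "\<forall>a\<in>A. f a = 0"
  proof (rule chebotarev_minors[OF p z _ r_def[symmetric]])
    show "A \<subseteq> {..<p}" by (auto simp: A_def)
    show "inj_on t {..<r}" using t by (simp add: bij_betw_def)
    show "t ` {..<r} \<subseteq> {..<p}" using t T'(1) by (auto simp: bij_betw_def T_def)
    fix i assume "i < r"
    then have "t i \<in> T" using t T'(1) by (auto simp: bij_betw_def)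
    then have "0 = (\<Sum>b<p. f b * z ^ (b * t i))" by (simp add: T_def)
    also have "\<dots> = (\<Sum>a\<in>A. f a * z ^ (a * t i))"
      by (rule sum.mono_neutral_right) (auto simp: A_def)
    finally show "(\<Sum>a\<in>A. f a * z ^ (a * t i)) = 0" by simp
  qed
  then show False using assms(4,5) by (auto simp: A_def)
qed

section \<open>S2\<close>

inductive polyfn :: "nat \<Rightarrow> (complex ^ 'n \<Rightarrow> complex) \<Rightarrow> bool" where
  polyfn_const: "polyfn d (\<lambda>z. c)"
| polyfn_coord: "polyfn (Suc d) (\<lambda>z. z $ i)"
| polyfn_add: "polyfn d f \<Longrightarrow> polyfn d g \<Longrightarrow> polyfn d (\<lambda>z. f z + g z)"
| polyfn_mult: "polyfn d f \<Longrightarrow> polyfn e g \<Longrightarrow> polyfn (d + e) (\<lambda>z. f z * g z)"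

lemma polyfn_mono: "polyfn d f \<Longrightarrow> d \<le> e \<Longrightarrow> polyfn e f"
proof (induction arbitrary: e rule: polyfn.induct)
  case (polyfn_coord d i)
  then show ?case using polyfn.polyfn_coord[of "e - 1" i] by (cases e) auto
next
  case (polyfn_mult d f d' g)
  then have "polyfn d f" "polyfn (e - d) g" by auto
  from polyfn.polyfn_mult[OF this] show ?case using polyfn_mult.prems by simp
qed (auto intro: polyfn.intros)

lemma polyfn_cmult: "polyfn d f \<Longrightarrow> polyfn d (\<lambda>z. c * f z)"
  using polyfn_mult[OF polyfn_const[of 0 c]] by simp

lemma polyfn_diff: "polyfn d f \<Longrightarrow> polyfn d g \<Longrightarrow> polyfn d (\<lambda>z. f z - g z)"
  using polyfn_add[OF _ polyfn_cmult[of d g "- 1"]] by simp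

lemma polyfn_sum: "(\<And>a. a \<in> A \<Longrightarrow> polyfn d (f a)) \<Longrightarrow> polyfn d (\<lambda>z. \<Sum>a\<in>A. f a z)"
  by (induction A rule: infinite_finite_induct) (auto intro: polyfn.intros)

lemma polyfn_prod:
  "(\<And>a. a \<in> A \<Longrightarrow> polyfn (d a) (f a)) \<Longrightarrow> polyfn (\<Sum>a\<in>A. d a) (\<lambda>z. \<Prod>a\<in>A. f a z)"
  by (induction A rule: infinite_finite_induct) (auto intro: polyfn.intros)

lemma polyfn_power: "polyfn d f \<Longrightarrow> polyfn (d * n) (\<lambda>z. f z ^ n)"
  by (induction n) (auto intro: polyfn.intros)

lemma polyfn_det:
  fixes A :: "'n::finite \<Rightarrow> 'n \<Rightarrow> complex ^ 'm \<Rightarrow> complex"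
  assumes "\<And>i j. polyfn d (A i j)"
  shows "polyfn (d * CARD('n)) (\<lambda>z. det (\<chi> i j. A i j z))"
proof -
  have "polyfn (d * CARD('n)) (\<lambda>z. \<Prod>i\<in>UNIV. A i (\<sigma> i) z)" for \<sigma>
    using polyfn_prod[of UNIV "\<lambda>_. d" "\<lambda>i. A i (\<sigma> i)"] assms by (simp add: mult.commute)
  then have "polyfn (d * CARD('n)) (\<lambda>z. \<Sum>\<sigma> | \<sigma> permutes (UNIV :: 'n set).
      of_int (sign \<sigma>) * (\<Prod>i\<in>UNIV. A i (\<sigma> i) z))"
    by (intro polyfn_sum polyfn_cmult)
  then show ?thesis by (simp add: det_def)
qed

lemma polyfn_on_line:
  assumes "polyfn d f"
  shows "\<exists>q. degree q \<le> d \<and> (\<forall>s. f (z + s *s v) = poly q s)"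
  using assms
proof (induction rule: polyfn.induct)
  case (polyfn_const d c)
  show ?case by (rule exI[of _ "[:c:]"]) simp
next
  case (polyfn_coord d i)
  show ?case by (rule exI[of _ "[:z $ i, v $ i:]"]) simp
next
  case (polyfn_add d f g)
  then obtain q r where "degree q \<le> d" "degree r \<le> d"
    "\<And>s. f (z + s *s v) = poly q s" "\<And>s. g (z + s *s v) = poly r s" by blast
  then show ?case by (intro exI[of _ "q + r"]) (auto intro: degree_add_le)
next
  case (polyfn_mult d f e g)
  then obtain q r where "degree q \<le> d" "degree r \<le> e"
    "\<And>s. f (z + s *s v) = poly q s" "\<And>s. g (z + s *s v) = poly r s" by blast
  then show ?case
    by (intro exI[of _ "q * r"]) (auto intro!: order_trans[OF degree_mult_le])
qed

lemma polyfn_has_derivative: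
  assumes "polyfn d f"
  shows "\<exists>f'. (\<forall>i. polyfn d (f' i)) \<and> (\<forall>z. (f has_derivative (\<lambda>h. \<Sum>i\<in>UNIV. f' i z * h $ i)) (at z))"
  using assms
proof (induction rule: polyfn.induct)
  case (polyfn_const d c)
  show ?case by (rule exI[of _ "\<lambda>_ _. 0"]) (auto intro: polyfn.intros)
next
  case (polyfn_coord d j)
  have "(\<Sum>i\<in>UNIV. (if i = j then 1 else 0) * h $ i) = h $ j" for h :: "complex ^ 'a"
    by (simp add: if_distrib[of "\<lambda>x. x * _"] cong: if_cong)
  then show ?case
    by (intro exI[of _ "\<lambda>i _. if i = j then 1 else 0"])
      (auto intro!: polyfn.polyfn_const bounded_linear_imp_has_derivative bounded_linear_vec_nth)
next
  case (polyfn_add d f g)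
  then obtain f' g' where *: "\<And>i. polyfn d (f' i)" "\<And>i. polyfn d (g' i)"
    and D: "\<And>z. (f has_derivative (\<lambda>h. \<Sum>i\<in>UNIV. f' i z * h $ i)) (at z)"
      "\<And>z. (g has_derivative (\<lambda>h. \<Sum>i\<in>UNIV. g' i z * h $ i)) (at z)"
    by blast
  have "((\<lambda>z. f z + g z) has_derivative (\<lambda>h. \<Sum>i\<in>UNIV. (f' i z + g' i z) * h $ i)) (at z)" for z
    using has_derivative_add[OF D] by (simp add: algebra_simps sum.distrib)
  then show ?case using *
    by (intro exI[of _ "\<lambda>i z. f' i z + g' i z"]) (auto intro: polyfn.intros)
next
  case (polyfn_mult d f e g)
  then obtain f' g' where *: "\<And>i. polyfn d (f' i)" "\<And>i. polyfn e (g' i)"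
    and D: "\<And>z. (f has_derivative (\<lambda>h. \<Sum>i\<in>UNIV. f' i z * h $ i)) (at z)"
      "\<And>z. (g has_derivative (\<lambda>h. \<Sum>i\<in>UNIV. g' i z * h $ i)) (at z)"
    by blast
  have "((\<lambda>z. f z * g z) has_derivative (\<lambda>h. \<Sum>i\<in>UNIV. (f z * g' i z + f' i z * g z) * h $ i)) (at z)" for z
    using has_derivative_mult[OF D]
    by (simp add: algebra_simps sum.distrib sum_distrib_left)
  then show ?case using * polyfn_mult.hyps
    by (intro exI[of _ "\<lambda>i z. f z * g' i z + f' i z * g z"] conjI allI
        polyfn.polyfn_add polyfn.polyfn_mult) auto
qed

lemma polyfn_continuous: "polyfn d f \<Longrightarrow> continuous_on S f"
  by (induction rule: polyfn.induct) (auto intro!: continuous_intros)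

definition mono_at :: "('n::finite \<Rightarrow> nat) \<Rightarrow> complex ^ 'n \<Rightarrow> complex" where
  "mono_at \<alpha> z = (\<Prod>i\<in>UNIV. z $ i ^ \<alpha> i)"

definition box_exps :: "nat \<Rightarrow> ('n::finite \<Rightarrow> nat) set" where
  "box_exps T = {\<alpha>. \<forall>i. \<alpha> i < T}"

lemma box_exps_eq: "box_exps T = (UNIV :: 'n::finite set) \<rightarrow>\<^sub>E {..<T}"
  by (auto simp: box_exps_def PiE_def Pi_def extensional_def)

lemma finite_box_exps [simp]: "finite (box_exps T :: ('n::finite \<Rightarrow> nat) set)"
  by (simp add: box_exps_eq finite_PiE)

lemma card_box_exps: "card (box_exps T :: ('n::finite \<Rightarrow> nat) set) = T ^ CARD('n)"
  by (simp add: box_exps_eq card_PiE)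

lemma polyfn_mono_at:
  assumes "\<alpha> \<in> box_exps T"
  shows "polyfn (T * CARD('n)) (mono_at \<alpha> :: complex ^ 'n::finite \<Rightarrow> complex)"
proof -
  have "polyfn (\<Sum>i\<in>(UNIV :: 'n set). 1 * \<alpha> i) (\<lambda>z. \<Prod>i\<in>(UNIV :: 'n set). z $ i ^ \<alpha> i)"
    using polyfn_coord[of 0] by (intro polyfn_prod polyfn_power) simp
  then have "polyfn (\<Sum>i\<in>(UNIV :: 'n set). \<alpha> i) (mono_at \<alpha>)"
    by (simp add: mono_at_def[abs_def])
  moreover have "(\<Sum>i\<in>(UNIV :: 'n set). \<alpha> i) \<le> T * CARD('n)"
    using sum_bounded_above[of "UNIV :: 'n set" \<alpha> T] assms
    by (auto simp: box_exps_def mult.commute less_imp_le)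
  ultimately show ?thesis by (rule polyfn_mono)
qed

lemma polyfn_normal_form:
  fixes f :: "complex ^ 'n \<Rightarrow> complex"
  assumes "polyfn d f"
  shows "\<exists>a. \<forall>z. f z = (\<Sum>\<alpha>\<in>box_exps (Suc d). a \<alpha> * mono_at \<alpha> z)"
  using assms
proof (induction rule: polyfn.induct)
  case (polyfn_const d c)
  have "(\<Sum>\<alpha>\<in>box_exps (Suc d). (if \<alpha> = (\<lambda>_. 0) then c else 0) * mono_at \<alpha> z) = c" for z :: "complex ^ 'n"
  proof -
    have "(\<Sum>\<alpha>\<in>box_exps (Suc d). (if \<alpha> = (\<lambda>_. 0) then c else 0) * mono_at \<alpha> z)
      = (\<Sum>\<alpha>\<in>{\<lambda>_. 0}. (if \<alpha> = (\<lambda>_. 0) then c else 0) * mono_at \<alpha> z)"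
      by (rule sum.mono_neutral_right, rule finite_box_exps, auto simp: box_exps_def)
    then show ?thesis by (simp add: mono_at_def)
  qed
  from this[symmetric] show ?case by (intro exI allI)
next
  case (polyfn_coord d j)
  let ?e = "\<lambda>i. if i = j then 1 else 0 :: nat"
  have "(\<Sum>\<alpha>\<in>box_exps (Suc (Suc d)). (if \<alpha> = ?e then 1 else 0) * mono_at \<alpha> z) = z $ j" for z :: "complex ^ 'n"
  proof -
    have "(\<Sum>\<alpha>\<in>box_exps (Suc (Suc d)). (if \<alpha> = ?e then 1 else 0) * mono_at \<alpha> z)
      = (\<Sum>\<alpha>\<in>{?e}. (if \<alpha> = ?e then 1 else 0) * mono_at \<alpha> z)"
      by (rule sum.mono_neutral_right, rule finite_box_exps, auto simp: box_exps_def)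
    also have "\<dots> = mono_at ?e z" by simp
    also have "\<dots> = (\<Prod>i\<in>UNIV. if i = j then z $ i else 1)"
      unfolding mono_at_def by (intro prod.cong) auto
    finally show ?thesis by simp
  qed
  from this[symmetric] show ?case by (intro exI allI)
next
  case (polyfn_add d f g)
  then obtain a b where "\<And>z. f z = (\<Sum>\<alpha>\<in>box_exps (Suc d). a \<alpha> * mono_at \<alpha> z)"
     "\<And>z. g z = (\<Sum>\<alpha>\<in>box_exps (Suc d). b \<alpha> * mono_at \<alpha> z)" by blast
  then show ?case
    by (intro exI[of _ "\<lambda>\<alpha>. a \<alpha> + b \<alpha>"]) (simp add: algebra_simps sum.distrib)
next
  case (polyfn_mult d f e g)
  then obtain a b where f: "\<And>z. f z = (\<Sum>\<alpha>\<in>box_exps (Suc d). a \<alpha> * mono_at \<alpha> z)"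
    and g: "\<And>z. g z = (\<Sum>\<alpha>\<in>box_exps (Suc e). b \<alpha> * mono_at \<alpha> z)" by blast
  define P where "P = (box_exps (Suc d) :: ('n \<Rightarrow> nat) set) \<times> (box_exps (Suc e) :: ('n \<Rightarrow> nat) set)"
  define s :: "('n \<Rightarrow> nat) \<times> ('n \<Rightarrow> nat) \<Rightarrow> 'n \<Rightarrow> nat" where "s p = (\<lambda>i. fst p i + snd p i)" for p
  define h where "h \<gamma> = (\<Sum>p\<in>{p\<in>P. s p = \<gamma>}. a (fst p) * b (snd p))" for \<gamma>
  have "f z * g z = (\<Sum>\<gamma>\<in>box_exps (Suc (d + e)). h \<gamma> * mono_at \<gamma> z)" for z
  proof -
    have "f z * g z = (\<Sum>p\<in>P. a (fst p) * b (snd p) * mono_at (s p) z)"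
      unfolding f g sum_product P_def sum.cartesian_product
      by (intro sum.cong) (auto simp: s_def mono_at_def power_add prod.distrib)
    also have "\<dots> = (\<Sum>\<gamma>\<in>box_exps (Suc (d + e)). \<Sum>p\<in>{p\<in>P. s p = \<gamma>}. a (fst p) * b (snd p) * mono_at (s p) z)"
    proof (rule sum.group[symmetric])
      show "finite P" by (simp add: P_def)
      show "s ` P \<subseteq> box_exps (Suc (d + e))"
        by (auto simp: P_def s_def box_exps_def less_Suc_eq_le intro: add_mono)
    qed simp
    also have "\<dots> = (\<Sum>\<gamma>\<in>box_exps (Suc (d + e)). h \<gamma> * mono_at \<gamma> z)"
      unfolding h_def sum_distrib_right by (intro sum.cong) auto
    finally show ?thesis .
  qed
  then show ?case by blast
qed

lemma homogeneous_system_nontrivial_solution: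
  fixes A :: "'e \<Rightarrow> 'i \<Rightarrow> 'a::field"
  assumes "finite E" "finite I" "card E < card I"
  shows "\<exists>x. (\<exists>i\<in>I. x i \<noteq> 0) \<and> (\<forall>e\<in>E. (\<Sum>i\<in>I. A e i * x i) = 0)"
  using assms
proof (induction E arbitrary: I A rule: finite_induct)
  case empty
  then obtain i where "i \<in> I" by fastforce
  then show ?case by (intro exI[of _ "\<lambda>_. 1"]) auto
next
  case (insert e E)
  show ?case
  proof (cases "\<forall>i\<in>I. A e i = 0")
    case True
    have "card E < card I" using insert by simp
    from insert.IH[OF insert.prems(1) this, of A] True show ?thesis by auto
  next
    case False
    then obtain k where k: "k \<in> I" "A e k \<noteq> 0" by blast
    define I' where "I' = I - {k}"
    have I: "I = insert k I'" "finite I'" "k \<notin> I'" using k insert.prems by (auto simp: I'_def)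
    have "card E < card I'" using insert I by simp
    from insert.IH[OF I(2) this, of "\<lambda>e' i. A e' i - A e' k * (A e i / A e k)"]
    obtain x where x: "\<exists>i\<in>I'. x i \<noteq> 0"
      and eq: "\<And>e'. e' \<in> E \<Longrightarrow> (\<Sum>i\<in>I'. (A e' i - A e' k * (A e i / A e k)) * x i) = 0" by blast
    define S where "S = (\<Sum>i\<in>I'. A e i * x i)"
    define y where "y = x(k := - S / A e k)"
    have sum: "(\<Sum>i\<in>I. A e' i * y i) = A e' k * (- S / A e k) + (\<Sum>i\<in>I'. A e' i * x i)" for e'
    proof -
      have "(\<Sum>i\<in>I'. A e' i * y i) = (\<Sum>i\<in>I'. A e' i * x i)"
        using I by (intro sum.cong) (auto simp: y_def)
      then show ?thesis using I by (simp add: y_def)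
    qed
    have "(\<Sum>i\<in>I. A e' i * y i) = 0" if "e' \<in> insert e E" for e'
    proof (cases "e' = e")
      case True
      then show ?thesis unfolding sum using k by (simp add: S_def)
    next
      case False
      then have "(\<Sum>i\<in>I'. A e' i * x i) = A e' k * (S / A e k)"
      proof -
        have "(\<Sum>i\<in>I'. A e' k * (A e i / A e k) * x i) = A e' k * (S / A e k)"
          unfolding S_def sum_divide_distrib sum_distrib_left by (intro sum.cong) auto
        then show ?thesis
          using eq[of e'] that False by (simp add: left_diff_distrib sum_subtractf)
      qed
      then show ?thesis unfolding sum by simp
    qed
    moreover have "\<exists>i\<in>I. y i \<noteq> 0" using x I by (auto simp: y_def)
    ultimately show ?thesis by blast
  qed
qed

lemma digits_less:
  fixes a :: "nat \<Rightarrow> nat"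
  assumes "\<And>i. i < n \<Longrightarrow> a i < T"
  shows "(\<Sum>i<n. a i * T ^ i) < T ^ n"
  using assms
proof (induction n)
  case (Suc n)
  have "(\<Sum>i<n. a i * T ^ i) + a n * T ^ n < T ^ n + a n * T ^ n" using Suc by simp
  also have "\<dots> = Suc (a n) * T ^ n" by simp
  also have "\<dots> \<le> T * T ^ n" using Suc.prems[of n] by (intro mult_le_mono1) simp
  finally show ?case by simp
qed simp

lemma digits_unique:
  fixes a b :: "nat \<Rightarrow> nat"
  assumes "\<And>i. i < n \<Longrightarrow> a i < T" "\<And>i. i < n \<Longrightarrow> b i < T"
    and "(\<Sum>i<n. a i * T ^ i) = (\<Sum>i<n. b i * T ^ i)"
  shows "\<forall>i<n. a i = b i"
  using assms
proof (induction n)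
  case (Suc n)
  have lt: "(\<Sum>i<n. a i * T ^ i) < T ^ n" "(\<Sum>i<n. b i * T ^ i) < T ^ n"
    using Suc.prems by (auto intro: digits_less)
  have eq: "(\<Sum>i<n. a i * T ^ i) + a n * T ^ n = (\<Sum>i<n. b i * T ^ i) + b n * T ^ n"
    using Suc.prems(3) by simp
  have "T ^ n \<noteq> 0" using lt(1) by (rule gr_implies_not0)
  then have "a n = ((\<Sum>i<n. a i * T ^ i) + a n * T ^ n) div T ^ n" using lt(1) by (simp del: power_eq_0_iff)
  also have "\<dots> = b n" unfolding eq using lt(2) \<open>T ^ n \<noteq> 0\<close> by (simp del: power_eq_0_iff)
  finally have "a n = b n" .
  moreover have "(\<Sum>i<n. a i * T ^ i) = (\<Sum>i<n. b i * T ^ i)"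
    using eq by (simp only: \<open>a n = b n\<close> add_right_cancel)
  then have "\<forall>i<n. a i = b i" by (intro Suc.IH) (use Suc.prems(1,2) in auto)
  ultimately show ?case by (auto simp: less_Suc_eq)
qed simp

lemma monomials_independent:
  fixes a :: "('n::finite \<Rightarrow> nat) \<Rightarrow> complex"
  assumes "\<alpha>0 \<in> box_exps T" "a \<alpha>0 \<noteq> 0"
  shows "\<exists>w. (\<Sum>\<alpha>\<in>box_exps T. a \<alpha> * mono_at \<alpha> w) \<noteq> 0"
proof -
  obtain e where e: "bij_betw e (UNIV :: 'n set) {..<CARD('n)}"
    using ex_bij_betw_finite_nat[of "UNIV :: 'n set"] by (auto simp: lessThan_atLeast0)
  define \<kappa> where "\<kappa> \<alpha> = (\<Sum>i\<in>UNIV. \<alpha> i * T ^ e i)" for \<alpha> :: "'n \<Rightarrow> nat"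
  have \<kappa>: "\<kappa> \<alpha> = (\<Sum>l<CARD('n). \<alpha> (inv_into UNIV e l) * T ^ l)" for \<alpha>
    unfolding \<kappa>_def using sum.reindex_bij_betw[OF e, of "\<lambda>l. \<alpha> (inv_into UNIV e l) * T ^ l"] e
    by (simp add: bij_betw_def)
  have inj: "inj_on \<kappa> (box_exps T)"
  proof (rule inj_onI)
    fix \<alpha> \<beta> :: "'n \<Rightarrow> nat"
    assume *: "\<alpha> \<in> box_exps T" "\<beta> \<in> box_exps T" "\<kappa> \<alpha> = \<kappa> \<beta>"
    then have "\<forall>l<CARD('n). \<alpha> (inv_into UNIV e l) = \<beta> (inv_into UNIV e l)"
      by (intro digits_unique[where T = T]) (auto simp: box_exps_def \<kappa>[symmetric])
    moreover have "inv_into UNIV e (e i) = i" "e i < CARD('n)" for i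
      using e bij_betwE[OF e] by (auto simp: bij_betw_def inv_into_f_f)
    ultimately have "\<alpha> i = \<beta> i" for i by metis
    then show "\<alpha> = \<beta>" by blast
  qed
  define q where "q = (\<Sum>\<alpha>\<in>box_exps T. monom (a \<alpha>) (\<kappa> \<alpha>))"
  have "coeff q (\<kappa> \<alpha>0) = (\<Sum>\<alpha>\<in>box_exps T. if \<alpha> = \<alpha>0 then a \<alpha> else 0)"
    unfolding q_def coeff_sum
    by (intro sum.cong) (use inj_onD[OF inj _ _ assms(1)] in auto)
  also have "\<dots> = a \<alpha>0" using assms(1) by simp
  finally have "q \<noteq> 0" using assms(2) by auto
  then obtain s where s: "poly q s \<noteq> 0" using poly_all_0_iff_0[of q] by blast
  have "mono_at \<alpha> (\<chi> i. s ^ (T ^ e i)) = s ^ \<kappa> \<alpha>" for \<alpha> :: "'n \<Rightarrow> nat"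
    by (simp add: mono_at_def \<kappa>_def power_sum power_mult[symmetric] mult.commute)
  then have "(\<Sum>\<alpha>\<in>box_exps T. a \<alpha> * mono_at \<alpha> (\<chi> i. s ^ (T ^ e i))) = poly q s"
    by (simp add: q_def poly_sum poly_monom)
  then show ?thesis using s by metis
qed

lemma poly_nonzero_near_0:
  fixes q :: "complex poly"
  assumes "q \<noteq> 0"
  shows "\<exists>\<delta>>0. \<forall>s. s \<noteq> 0 \<and> norm s < \<delta> \<longrightarrow> poly q s \<noteq> 0"
proof -
  have "finite {s. poly q s = 0}" using assms by (rule poly_roots_finite)
  then obtain \<delta> where "\<delta> > 0" "\<And>s. poly q s = 0 \<Longrightarrow> s \<noteq> 0 \<Longrightarrow> \<delta> \<le> dist 0 s"
    using finite_set_avoid[of "{s. poly q s = 0}" 0] by auto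
  then show ?thesis by (intro exI[of _ \<delta>]) (force simp: dist_norm)
qed

lemma dist_line: "dist (z + s *s v) z = norm s * norm (v :: complex ^ 'n)"
proof -
  have "norm (s *s v) = norm s * norm v"
    unfolding norm_vec_def by (simp add: norm_mult L2_set_right_distrib)
  then show ?thesis by (simp add: dist_norm)
qed

lemma polyfn_nonzero_dense:
  fixes f :: "complex ^ 'n \<Rightarrow> complex"
  assumes "polyfn d f" and "f z1 \<noteq> 0" and "e > 0"
  shows "\<exists>z'. dist z' z < e \<and> f z' \<noteq> 0"
proof (cases "z1 = z")
  case True
  then show ?thesis using assms by (intro exI[of _ z1]) simp
next
  case False
  obtain q where q: "\<And>s. f (z + s *s (z1 - z)) = poly q s"
    using polyfn_on_line[OF assms(1)] by blast
  have "poly q 1 \<noteq> 0" using assms(2) by (simp flip: q)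
  then have "q \<noteq> 0" by auto
  then obtain \<delta> where \<delta>: "\<delta> > 0" "\<And>s. s \<noteq> 0 \<Longrightarrow> norm s < \<delta> \<Longrightarrow> poly q s \<noteq> 0"
    using poly_nonzero_near_0 by blast
  define N where "N = norm (z1 - z)"
  have N: "N > 0" using False by (simp add: N_def)
  define t where "t = min (\<delta> / 2) (e / (2 * N))"
  have t: "t > 0" "t < \<delta>" using \<delta>(1) assms(3) N by (auto simp: t_def min_def)
  have "t * N \<le> e / (2 * N) * N" using N by (intro mult_right_mono) (auto simp: t_def)
  also have "\<dots> < e" using N assms(3) by simp
  finally have "t * N < e" .
  then have "dist (z + of_real t *s (z1 - z)) z < e"
    using t by (simp only: dist_line N_def norm_of_real abs_of_pos)
  moreover have "f (z + of_real t *s (z1 - z)) \<noteq> 0"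
    using \<delta>(2)[of "of_real t"] t unfolding q by simp
  ultimately show ?thesis by blast
qed

lemma negligible_polyfn_zeros:
  fixes f :: "complex ^ 'n \<Rightarrow> complex"
  assumes f: "polyfn d f" and a: "f a \<noteq> 0"
  shows "negligible {w. f w = 0}"
proof -
  have "negligible ({w. f w = 0} \<inter> cball a R)" for R
  proof -
    define S where "S = {w. f w = 0} \<inter> cball a R"
    have "closed {w. f w = 0}"
      using continuous_closed_preimage_constant[OF polyfn_continuous[OF f] closed_UNIV] by simp
    then have cS: "compact S" unfolding S_def by (intro closed_Int_compact) auto
    define c where "c j = 1/2 + 1 / (2 * (real j + 1))" for j :: nat
    have c: "c j > 1/2" "c j \<le> 1" for j by (auto simp: c_def field_simps)
    define T where "T j = (\<lambda>x. c j *\<^sub>R x + (a - c j *\<^sub>R a)) ` S" for j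
    have cT: "compact (T j)" for j
      unfolding T_def by (intro compact_continuous_image continuous_intros cS)
    have mT: "measure lebesgue (T j) \<ge> (1/2) ^ DIM(complex ^ 'n) * measure lebesgue S" for j
      unfolding T_def measure_lebesgue_affine using c[of j]
      by (intro mult_right_mono power_mono) auto
    have count: "(\<Sum>j<m. indicator (T j) x) \<le> real d * indicator (cball a R) x" for m x
    proof (cases "x \<in> cball a R")
      case False
      have "x \<notin> T j" for j
      proof
        assume "x \<in> T j"
        then obtain y where y: "y \<in> S" "x = c j *\<^sub>R y + (a - c j *\<^sub>R a)" by (auto simp: T_def)
        have "x - a = c j *\<^sub>R (y - a)" by (simp add: y(2) algebra_simps)
        then have "norm (x - a) = c j * norm (y - a)" using c(1)[of j] by simp
        then have "dist a x = c j * dist a y" by (simp add: dist_norm norm_minus_commute)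
        also have "\<dots> \<le> dist a y" using c[of j] by (intro mult_left_le_one_le) auto
        finally show False using y(1) False by (simp add: S_def)
      qed
      then show ?thesis using False by simp
    next
      case True
      obtain q where q: "degree q \<le> d" "\<And>s. f (a + s *s (x - a)) = poly q s"
        using polyfn_on_line[OF f] by blast
      have "poly q 0 \<noteq> 0" using a by (simp flip: q(2))
      then have q0: "q \<noteq> 0" by auto
      define r where "r j = complex_of_real (1 / c j)" for j
      have "inj r"
      proof (rule injI)
        fix i j assume "r i = r j"
        then have "1 / c i = 1 / c j" by (simp add: r_def)
        then have "c i = c j" using c[of i] c[of j] by (simp add: field_simps)
        then show "i = j" by (simp add: c_def)
      qed
      have "r j \<in> {s. poly q s = 0}" if "x \<in> T j" for j
      proof -
        from that obtain y where y: "y \<in> S" "x = c j *\<^sub>R y + (a - c j *\<^sub>R a)" by (auto simp: T_def)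
        have "x - a = c j *\<^sub>R (y - a)" by (simp add: y(2) algebra_simps)
        moreover have "r j *s (c j *\<^sub>R (y - a)) = y - a"
          using c(1)[of j] by (simp add: vec_eq_iff r_def scaleR_conv_of_real[where 'a = complex])
        ultimately have "r j *s (x - a) = y - a" by simp
        then have "poly q (r j) = f y" by (simp flip: q(2))
        then show ?thesis using y(1) by (simp add: S_def)
      qed
      then have "card {j. j < m \<and> x \<in> T j} \<le> card {s. poly q s = 0}"
        using poly_roots_finite[OF q0] \<open>inj r\<close>
        by (intro card_inj_on_le[of r]) (auto intro: inj_on_subset)
      also have "\<dots> \<le> d" using card_poly_roots_bound[OF q0] q(1) by simp
      finally have "card {j. j < m \<and> x \<in> T j} \<le> d" .
      moreover have "(\<Sum>j<m. indicator (T j) x) = real (card {j. j < m \<and> x \<in> T j})"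
        by (simp add: indicator_def sum.If_cases Int_def)
      ultimately show ?thesis using True by simp
    qed
    have bound: "real m * ((1/2) ^ DIM(complex ^ 'n) * measure lebesgue S) \<le> real d * measure lebesgue (cball a R)" for m
    proof -
      have lm: "T j \<in> lmeasurable" "cball a R \<in> lmeasurable" for j
        using cT by (auto intro: lmeasurable_compact)
      have int: "integrable lebesgue (indicator (T j) :: _ \<Rightarrow> real)" for j
        using lm(1)[of j] by (auto simp: fmeasurable_def)
      have intB: "integrable lebesgue (indicator (cball a R) :: _ \<Rightarrow> real)"
        using lm(2) by (auto simp: fmeasurable_def)
      have "real m * ((1/2) ^ DIM(complex ^ 'n) * measure lebesgue S) = (\<Sum>j<m. (1/2) ^ DIM(complex ^ 'n) * measure lebesgue S)"
        by simp
      also have "\<dots> \<le> (\<Sum>j<m. measure lebesgue (T j))" by (intro sum_mono mT)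
      also have "\<dots> = (\<Sum>j<m. integral\<^sup>L lebesgue (indicator (T j)))"
        using lm by (intro sum.cong) auto
      also have "\<dots> = integral\<^sup>L lebesgue (\<lambda>x. \<Sum>j<m. indicator (T j) x)"
        using int by (subst Bochner_Integration.integral_sum) auto
      also have "\<dots> \<le> integral\<^sup>L lebesgue (\<lambda>x. real d * indicator (cball a R) x)"
        using int intB by (intro integral_mono count) auto
      also have "\<dots> = real d * measure lebesgue (cball a R)" using lm(2) by simp
      finally show ?thesis .
    qed
    have "measure lebesgue S = 0"
    proof (rule ccontr)
      assume "measure lebesgue S \<noteq> 0"
      then have "measure lebesgue S > 0"
        using measure_nonneg[of lebesgue S] by linarith
      then have "(1/2) ^ DIM(complex ^ 'n) * measure lebesgue S > 0"
        by (intro mult_pos_pos zero_less_power) auto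
      from reals_Archimedean3[OF this] obtain m :: nat
        where "real d * measure lebesgue (cball a R) < real m * ((1/2) ^ DIM(complex ^ 'n) * measure lebesgue S)"
        by (rule allE[where x = "real d * measure lebesgue (cball a R)"]) (elim exE, rule that)
      then show False using bound[of m] by linarith
    qed
    then show ?thesis
      unfolding S_def[symmetric] negligible_iff_measure using lmeasurable_compact[OF cS] by blast
  qed
  then have "negligible (\<Union>n::nat. {w. f w = 0} \<inter> cball a (real n))"
    by (intro negligible_countable_Union) auto
  moreover have "(\<Union>n::nat. {w. f w = 0} \<inter> cball a (real n)) = {w. f w = 0}"
    by (auto intro: real_arch_simple)
  ultimately show ?thesis by simp
qed

section \<open>S3\<close>

lemma box_count_exceeds:
  fixes C :: nat
  shows "\<exists>T>0. (C * T + 1) ^ n < T ^ n * T"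
proof -
  define T where "T = (C + 1) ^ n + 1"
  have "(C * T + 1) ^ n \<le> ((C + 1) * T) ^ n" by (rule power_mono) (auto simp: T_def)
  also have "\<dots> = T ^ n * (C + 1) ^ n" by (simp only: power_mult_distrib mult.commute)
  also have "\<dots> < T ^ n * T" by (rule mult_strict_left_mono) (auto simp: T_def)
  finally show ?thesis by (intro exI[of _ T]) (simp add: T_def)
qed

theorem critical_values_in_hypersurface:
  fixes \<phi> :: "complex ^ 'n \<Rightarrow> complex ^ 'n" and J M :: "complex ^ 'n \<Rightarrow> complex"
  assumes U: "open U"
    and M: "polyfn e M" "\<And>z. z \<in> U \<Longrightarrow> M z \<noteq> 0"
    and \<phi>: "\<And>i. \<exists>P. polyfn D P \<and> (\<forall>z\<in>U. M z ^ d * \<phi> z $ i = P z)"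
    and J: "\<exists>P. polyfn D P \<and> (\<forall>z\<in>U. M z ^ d * J z = P z)"
    and cont: "continuous_on U \<phi>" "continuous_on U J"
    and dense: "\<And>z \<epsilon>. z \<in> U \<Longrightarrow> \<epsilon> > 0 \<Longrightarrow> \<exists>z'\<in>U. dist z' z < \<epsilon> \<and> J z' \<noteq> 0"
  shows "\<exists>m Q. polyfn m Q \<and> (\<exists>w :: complex ^ 'n. Q w \<noteq> 0) \<and> (\<forall>z\<in>U. J z = 0 \<longrightarrow> Q (\<phi> z) = 0)"
proof -
  from \<phi> obtain P where P: "\<And>i. polyfn D (P i)" "\<And>i z. z \<in> U \<Longrightarrow> M z ^ d * \<phi> z $ i = P i z"
    by metis
  from J obtain R where R: "polyfn D R" "\<And>z. z \<in> U \<Longrightarrow> M z ^ d * J z = R z" by blast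
  define E where "E = D + e * d"
  define n where "n = CARD('n)"
  obtain T where T: "T > 0" "((n + 1) * E * T + 1) ^ n < T ^ n * T" using box_count_exceeds by blast
  define I where "I = (box_exps T :: ('n \<Rightarrow> nat) set) \<times> {..<T}"
  define K where "K = (n + 1) * E * T"
  define g where "g p z = mono_at (fst p) (\<phi> z) * J z ^ snd p" for p z
  have factor: "polyfn (E * T) (\<lambda>z. (M z ^ d) ^ (T - k) * S z ^ k)"
    if "polyfn D S" "k < T" for k and S :: "complex ^ 'n \<Rightarrow> complex"
  proof (rule polyfn_mono)
    show "polyfn (e * d * (T - k) + D * k) (\<lambda>z. (M z ^ d) ^ (T - k) * S z ^ k)"
      by (intro polyfn_mult polyfn_power that M)
    have "e * d * (T - k) + D * k \<le> E * (T - k) + E * k"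
      by (intro add_mono mult_right_mono) (auto simp: E_def)
    also have "\<dots> = E * T" using that by (simp flip: distrib_left)
    finally show "e * d * (T - k) + D * k \<le> E * T" .
  qed
  have "\<exists>G. polyfn K G \<and> (\<forall>z\<in>U. M z ^ (d * T * (n + 1)) * g p z = G z)" if p: "p \<in> I" for p
  proof -
    define G where "G z = (\<Prod>i\<in>UNIV. (M z ^ d) ^ (T - fst p i) * P i z ^ fst p i)
        * ((M z ^ d) ^ (T - snd p) * R z ^ snd p)" for z
    have lt: "fst p i < T" "snd p < T" for i using p by (auto simp: I_def box_exps_def)
    have "polyfn ((\<Sum>i\<in>(UNIV :: 'n set). E * T) + E * T) G"
      unfolding G_def[abs_def] by (intro polyfn_mult polyfn_prod factor P R lt)
    moreover have "(\<Sum>i\<in>(UNIV :: 'n set). E * T) + E * T = K"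
      by (simp add: K_def n_def algebra_simps)
    moreover have "M z ^ (d * T * (n + 1)) * g p z = G z" if z: "z \<in> U" for z
    proof -
      have *: "(M z ^ d) ^ (T - k) * (M z ^ d * x) ^ k = (M z ^ d) ^ T * x ^ k" if "k < T" for k x
      proof -
        have "(M z ^ d) ^ T = (M z ^ d) ^ (T - k) * (M z ^ d) ^ k"
          using that by (simp flip: power_add)
        then show ?thesis by (simp add: power_mult_distrib)
      qed
      have "G z = (\<Prod>i\<in>(UNIV :: 'n set). (M z ^ d) ^ T * \<phi> z $ i ^ fst p i) * ((M z ^ d) ^ T * J z ^ snd p)"
        unfolding G_def using z by (simp add: P(2)[symmetric] R(2)[symmetric] * lt)
      also have "\<dots> = ((M z ^ d) ^ T) ^ (n + 1) * g p z"
        by (simp add: prod.distrib g_def mono_at_def n_def)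
      finally show ?thesis by (simp only: power_mult)
    qed
    ultimately show ?thesis by auto
  qed
  then obtain G where G: "\<And>p. p \<in> I \<Longrightarrow> polyfn K (G p)"
    "\<And>p z. p \<in> I \<Longrightarrow> z \<in> U \<Longrightarrow> M z ^ (d * T * (n + 1)) * g p z = G p z" by metis
  from polyfn_normal_form[OF G(1)] obtain c where
    c: "\<And>p z. p \<in> I \<Longrightarrow> G p z = (\<Sum>\<alpha>\<in>box_exps (Suc K). c p \<alpha> * mono_at \<alpha> z)" by metis
  have "card (box_exps (Suc K) :: ('n \<Rightarrow> nat) set) < card I"
    using T by (simp add: I_def card_cartesian_product card_box_exps n_def K_def)
  from homogeneous_system_nontrivial_solution[OF finite_box_exps _ this, of "\<lambda>\<alpha> p. c p \<alpha>"]
  obtain x where x: "\<exists>p\<in>I. x p \<noteq> 0"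
    and x0: "\<And>\<alpha>. \<alpha> \<in> box_exps (Suc K) \<Longrightarrow> (\<Sum>p\<in>I. c p \<alpha> * x p) = 0" by (auto simp: I_def)
  have rel: "(\<Sum>p\<in>I. x p * g p z) = 0" if z: "z \<in> U" for z
  proof -
    have "M z ^ (d * T * (n + 1)) * (\<Sum>p\<in>I. x p * g p z) = (\<Sum>p\<in>I. x p * G p z)"
      unfolding sum_distrib_left using z by (intro sum.cong) (auto simp: G(2)[symmetric])
    also have "\<dots> = (\<Sum>p\<in>I. \<Sum>\<alpha>\<in>box_exps (Suc K). c p \<alpha> * x p * mono_at \<alpha> z)"
      by (intro sum.cong) (simp_all add: c sum_distrib_left mult_ac)
    also have "\<dots> = (\<Sum>\<alpha>\<in>box_exps (Suc K). \<Sum>p\<in>I. c p \<alpha> * x p * mono_at \<alpha> z)" by (rule sum.swap)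
    also have "\<dots> = (\<Sum>\<alpha>\<in>box_exps (Suc K). (\<Sum>p\<in>I. c p \<alpha> * x p) * mono_at \<alpha> z)"
      by (simp only: sum_distrib_right)
    also have "\<dots> = 0" by (simp add: x0)
    finally show ?thesis using M(2)[OF z] by simp
  qed
  define \<beta>0 where "\<beta>0 = (LEAST \<beta>. \<exists>\<alpha>. (\<alpha>, \<beta>) \<in> I \<and> x (\<alpha>, \<beta>) \<noteq> 0)"
  have ex: "\<exists>\<beta> \<alpha>. (\<alpha>, \<beta>) \<in> I \<and> x (\<alpha>, \<beta>) \<noteq> 0" using x by auto
  obtain \<alpha>0 where \<alpha>0: "(\<alpha>0, \<beta>0) \<in> I" "x (\<alpha>0, \<beta>0) \<noteq> 0"
    using LeastI_ex[OF ex] unfolding \<beta>0_def by blast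
  have less: "x (\<alpha>, \<beta>) = 0" if "(\<alpha>, \<beta>) \<in> I" "\<beta> < \<beta>0" for \<alpha> \<beta>
    using not_less_Least[OF that(2)[unfolded \<beta>0_def]] that(1) by blast
  define Q where "Q w = (\<Sum>\<alpha>\<in>box_exps T. x (\<alpha>, \<beta>0) * mono_at \<alpha> w)" for w :: "complex ^ 'n"
  define h where "h z = (\<Sum>p\<in>I. x p * (mono_at (fst p) (\<phi> z) * J z ^ (snd p - \<beta>0)))" for z
  have Qpoly: "polyfn (T * CARD('n)) Q"
    unfolding Q_def[abs_def] by (intro polyfn_sum polyfn_cmult polyfn_mono_at)
  have "\<exists>w. Q w \<noteq> 0"
    unfolding Q_def using \<alpha>0 by (intro monomials_independent) (auto simp: I_def)
  have conth: "continuous_on U h"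
    unfolding h_def[abs_def] mono_at_def by (intro continuous_intros cont)
  have h0: "h z = 0" if z: "z \<in> U" "J z \<noteq> 0" for z
  proof -
    have "J z ^ \<beta>0 * h z = (\<Sum>p\<in>I. x p * g p z)"
      unfolding h_def sum_distrib_left
    proof (intro sum.cong refl)
      fix p assume p: "p \<in> I"
      show "J z ^ \<beta>0 * (x p * (mono_at (fst p) (\<phi> z) * J z ^ (snd p - \<beta>0))) = x p * g p z"
      proof (cases "snd p < \<beta>0")
        case True
        then show ?thesis using less[of "fst p" "snd p"] p by simp
      next
        case False
        then have "J z ^ snd p = J z ^ \<beta>0 * J z ^ (snd p - \<beta>0)" by (simp flip: power_add)
        then show ?thesis by (simp add: g_def)
      qed
    qed
    then show ?thesis using rel[OF z(1)] z(2) by simp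
  qed
  have "Q (\<phi> z) = 0" if z: "z \<in> U" "J z = 0" for z
  proof -
    have "h z = 0"
    proof (rule ccontr)
      assume "h z \<noteq> 0"
      moreover have "continuous (at z) h" using conth U z(1) by (simp add: continuous_on_eq_continuous_at)
      ultimately obtain \<epsilon> where "\<epsilon> > 0" "\<And>y. dist z y < \<epsilon> \<Longrightarrow> h y \<noteq> 0"
        using continuous_at_avoid[of z h 0] by blast
      moreover obtain z' where "z' \<in> U" "dist z' z < \<epsilon>" "J z' \<noteq> 0" using dense[OF z(1) \<open>\<epsilon> > 0\<close>] by blast
      ultimately show False using h0[of z'] by (auto simp: dist_commute)
    qed
    also have "h z = (\<Sum>p\<in>(\<lambda>\<alpha>. (\<alpha>, \<beta>0)) ` box_exps T. x p * (mono_at (fst p) (\<phi> z) * J z ^ (snd p - \<beta>0)))"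
      unfolding h_def
    proof (rule sum.mono_neutral_right)
      show "finite I" by (simp add: I_def)
      show "(\<lambda>\<alpha>. (\<alpha>, \<beta>0)) ` box_exps T \<subseteq> I" using \<alpha>0 by (auto simp: I_def)
      show "\<forall>p\<in>I - (\<lambda>\<alpha>. (\<alpha>, \<beta>0)) ` box_exps T. x p * (mono_at (fst p) (\<phi> z) * J z ^ (snd p - \<beta>0)) = 0"
      proof
        fix p assume p: "p \<in> I - (\<lambda>\<alpha>. (\<alpha>, \<beta>0)) ` box_exps T"
        then have "snd p \<noteq> \<beta>0" by (cases p) (auto simp: I_def)
        then show "x p * (mono_at (fst p) (\<phi> z) * J z ^ (snd p - \<beta>0)) = 0"
          using less[of "fst p" "snd p"] p z(2) by (cases "snd p < \<beta>0") auto
      qed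
    qed
    also have "\<dots> = Q (\<phi> z)"
      unfolding Q_def by (subst sum.reindex) (auto simp: inj_on_def)
    finally show ?thesis by simp
  qed
  then show ?thesis using Qpoly \<open>\<exists>w. Q w \<noteq> 0\<close> by blast
qed

section \<open>S4\<close>

lemma bounded_linear_matrix_mult [simp]: "bounded_linear ((*v) (A :: complex ^ 'm ^ 'n))"
  by (rule matrix_vector_mul_bounded_linear)

lemma inj_matrix_mult_iff:
  fixes A :: "complex ^ 'm ^ 'n"
  shows "inj ((*v) A) \<longleftrightarrow> (\<forall>h. A *v h = 0 \<longrightarrow> h = 0)"
proof
  assume "inj ((*v) A)"
  then show "\<forall>h. A *v h = 0 \<longrightarrow> h = 0" by (metis injD matrix_vector_mult_0_right)
next
  assume *: "\<forall>h. A *v h = 0 \<longrightarrow> h = 0"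
  show "inj ((*v) A)"
  proof (rule injI)
    fix x y assume "A *v x = A *v y"
    then have "A *v (x - y) = 0" by (simp add: matrix_vector_mult_diff_distrib)
    then show "x = y" using * by auto
  qed
qed

lemma det_nonzero_iff_inj:
  fixes A :: "complex ^ 'n ^ 'n"
  shows "det A \<noteq> 0 \<longleftrightarrow> (\<forall>h. A *v h = 0 \<longrightarrow> h = 0)"
proof -
  have "det A \<noteq> 0 \<longleftrightarrow> (\<exists>B. B ** A = mat 1)"
    using invertible_det_nz[of A] invertible_left_inverse[of A] by blast
  then show ?thesis
    by (simp only: matrix_left_invertible_injective inj_matrix_mult_iff)
qed

lemma complex_matrix_inverse_function:
  fixes \<phi> :: "complex ^ 'n \<Rightarrow> complex ^ 'n" and \<phi>' :: "complex ^ 'n \<Rightarrow> complex ^ 'n ^ 'n"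
  assumes U: "open U" and deriv: "\<And>z. z \<in> U \<Longrightarrow> (\<phi> has_derivative (*v) (\<phi>' z)) (at z)"
    and cont: "continuous_on U \<phi>'" and z0: "z0 \<in> U" "det (\<phi>' z0) \<noteq> 0"
  obtains U' V' g where "open U'" "U' \<subseteq> U" "z0 \<in> U'" "open V'" "\<phi> z0 \<in> V'"
    "homeomorphism U' V' \<phi> g"
    "\<And>y. y \<in> V' \<Longrightarrow> \<exists>A. (g has_derivative (*v) A) (at y)"
    "\<And>y. y \<in> V' \<Longrightarrow> det (\<phi>' (g y)) \<noteq> 0"
proof -
  define f' where "f' z = Blinfun ((*v) (\<phi>' z))" for z
  have f': "blinfun_apply (f' z) = (*v) (\<phi>' z)" for z
    by (simp add: f'_def bounded_linear_Blinfun_apply)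
  have contf: "continuous_on U f'"
  proof (rule continuous_on_blinfun_componentwise)
    fix b :: "complex ^ 'n"
    show "continuous_on U (\<lambda>x. blinfun_apply (f' x) b)"
      unfolding f' matrix_vector_mult_def by (intro continuous_intros cont)
  qed
  obtain B where B: "B ** \<phi>' z0 = mat 1"
    using z0(2) invertible_det_nz[of "\<phi>' z0"] invertible_left_inverse[of "\<phi>' z0"] by blast
  have linv: "Blinfun ((*v) B) o\<^sub>L f' z0 = id_blinfun"
    by (rule blinfun_eqI) (simp add: f' bounded_linear_Blinfun_apply matrix_vector_mul_assoc B)
  have der: "\<And>x. x \<in> U \<Longrightarrow> (\<phi> has_derivative blinfun_apply (f' x)) (at x)"
    using deriv by (simp add: f')
  obtain U' V' g g' where *: "open U'" "U' \<subseteq> U" "z0 \<in> U'" "open V'" "\<phi> z0 \<in> V'" "homeomorphism U' V' \<phi> g"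
    "\<And>y. y \<in> V' \<Longrightarrow> (g has_derivative (g' y)) (at y)"
    "\<And>y. y \<in> V' \<Longrightarrow> g' y = inv_into UNIV (blinfun_apply (f'(g y)))"
    "\<And>y. y \<in> V' \<Longrightarrow> bij (blinfun_apply (f'(g y)))"
    using inverse_function_theorem[OF U der contf z0(1) linv] by blast
  have det: "det (\<phi>' (g y)) \<noteq> 0" if "y \<in> V'" for y
    using *(9)[OF that] by (simp add: f' bij_def det_nonzero_iff_inj inj_matrix_mult_iff)
  show ?thesis
  proof (rule that[OF *(1-6) _ det])
    fix y assume y: "y \<in> V'"
    obtain A where A: "A ** \<phi>' (g y) = mat 1"
      using det[OF y] invertible_det_nz[of "\<phi>' (g y)"] invertible_left_inverse[of "\<phi>' (g y)"] by blast
    have "inv_into UNIV ((*v) (\<phi>' (g y))) = (*v) A"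
    proof (rule inv_equality)
      show "A *v (\<phi>' (g y) *v x) = x" for x by (simp add: matrix_vector_mul_assoc A)
      show "\<phi>' (g y) *v (A *v x) = x" for x
        using A matrix_left_right_inverse[of A] by (simp add: matrix_vector_mul_assoc)
    qed
    then show "\<exists>A. (g has_derivative (*v) A) (at y)" using *(7,8)[OF y] by (auto simp: f')
  qed
qed

locale proper_complex_map =
  fixes \<phi> :: "complex ^ 'n \<Rightarrow> complex ^ 'n" and \<phi>' :: "complex ^ 'n \<Rightarrow> complex ^ 'n ^ 'n"
    and U V :: "(complex ^ 'n) set"
  assumes open_dom: "open U" and open_target: "open V"
    and deriv: "z \<in> U \<Longrightarrow> (\<phi> has_derivative (*v) (\<phi>' z)) (at z)"
    and cont_deriv: "continuous_on U \<phi>'"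
    and proper: "compact K \<Longrightarrow> K \<subseteq> V \<Longrightarrow> compact {z \<in> U. \<phi> z \<in> K}"
begin

definition fibre :: "complex ^ 'n \<Rightarrow> (complex ^ 'n) set" where
  "fibre w = {z \<in> U. \<phi> z = w}"

lemma continuous_map: "continuous_on U \<phi>"
  using deriv by (meson continuous_at_imp_continuous_on has_derivative_continuous)

lemma compact_fibre: "w \<in> V \<Longrightarrow> compact (fibre w)"
  using proper[of "{w}"] by (simp add: fibre_def)

lemma misses_nearby_values:
  assumes K: "compact K" "K \<subseteq> U" "\<And>z. z \<in> K \<Longrightarrow> \<phi> z \<noteq> w"
  shows "\<exists>\<epsilon>>0. \<forall>z\<in>K. \<phi> z \<notin> ball w \<epsilon>"
proof -
  have "closed (\<phi> ` K)"
    using K continuous_on_subset[OF continuous_map] by (intro compact_imp_closed compact_continuous_image) auto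
  then have "open (- \<phi> ` K)" by auto
  moreover have "w \<in> - \<phi> ` K" using K(3) by auto
  ultimately obtain \<epsilon> where "\<epsilon> > 0" "ball w \<epsilon> \<subseteq> - \<phi> ` K" using openE by blast
  then show ?thesis by (intro exI[of _ \<epsilon>]) auto
qed

lemma nearby_fibres_in_neighbourhood:
  assumes "w \<in> V" "open W" "fibre w \<subseteq> W"
  shows "\<exists>\<epsilon>>0. ball w \<epsilon> \<subseteq> V \<and> (\<forall>y\<in>ball w \<epsilon>. fibre y \<subseteq> W)"
proof -
  obtain r where r: "r > 0" "cball w r \<subseteq> V" using assms(1) open_target open_contains_cball by blast
  define K where "K = {z \<in> U. \<phi> z \<in> cball w r}"
  have cK: "compact K" unfolding K_def by (rule proper) (use r in auto)
  have "compact (K - W)" using cK assms(2) by (rule compact_diff)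
  moreover have "K - W \<subseteq> U" by (auto simp: K_def)
  moreover have "\<phi> z \<noteq> w" if "z \<in> K - W" for z using that assms(3) by (auto simp: K_def fibre_def)
  ultimately obtain \<epsilon> where \<epsilon>: "\<epsilon> > 0" "\<forall>z\<in>K - W. \<phi> z \<notin> ball w \<epsilon>" using misses_nearby_values by blast
  show ?thesis
  proof (intro exI[of _ "min r \<epsilon>"] conjI ballI subsetI)
    show "min r \<epsilon> > 0" using r \<epsilon> by simp
    show "x \<in> V" if "x \<in> ball w (min r \<epsilon>)" for x using that r by auto
    show "z \<in> W" if "y \<in> ball w (min r \<epsilon>)" "z \<in> fibre y" for y z
      using that \<epsilon>(2) by (auto simp: fibre_def K_def)
  qed
qed

lemma regular_fibre_sheets:
  assumes w: "w \<in> V" and reg: "\<forall>z\<in>fibre w. det (\<phi>' z) \<noteq> 0"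
  shows "finite (fibre w)"
    and "\<exists>B g. open B \<and> w \<in> B \<and> B \<subseteq> V \<and>
      (\<forall>z\<in>fibre w. g z w = z \<and> (\<forall>y\<in>B. \<exists>A. (g z has_derivative (*v) A) (at y))) \<and>
      (\<forall>y\<in>B. inj_on (\<lambda>z. g z y) (fibre w) \<and> fibre y = (\<lambda>z. g z y) ` fibre w \<and>
         (\<forall>z\<in>fibre y. det (\<phi>' z) \<noteq> 0))"
proof -
  define sheet where "sheet z U' V' g \<longleftrightarrow> open U' \<and> U' \<subseteq> U \<and> z \<in> U' \<and> open V' \<and> w \<in> V' \<and>
    homeomorphism U' V' \<phi> g \<and> (\<forall>y\<in>V'. (\<exists>A. (g has_derivative (*v) A) (at y)) \<and> det (\<phi>' (g y)) \<noteq> 0)"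
    for z U' V' g
  have "\<exists>U' V' g. sheet z U' V' g" if z: "z \<in> fibre w" for z
  proof -
    have zU: "z \<in> U" "\<phi> z = w" using z by (auto simp: fibre_def)
    obtain U' V' g where "open U'" "U' \<subseteq> U" "z \<in> U'" "open V'" "\<phi> z \<in> V'" "homeomorphism U' V' \<phi> g"
      "\<And>y. y \<in> V' \<Longrightarrow> \<exists>A. (g has_derivative (*v) A) (at y)"
      "\<And>y. y \<in> V' \<Longrightarrow> det (\<phi>' (g y)) \<noteq> 0"
      by (rule complex_matrix_inverse_function[OF open_dom deriv cont_deriv zU(1) bspec[OF reg z]], assumption, rule that)
    then have "sheet z U' V' g" unfolding sheet_def zU(2) by blast
    then show ?thesis by blast
  qed
  then obtain U1 V1 g where sheet: "\<And>z. z \<in> fibre w \<Longrightarrow> sheet z (U1 z) (V1 z) (g z)"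
    by metis
  have *: "open (U1 z)" "U1 z \<subseteq> U" "z \<in> U1 z" "open (V1 z)" "w \<in> V1 z"
    "homeomorphism (U1 z) (V1 z) \<phi> (g z)" if "z \<in> fibre w" for z
    using sheet[OF that] by (simp_all add: sheet_def)
  have **: "(\<exists>A. (g z has_derivative (*v) A) (at y)) \<and> det (\<phi>' (g z y)) \<noteq> 0"
    if "z \<in> fibre w" "y \<in> V1 z" for z y
    using sheet[OF that(1)] that(2) by (simp add: sheet_def)
  have inj1: "z' = z" if "z \<in> fibre w" "z' \<in> fibre w" "z' \<in> U1 z" for z z'
  proof -
    have "g z (\<phi> z') = z'" "g z (\<phi> z) = z"
      using *(3,6)[OF that(1)] that(3) by (simp_all add: homeomorphism_def)
    moreover have "\<phi> z' = w" "\<phi> z = w" using that by (simp_all add: fibre_def)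
    ultimately show ?thesis by metis
  qed
  show fin: "finite (fibre w)"
  proof -
    obtain D where D: "D \<subseteq> fibre w" "finite D" "fibre w \<subseteq> (\<Union>z\<in>D. U1 z)"
    proof (rule compactE_image[OF compact_fibre[OF w], of "fibre w" U1])
      show "fibre w \<subseteq> (\<Union>z\<in>fibre w. U1 z)" using *(3) by blast
    qed (rule *(1))
    have "fibre w \<subseteq> D"
    proof
      fix z' assume "z' \<in> fibre w"
      then obtain z where "z \<in> D" "z' \<in> U1 z" using D by auto
      then show "z' \<in> D" using inj1[of z z'] D(1) \<open>z' \<in> fibre w\<close> by auto
    qed
    then show ?thesis using D(2) finite_subset by blast
  qed
  obtain \<delta> where \<delta>: "\<delta> > 0" "\<And>z z'. z \<in> fibre w \<Longrightarrow> z' \<in> fibre w \<Longrightarrow> z \<noteq> z' \<Longrightarrow> \<delta> \<le> dist z z'"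
  proof -
    have "\<forall>z. \<exists>\<delta>>0. \<forall>z'\<in>fibre w. z' \<noteq> z \<longrightarrow> \<delta> \<le> dist z z'"
      using finite_set_avoid[OF fin] by (rule allI)
    from choice[OF this] obtain \<delta>f
      where "\<forall>z. \<delta>f z > 0 \<and> (\<forall>z'\<in>fibre w. z' \<noteq> z \<longrightarrow> \<delta>f z \<le> dist z z')" by (elim exE)
    then have d: "\<And>z. \<delta>f z > 0" "\<And>z z'. z' \<in> fibre w \<Longrightarrow> z' \<noteq> z \<Longrightarrow> \<delta>f z \<le> dist z z'"
      by simp_all
    show ?thesis
    proof (rule that[of "Min (insert 1 (\<delta>f ` fibre w))"])
      show "0 < Min (insert 1 (\<delta>f ` fibre w))" using fin d(1) by (subst Min_gr_iff) auto
      show "Min (insert 1 (\<delta>f ` fibre w)) \<le> dist z z'" if "z \<in> fibre w" "z' \<in> fibre w" "z \<noteq> z'" for z z'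
        by (rule order_trans[OF Min_le d(2)[of z' z]]) (use fin that in auto)
    qed
  qed
  define U2 where "U2 z = U1 z \<inter> ball z (\<delta> / 2)" for z
  define V2 where "V2 z = V1 z \<inter> g z -` ball z (\<delta> / 2)" for z
  have gw: "g z w = z" if "z \<in> fibre w" for z
    using *(3,6)[OF that] that by (auto simp: homeomorphism_def fibre_def)
  have V2: "open (V2 z)" "w \<in> V2 z" if "z \<in> fibre w" for z
  proof -
    have "continuous_on (V1 z) (g z)" using *(6)[OF that] by (simp add: homeomorphism_def)
    then show "open (V2 z)" unfolding V2_def using *(4)[OF that] by (intro continuous_open_preimage) auto
    show "w \<in> V2 z" using gw[OF that] *(5)[OF that] \<delta>(1) by (simp add: V2_def)
  qed
  define W where "W = (\<Union>z\<in>fibre w. U2 z)"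
  have "open W" using * by (auto simp: W_def U2_def)
  moreover have "fibre w \<subseteq> W" using * \<delta>(1) by (auto simp: W_def U2_def)
  ultimately have "\<exists>\<epsilon>>0. ball w \<epsilon> \<subseteq> V \<and> (\<forall>y\<in>ball w \<epsilon>. fibre y \<subseteq> W)"
    by (rule nearby_fibres_in_neighbourhood[OF w])
  then obtain \<epsilon> where \<epsilon>: "\<epsilon> > 0" "ball w \<epsilon> \<subseteq> V" "\<forall>y\<in>ball w \<epsilon>. fibre y \<subseteq> W"
    by (elim exE conjE)
  define B where "B = ball w \<epsilon> \<inter> (\<Inter>z\<in>fibre w. V2 z)"
  have "open B" unfolding B_def using V2 fin by (intro open_Int open_INT) auto
  moreover have "w \<in> B" using V2 \<epsilon> by (auto simp: B_def)
  moreover have "B \<subseteq> V" using \<epsilon> by (auto simp: B_def)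
  moreover have "\<forall>z\<in>fibre w. g z w = z \<and> (\<forall>y\<in>B. \<exists>A. (g z has_derivative (*v) A) (at y))"
  proof (intro ballI conjI)
    fix z assume z: "z \<in> fibre w"
    show "g z w = z" by (rule gw[OF z])
    fix y assume "y \<in> B"
    then have "y \<in> V1 z" using z unfolding B_def V2_def by blast
    then show "\<exists>A. (g z has_derivative (*v) A) (at y)" using **[OF z] by blast
  qed
  moreover have sheets: "inj_on (\<lambda>z. g z y) (fibre w) \<and> fibre y = (\<lambda>z. g z y) ` fibre w \<and>
         (\<forall>z\<in>fibre y. det (\<phi>' z) \<noteq> 0)" if y: "y \<in> B" for y
  proof -
    have gb: "g z y \<in> ball z (\<delta> / 2)" "g z y \<in> U1 z" "\<phi> (g z y) = y" if "z \<in> fibre w" for z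
    proof -
      have "y \<in> V2 z" using y that unfolding B_def by blast
      then show "g z y \<in> ball z (\<delta> / 2)" "g z y \<in> U1 z" "\<phi> (g z y) = y"
        using *(6)[OF that] by (auto simp: V2_def homeomorphism_def)
    qed
    have "inj_on (\<lambda>z. g z y) (fibre w)"
    proof (rule inj_onI, rule ccontr)
      fix z z' assume zz: "z \<in> fibre w" "z' \<in> fibre w" "g z y = g z' y" "z \<noteq> z'"
      have "dist z' (g z y) < \<delta> / 2" using gb(1)[OF zz(2)] by (simp only: zz(3) mem_ball)
      moreover have "dist z (g z y) < \<delta> / 2" using gb(1)[OF zz(1)] by (simp only: mem_ball)
      moreover have "dist z z' \<le> dist z (g z y) + dist z' (g z y)" by (rule dist_triangle2)
      ultimately show False using \<delta>(2)[OF zz(1,2,4)] by linarith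
    qed
    moreover have eq: "fibre y = (\<lambda>z. g z y) ` fibre w"
    proof (intro equalityI subsetI)
      fix z' assume z': "z' \<in> fibre y"
      moreover have "y \<in> ball w \<epsilon>" using y by (simp add: B_def)
      ultimately have "z' \<in> W" using \<epsilon>(3) by blast
      then obtain z where z: "z \<in> fibre w" "z' \<in> U2 z" unfolding W_def by blast
      then have "g z (\<phi> z') = z'" using *(6)[OF z(1)] by (simp add: U2_def homeomorphism_def)
      moreover have "\<phi> z' = y" using z' by (simp add: fibre_def)
      ultimately have "z' = g z y" by metis
      then show "z' \<in> (\<lambda>z. g z y) ` fibre w" using z(1) by (rule image_eqI)
    next
      fix z' assume "z' \<in> (\<lambda>z. g z y) ` fibre w"
      then obtain z where z: "z \<in> fibre w" "z' = g z y" by blast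
      have "z' \<in> U" using gb(2)[OF z(1)] *(2)[OF z(1)] z(2) by blast
      then show "z' \<in> fibre y" using gb(3)[OF z(1)] z(2) by (simp add: fibre_def)
    qed
    moreover have "\<forall>z\<in>fibre y. det (\<phi>' z) \<noteq> 0" unfolding eq using ** y by (auto simp: B_def V2_def)
    ultimately show ?thesis by blast
  qed
  ultimately show "\<exists>B g. open B \<and> w \<in> B \<and> B \<subseteq> V \<and>
      (\<forall>z\<in>fibre w. g z w = z \<and> (\<forall>y\<in>B. \<exists>A. (g z has_derivative (*v) A) (at y))) \<and>
      (\<forall>y\<in>B. inj_on (\<lambda>z. g z y) (fibre w) \<and> fibre y = (\<lambda>z. g z y) ` fibre w \<and>
         (\<forall>z\<in>fibre y. det (\<phi>' z) \<noteq> 0))"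
    by (intro exI[of _ B] exI[of _ g] conjI ballI[OF sheets])
qed

end

locale proper_map_off_hypersurface = proper_complex_map +
  fixes m :: nat and Q :: "complex ^ 'a \<Rightarrow> complex"
  assumes Q_poly: "polyfn m Q" and Q_nonzero: "\<exists>w. Q w \<noteq> 0"
    and critical: "z \<in> U \<Longrightarrow> det (\<phi>' z) = 0 \<Longrightarrow> Q (\<phi> z) = 0"
    and regular_dense: "z \<in> U \<Longrightarrow> \<epsilon> > 0 \<Longrightarrow> \<exists>z'\<in>U. dist z' z < \<epsilon> \<and> det (\<phi>' z') \<noteq> 0"
    and convex_target: "convex V"
begin

lemma regular: "Q w \<noteq> 0 \<Longrightarrow> \<forall>z\<in>fibre w. det (\<phi>' z) \<noteq> 0"
  using critical by (auto simp: fibre_def)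

lemmas generic_sheets = regular_fibre_sheets[OF _ regular]

lemma open_generic: "open {w \<in> V. Q w \<noteq> 0}"
proof -
  have "open {w. Q w \<noteq> 0}"
    by (intro open_Collect_neq polyfn_continuous[OF Q_poly] continuous_intros)
  then show ?thesis using open_target by (simp add: Collect_conj_eq open_Int)
qed

lemma card_fibre_locally_constant:
  assumes "w \<in> V" "\<forall>z\<in>fibre w. det (\<phi>' z) \<noteq> 0"
  shows "\<exists>B. open B \<and> w \<in> B \<and> B \<subseteq> V \<and> (\<forall>y\<in>B. card (fibre y) = card (fibre w))"
proof -
  from regular_fibre_sheets(2)[OF assms] obtain B g where B: "open B" "w \<in> B" "B \<subseteq> V"
    "\<forall>y\<in>B. inj_on (\<lambda>z. g z y) (fibre w) \<and> fibre y = (\<lambda>z. g z y) ` fibre w \<and>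
         (\<forall>z\<in>fibre y. det (\<phi>' z) \<noteq> 0)" by (elim exE conjE)
  have "card (fibre y) = card (fibre w)" if "y \<in> B" for y
    using B(4) that card_image[of "\<lambda>z. g z y" "fibre w"] by simp
  then show ?thesis using B(1-3) by blast
qed

lemma card_generic_fibre_constant:
  assumes w: "w0 \<in> V" "Q w0 \<noteq> 0" "w1 \<in> V" "Q w1 \<noteq> 0"
  shows "card (fibre w0) = card (fibre w1)"
proof -
  define L where "L s = w0 + s *s (w1 - w0)" for s
  obtain q where q: "\<And>s. Q (L s) = poly q s"
    unfolding L_def using polyfn_on_line[OF Q_poly] by blast
  have L: "L 0 = w0" "L 1 = w1" by (simp_all add: L_def)
  have contL: "continuous_on S L" for S
    unfolding L_def vector_scalar_mult_def by (intro continuous_intros)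
  have "poly q 0 \<noteq> 0" using w(2) L by (simp add: q[symmetric])
  then have "q \<noteq> 0" by auto
  then have fin: "finite {s. poly q s = 0}" by (rule poly_roots_finite)
  define S where "S = L -` V"
  have "open S" unfolding S_def
    using continuous_open_preimage[OF contL open_UNIV open_target] by simp
  moreover have "convex S"
  proof (rule convexI)
    fix x y :: complex and u v :: real
    assume *: "x \<in> S" "y \<in> S" "0 \<le> u" "0 \<le> v" "u + v = 1"
    have "L (u *\<^sub>R x + v *\<^sub>R y) = (u + v) *\<^sub>R w0 + (u *\<^sub>R x + v *\<^sub>R y) *s (w1 - w0)"
      using *(5) by (simp add: L_def)
    also have "\<dots> = u *\<^sub>R L x + v *\<^sub>R L y"
      by (simp add: vec_eq_iff L_def scaleR_conv_of_real[where 'a = complex] algebra_simps)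
    finally show "u *\<^sub>R x + v *\<^sub>R y \<in> S"
      using * convex_target by (auto simp: S_def convex_def)
  qed
  ultimately have conn: "connected (S - {s. poly q s = 0})"
    using fin by (intro connected_open_delete_finite convex_connected) auto
  have "(\<lambda>s. card (fibre (L s))) constant_on (S - {s. poly q s = 0})"
  proof (rule locally_constant_imp_constant[OF conn])
    fix a assume a: "a \<in> S - {s. poly q s = 0}"
    then have "L a \<in> V" "Q (L a) \<noteq> 0" by (auto simp: S_def q)
    then obtain B where B: "open B" "L a \<in> B" "B \<subseteq> V" "\<forall>y\<in>B. card (fibre y) = card (fibre (L a))"
      using card_fibre_locally_constant[OF _ regular, of "L a"] by blast
    have "open (L -` B)" using continuous_open_preimage[OF contL open_UNIV B(1)] by simp
    then have "openin (top_of_set (S - {s. poly q s = 0})) ((S - {s. poly q s = 0}) \<inter> L -` B)"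
      by (rule openin_open_Int)
    moreover have "a \<in> (S - {s. poly q s = 0}) \<inter> L -` B" using a B(2) by blast
    moreover have "\<forall>x\<in>(S - {s. poly q s = 0}) \<inter> L -` B. card (fibre (L x)) = card (fibre (L a))"
      using B(4) by blast
    ultimately show "\<exists>T. openin (top_of_set (S - {s. poly q s = 0})) T \<and> a \<in> T \<and>
        (\<forall>x\<in>T. card (fibre (L x)) = card (fibre (L a)))" by blast
  qed
  then obtain c where c: "\<forall>s\<in>S - {s. poly q s = 0}. card (fibre (L s)) = c"
    unfolding constant_on_def by (elim exE)
  moreover have "0 \<in> S - {s. poly q s = 0}" "1 \<in> S - {s. poly q s = 0}"
    using w L by (auto simp: S_def q[symmetric])
  ultimately have "card (fibre (L 0)) = c" "card (fibre (L 1)) = c" by blast+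
  then show ?thesis by (simp add: L)
qed

lemma generic_near:
  assumes "w \<in> V" "open B" "w \<in> B"
  shows "\<exists>y\<in>B. y \<in> V \<and> Q y \<noteq> 0"
proof -
  have "open (B \<inter> V)" "w \<in> B \<inter> V" using assms open_target by auto
  then obtain e where e: "e > 0" "ball w e \<subseteq> B \<inter> V" by (rule openE)
  from Q_nonzero obtain w1 where "Q w1 \<noteq> 0" by blast
  from polyfn_nonzero_dense[OF Q_poly this e(1)] obtain y where "dist y w < e" "Q y \<noteq> 0" by blast
  moreover from this have "y \<in> ball w e" by (simp add: dist_commute)
  ultimately show ?thesis using e(2) by blast
qed

lemma card_regular_fibre:
  assumes "w \<in> V" "\<forall>z\<in>fibre w. det (\<phi>' z) \<noteq> 0" "w1 \<in> V" "Q w1 \<noteq> 0"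
  shows "card (fibre w) = card (fibre w1)"
proof -
  obtain B where B: "open B" "w \<in> B" "\<forall>y\<in>B. card (fibre y) = card (fibre w)"
    using card_fibre_locally_constant[OF assms(1,2)] by (elim exE conjE)
  obtain y where y: "y \<in> B" "y \<in> V" "Q y \<noteq> 0" using generic_near[OF assms(1) B(1,2)] by (elim bexE conjE)
  have "card (fibre y) = card (fibre w)" using B(3) y(1) by (rule bspec)
  then have "card (fibre w) = card (fibre y)" by (rule sym)
  also have "\<dots> = card (fibre w1)" using y(2,3) assms(3,4) by (rule card_generic_fibre_constant)
  finally show ?thesis .
qed

lemma generic_preimages_dense:
  assumes "z \<in> U" "\<epsilon> > 0"
  shows "\<exists>z'\<in>U. dist z' z < \<epsilon> \<and> Q (\<phi> z') \<noteq> 0"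
proof -
  obtain z1 where z1: "z1 \<in> U" "dist z1 z < \<epsilon> / 2" "det (\<phi>' z1) \<noteq> 0"
    using regular_dense[OF assms(1), of "\<epsilon> / 2"] assms(2) by auto
  obtain U' V' g where *: "open U'" "U' \<subseteq> U" "z1 \<in> U'" "open V'" "\<phi> z1 \<in> V'" "homeomorphism U' V' \<phi> g"
    by (rule complex_matrix_inverse_function[OF open_dom deriv cont_deriv z1(1,3)], assumption, rule that)
  define W where "W = V' \<inter> g -` ball z1 (\<epsilon> / 2)"
  have "open W" unfolding W_def
    using *(4,6) by (intro continuous_open_preimage) (auto simp: homeomorphism_def)
  moreover have "\<phi> z1 \<in> W" using *(3,5,6) assms(2) by (auto simp: W_def homeomorphism_def)
  ultimately obtain e where e: "e > 0" "ball (\<phi> z1) e \<subseteq> W" by (rule openE)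
  from Q_nonzero obtain w1 where "Q w1 \<noteq> 0" by blast
  then obtain y where y: "dist y (\<phi> z1) < e" "Q y \<noteq> 0"
    using polyfn_nonzero_dense[OF Q_poly _ e(1)] by blast
  then have "y \<in> W" using e by (auto simp: dist_commute)
  then have g: "g y \<in> U" "\<phi> (g y) = y" "dist z1 (g y) < \<epsilon> / 2"
    using * by (auto simp: W_def homeomorphism_def)
  then have "dist (g y) z < \<epsilon>" using z1(2) by (metis dist_commute dist_triangle_half_l)
  then show ?thesis using g y by (intro bexI[of _ "g y"]) auto
qed

end

section \<open>S5\<close>

lemma maximum_principle_off_zeros:
  fixes f :: "complex \<Rightarrow> complex" and q :: "complex poly"
  assumes D: "open D" "cball 0 r \<subseteq> D" and r: "r > 0" and \<epsilon>: "\<epsilon> > 0"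
    and q0: "poly q 0 \<noteq> 0"
    and hol: "f holomorphic_on {s \<in> D. poly q s \<noteq> 0}"
    and bound: "\<And>s. norm s \<le> r \<Longrightarrow> poly q s \<noteq> 0 \<Longrightarrow> norm (f s) \<le> C"
    and circle: "\<And>s. norm s = r \<Longrightarrow> poly q s \<noteq> 0 \<and> norm (f s) \<le> \<epsilon>"
  shows "norm (f 0) \<le> \<epsilon>"
proof -
  define D' where "D' = {s \<in> D. poly q s \<noteq> 0}"
  have "q \<noteq> 0" using q0 by auto
  then have fin: "finite {s. poly q s = 0}" by (rule poly_roots_finite)
  have "open (D - {s. poly q s = 0})" using D(1) fin by (intro open_Diff finite_imp_closed)
  moreover have "D' = D - {s. poly q s = 0}" by (auto simp: D'_def)
  ultimately have oD': "open D'" by simp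
  have "continuous_on (cball 0 r) (poly q)" by (intro continuous_intros)
  then have "bounded (poly q ` cball 0 r)"
    by (intro compact_imp_bounded compact_continuous_image) auto
  then obtain M where "\<forall>y\<in>poly q ` cball 0 r. norm y \<le> M" unfolding bounded_iff by (elim exE)
  then have M: "norm (poly q s) \<le> M" if "norm s \<le> r" for s using that by simp
  have C0: "0 \<le> C" using order_trans[OF norm_ge_zero bound[of 0]] q0 r by simp
  have main: "norm (f 0) ^ n * norm (poly q 0) \<le> \<epsilon> ^ n * M" for n
  proof -
    define F where "F s = (if poly q s = 0 then 0 else f s ^ n * poly q s)" for s
    have Fhol: "F holomorphic_on D'"
    proof -
      have "(\<lambda>s. f s ^ n * poly q s) holomorphic_on D'"
        using hol unfolding D'_def by (intro holomorphic_intros)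
      then show ?thesis by (rule holomorphic_transform) (simp add: F_def D'_def)
    qed
    have Fcont: "continuous (at s within cball 0 r) F" if s: "s \<in> cball 0 r" for s
    proof (cases "poly q s = 0")
      case False
      then have "s \<in> D'" using s D by (auto simp: D'_def)
      then have "isCont F s"
        using holomorphic_on_imp_continuous_on[OF Fhol] oD' by (simp add: continuous_on_eq_continuous_at)
      then show ?thesis by (rule continuous_at_imp_continuous_at_within)
    next
      case True
      have "((\<lambda>s. C ^ n * poly q s) \<longlongrightarrow> C ^ n * poly q s) (at s within cball 0 r)"
        by (intro tendsto_intros)
      then have lim: "((\<lambda>s. C ^ n * poly q s) \<longlongrightarrow> 0) (at s within cball 0 r)" using True by simp
      have "(F \<longlongrightarrow> 0) (at s within cball 0 r)"
      proof (rule Lim_null_comparison[OF _ tendsto_norm_zero[OF lim]])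
        have "norm (F y) \<le> norm (C ^ n * poly q y)" if "y \<in> cball 0 r" for y
          using bound[of y] that C0
          by (auto simp: F_def norm_mult norm_power intro!: mult_right_mono power_mono)
        then show "\<forall>\<^sub>F x in at s within cball 0 r. norm (F x) \<le> norm (C ^ n * poly q x)"
          by (auto simp: eventually_at_filter)
      qed
      then show ?thesis using True by (simp add: continuous_within F_def)
    qed
    then have contF: "continuous_on (cball 0 r) F" by (simp add: continuous_on_eq_continuous_within)
    have "F holomorphic_on ball 0 r"
    proof (rule no_isolated_singularity[OF _ _ open_ball fin])
      show "continuous_on (ball 0 r) F" using contF ball_subset_cball by (rule continuous_on_subset)
      show "F holomorphic_on ball 0 r - {s. poly q s = 0}"
      proof (rule holomorphic_on_subset[OF Fhol])
        show "ball 0 r - {s. poly q s = 0} \<subseteq> D'" using D(2) ball_subset_cball[of 0 r] by (auto simp: D'_def)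
      qed
    qed
    then have Fin: "F holomorphic_on interior (cball 0 r)" by simp
    have "norm (F 0) \<le> \<epsilon> ^ n * M"
    proof (rule maximum_modulus_frontier[of F "cball 0 r"])
      fix s :: complex assume "s \<in> frontier (cball 0 r)"
      then have s: "norm s = r" using r by (simp add: frontier_cball)
      show "norm (F s) \<le> \<epsilon> ^ n * M"
        using circle[OF s] M[of s] s \<epsilon>
        by (auto simp: F_def norm_mult norm_power intro!: mult_mono power_mono)
    qed (use r contF Fin in auto)
    then show ?thesis using q0 by (simp add: F_def norm_mult norm_power)
  qed
  show ?thesis
  proof (rule ccontr)
    assume "\<not> ?thesis"
    then have "1 < norm (f 0) / \<epsilon>" using \<epsilon> by simp
    then obtain n where "M / norm (poly q 0) < (norm (f 0) / \<epsilon>) ^ n" using real_arch_pow by blast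
    then have "\<epsilon> ^ n * M < norm (f 0) ^ n * norm (poly q 0)"
      using q0 \<epsilon> by (simp add: power_divide field_simps)
    then show False using main[of n] by simp
  qed
qed

lemma has_derivative_line:
  fixes v w :: "complex ^ 'n"
  shows "((\<lambda>s. w + s *s v) has_derivative (\<lambda>s. s *s v)) (at s)"
proof -
  have "bounded_linear (\<lambda>s. s *s v)"
    by (intro linear_conv_bounded_linear[THEN iffD1] linearI)
      (simp_all add: vec_eq_iff scaleR_conv_of_real[where 'a = complex] algebra_simps)
  then have "((\<lambda>s. s *s v) has_derivative (\<lambda>s. s *s v)) (at s)" by (rule bounded_linear_imp_has_derivative)
  then show ?thesis using has_derivative_add[OF has_derivative_const[of w]] by fastforce
qed

lemma has_field_derivative_along_line:
  fixes g :: "complex ^ 'n \<Rightarrow> complex ^ 'n"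
  assumes "(g has_derivative (*v) A) (at (w + s *s v))"
  shows "((\<lambda>s. g (w + s *s v) $ i) has_field_derivative (A *v v) $ i) (at s)"
proof -
  from has_derivative_compose[OF has_derivative_line assms]
  have "((\<lambda>s. g (w + s *s v)) has_derivative (\<lambda>s. A *v (s *s v))) (at s)" .
  from bounded_linear.has_derivative[OF bounded_linear_vec_nth this, of i]
  have "((\<lambda>s. g (w + s *s v) $ i) has_derivative (\<lambda>s. (A *v (s *s v)) $ i)) (at s)" .
  moreover have "(A *v (s *s v)) $ i = (A *v v) $ i * s" for s
    by (simp add: matrix_vector_mult_def sum_distrib_left mult_ac)
  ultimately show ?thesis by (simp add: has_field_derivative_def)
qed

lemma continuous_line: "continuous_on S (\<lambda>s. w + s *s (v :: complex ^ 'n))"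
  unfolding vector_scalar_mult_def by (intro continuous_intros)

context proper_map_off_hypersurface
begin

definition coord_prod :: "'a \<Rightarrow> complex \<Rightarrow> complex ^ 'a \<Rightarrow> complex" where
  "coord_prod i t w = (\<Prod>z\<in>fibre w. t - z $ i)"

lemma coord_prod_sheets:
  assumes "w \<in> V" "Q w \<noteq> 0"
  obtains B g where "open B" "w \<in> B" "B \<subseteq> V"
    "\<And>z y. z \<in> fibre w \<Longrightarrow> y \<in> B \<Longrightarrow> \<exists>A. (g z has_derivative (*v) A) (at y)"
    "\<And>y. y \<in> B \<Longrightarrow> coord_prod i t y = (\<Prod>z\<in>fibre w. t - g z y $ i)"
proof -
  from generic_sheets(2)[OF assms] obtain B g where B: "open B" "w \<in> B" "B \<subseteq> V"
    "\<forall>z\<in>fibre w. g z w = z \<and> (\<forall>y\<in>B. \<exists>A. (g z has_derivative (*v) A) (at y))"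
    "\<forall>y\<in>B. inj_on (\<lambda>z. g z y) (fibre w) \<and> fibre y = (\<lambda>z. g z y) ` fibre w \<and>
       (\<forall>z\<in>fibre y. det (\<phi>' z) \<noteq> 0)" by (elim exE conjE)
  show ?thesis
  proof (rule that[OF B(1-3)])
    show "\<exists>A. (g z has_derivative (*v) A) (at y)" if "z \<in> fibre w" "y \<in> B" for z y
      using B(4) that by blast
    show "coord_prod i t y = (\<Prod>z\<in>fibre w. t - g z y $ i)" if "y \<in> B" for y
    proof -
      have *: "inj_on (\<lambda>z. g z y) (fibre w)" "fibre y = (\<lambda>z. g z y) ` fibre w" using B(5) that by blast+
      show ?thesis unfolding coord_prod_def *(2) by (simp add: prod.reindex[OF *(1)])
    qed
  qed
qed

lemma coord_prod_continuous: "continuous_on {w \<in> V. Q w \<noteq> 0} (coord_prod i t)"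
proof (rule continuous_at_imp_continuous_on, rule ballI)
  fix w assume "w \<in> {w \<in> V. Q w \<noteq> 0}"
  then have w: "w \<in> V" "Q w \<noteq> 0" by auto
  from coord_prod_sheets[OF w, of i t] obtain B g where B: "open B" "w \<in> B"
    "\<And>z y. z \<in> fibre w \<Longrightarrow> y \<in> B \<Longrightarrow> \<exists>A. (g z has_derivative (*v) A) (at y)"
    "\<And>y. y \<in> B \<Longrightarrow> coord_prod i t y = (\<Prod>z\<in>fibre w. t - g z y $ i)" by metis
  have g: "continuous_on B (g z)" if "z \<in> fibre w" for z
    using B(3)[OF that] by (meson continuous_at_imp_continuous_on has_derivative_continuous)
  have "continuous_on B (\<lambda>y. \<Prod>z\<in>fibre w. t - g z y $ i)"
    by (intro continuous_intros g)
  then have "continuous_on B (coord_prod i t)"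
    by (rule continuous_on_eq) (use B(4) in simp)
  then show "isCont (coord_prod i t) w" using B(1,2) by (simp add: continuous_on_eq_continuous_at)
qed

lemma coord_prod_holomorphic_on_line:
  "(\<lambda>s. coord_prod i t (w + s *s v)) holomorphic_on {s. w + s *s v \<in> V \<and> Q (w + s *s v) \<noteq> 0}"
  unfolding holomorphic_on_def
proof
  fix s0 assume "s0 \<in> {s. w + s *s v \<in> V \<and> Q (w + s *s v) \<noteq> 0}"
  then have s0: "w + s0 *s v \<in> V" "Q (w + s0 *s v) \<noteq> 0" by auto
  from coord_prod_sheets[OF s0, of i t] obtain B g where B: "open B" "w + s0 *s v \<in> B"
    "\<And>z y. z \<in> fibre (w + s0 *s v) \<Longrightarrow> y \<in> B \<Longrightarrow> \<exists>A. (g z has_derivative (*v) A) (at y)"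
    "\<And>y. y \<in> B \<Longrightarrow> coord_prod i t y = (\<Prod>z\<in>fibre (w + s0 *s v). t - g z y $ i)" by metis
  define T where "T = (\<lambda>s. w + s *s v) -` B"
  have T: "open T" "s0 \<in> T"
    using continuous_open_preimage[OF continuous_line open_UNIV B(1)] B(2) by (auto simp: T_def)
  have "(\<lambda>s. g z (w + s *s v) $ i) holomorphic_on T" if z: "z \<in> fibre (w + s0 *s v)" for z
    unfolding holomorphic_on_open[OF T(1)]
  proof
    fix s assume "s \<in> T"
    then have "w + s *s v \<in> B" by (simp add: T_def)
    from B(3)[OF z this] obtain A where "(g z has_derivative (*v) A) (at (w + s *s v))" by (elim exE)
    from has_field_derivative_along_line[OF this]
    show "\<exists>f'. ((\<lambda>s. g z (w + s *s v) $ i) has_field_derivative f') (at s)" by (rule exI)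
  qed
  then have "(\<lambda>s. \<Prod>z\<in>fibre (w + s0 *s v). t - g z (w + s *s v) $ i) holomorphic_on T"
    by (intro holomorphic_intros)
  then have "(\<lambda>s. coord_prod i t (w + s *s v)) holomorphic_on T"
    by (rule holomorphic_transform) (use B(4) in \<open>simp add: T_def\<close>)
  then show "(\<lambda>s. coord_prod i t (w + s *s v)) field_differentiable
      (at s0 within {s. w + s *s v \<in> V \<and> Q (w + s *s v) \<noteq> 0})"
    using T by (meson field_differentiable_at_within holomorphic_on_imp_differentiable_at)
qed

lemma generic_degree: "\<exists>N. \<forall>w\<in>V. Q w \<noteq> 0 \<longrightarrow> card (fibre w) = N"
  using card_generic_fibre_constant by metis

lemma coord_bound:
  assumes "compact K" "K \<subseteq> V"
  shows "\<exists>R\<ge>1. \<forall>z\<in>U. \<phi> z \<in> K \<longrightarrow> norm (t - z $ i) \<le> R"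
proof -
  have "bounded {z \<in> U. \<phi> z \<in> K}" using proper[OF assms] by (rule compact_imp_bounded)
  then obtain R where R: "\<forall>z\<in>{z \<in> U. \<phi> z \<in> K}. norm z \<le> R" by (auto simp: bounded_iff)
  have "norm (t - z $ i) \<le> max 1 (norm t + R)" if "z \<in> U" "\<phi> z \<in> K" for z
  proof -
    have "norm (t - z $ i) \<le> norm t + norm (z $ i)" by (rule norm_triangle_ineq4)
    also have "norm (z $ i) \<le> norm z" by (rule Finite_Cartesian_Product.norm_nth_le)
    also have "norm z \<le> R" using R that by blast
    finally show ?thesis by simp
  qed
  then show ?thesis by (intro exI[of _ "max 1 (norm t + R)"]) auto
qed

lemma coord_prod_nearly_constant:
  assumes w: "w \<in> V" and \<epsilon>: "\<epsilon> > 0"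
  shows "\<exists>\<eta>>0. \<forall>w1\<in>ball w \<eta>. \<forall>w2\<in>ball w \<eta>. Q w1 \<noteq> 0 \<longrightarrow> Q w2 \<noteq> 0 \<longrightarrow>
    norm (coord_prod i t w1 - coord_prod i t w2) \<le> \<epsilon>"
proof -
  let ?h = "coord_prod i t"
  let ?G = "{w \<in> V. Q w \<noteq> 0}"
  obtain \<rho> where \<rho>: "\<rho> > 0" "cball w \<rho> \<subseteq> V" using w open_target open_contains_cball by blast
  from Q_nonzero obtain w' where "Q w' \<noteq> 0" by blast
  define v where "v = w' - w"
  obtain q where q: "\<And>s. Q (w + s *s v) = poly q s" using polyfn_on_line[OF Q_poly] by blast
  have "poly q 1 \<noteq> 0" using \<open>Q w' \<noteq> 0\<close> by (simp add: v_def flip: q)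
  then have "q \<noteq> 0" by auto
  then obtain \<delta> where \<delta>: "\<delta> > 0" "\<And>s. s \<noteq> 0 \<Longrightarrow> norm s < \<delta> \<Longrightarrow> poly q s \<noteq> 0"
    using poly_nonzero_near_0 by blast
  define c where "c = norm v + 1"
  have c: "c > 0" "norm v \<le> c" by (simp_all add: c_def add_nonneg_pos)
  define r where "r = min (\<delta> / 2) (\<rho> / (3 * c))"
  have "r \<le> \<delta> / 2" by (simp add: r_def)
  moreover have "r > 0" using \<delta>(1) \<rho>(1) c by (simp add: r_def)
  ultimately have r: "r > 0" "r < \<delta>" by linarith+
  have "r * norm v \<le> r * c" using r c by (intro mult_left_mono) auto
  also have "\<dots> \<le> \<rho> / (3 * c) * c" using c by (intro mult_right_mono) (auto simp: r_def)
  also have "\<dots> = \<rho> / 3" using c by simp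
  finally have rv: "r * norm v \<le> \<rho> / 3" .
  have in\<rho>: "y + s *s v \<in> cball w \<rho>" if "dist w y \<le> \<rho> / 2" "norm s \<le> r" for y s
  proof -
    have "dist y (y + s *s v) = norm s * norm v" using dist_line[of y s v] by (simp add: dist_commute)
    also have "\<dots> \<le> r * norm v" using that by (intro mult_right_mono) auto
    finally have "dist y (y + s *s v) \<le> \<rho> / 3" using rv by simp
    then have "dist w (y + s *s v) \<le> \<rho>"
      using that(1) \<rho>(1) dist_triangle[of w "y + s *s v" y] by simp
    then show ?thesis by simp
  qed
  define C0 where "C0 = (\<lambda>s. w + s *s v) ` sphere 0 r"
  have "compact C0" unfolding C0_def by (intro compact_continuous_image continuous_line compact_sphere)
  moreover have "C0 \<subseteq> ?G"
  proof
    fix y assume "y \<in> C0"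
    then obtain s where s: "norm s = r" "y = w + s *s v" by (auto simp: C0_def)
    then have "s \<noteq> 0" "norm s < \<delta>" using r by auto
    then have "Q y \<noteq> 0" using \<delta>(2) by (simp add: s(2) q)
    moreover have "y \<in> V" using in\<rho>[of w s] s \<rho> by auto
    ultimately show "y \<in> ?G" by simp
  qed
  ultimately obtain e where e: "e > 0" "(\<Union>x\<in>C0. cball x e) \<subseteq> ?G"
    using compact_subset_open_imp_cball_epsilon_subset[OF _ open_generic] by blast
  define H where "H = (\<lambda>p. ?h (w + fst p *s v + snd p))"
  define P where "P = sphere (0 :: complex) r \<times> cball (0 :: complex ^ 'a) e"
  have inG: "w + s *s v + u \<in> ?G" if "norm s = r" "norm u \<le> e" for s u
  proof -
    have "w + s *s v \<in> C0" using that(1) by (auto simp: C0_def)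
    moreover have "w + s *s v + u \<in> cball (w + s *s v) e" using that by (simp add: dist_norm)
    ultimately show ?thesis using e(2) by blast
  qed
  have "continuous_on P H"
    unfolding H_def
  proof (rule continuous_on_compose2[OF coord_prod_continuous])
    show "continuous_on P (\<lambda>x. w + fst x *s v + snd x)"
      unfolding vector_scalar_mult_def by (intro continuous_intros)
    show "(\<lambda>x. w + fst x *s v + snd x) ` P \<subseteq> ?G" using inG by (auto simp: P_def)
  qed
  then have "uniformly_continuous_on P H"
    by (rule compact_uniformly_continuous) (simp add: P_def compact_Times)
  then obtain \<eta>1 where \<eta>1: "\<eta>1 > 0"
    "\<And>x y. x \<in> P \<Longrightarrow> y \<in> P \<Longrightarrow> dist y x < \<eta>1 \<Longrightarrow> dist (H y) (H x) < \<epsilon> / 2"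
    using \<epsilon> unfolding uniformly_continuous_on_def by (meson half_gt_zero)
  define \<eta> where "\<eta> = min (min \<eta>1 e) (\<rho> / 2)"
  have \<eta>: "\<eta> > 0" using \<eta>1(1) e(1) \<rho>(1) by (simp add: \<eta>_def)
  have near: "y + s *s v \<in> ?G \<and> norm (?h (y + s *s v) - ?h (w + s *s v)) < \<epsilon> / 2"
    if "y \<in> ball w \<eta>" "norm s = r" for y s
  proof -
    have ny: "norm (y - w) < \<eta>1" "norm (y - w) \<le> e"
      using that(1) by (auto simp: \<eta>_def dist_norm norm_minus_commute)
    have yw: "y + s *s v = w + s *s v + (y - w)" by simp
    have "dist (s, y - w) (s, 0 :: complex ^ 'a) = norm (y - w)" by (simp add: dist_Pair_Pair)
    then have "dist (H (s, y - w)) (H (s, 0)) < \<epsilon> / 2"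
      using ny that(2) e(1) by (intro \<eta>1(2)) (auto simp: P_def)
    then have "norm (?h (y + s *s v) - ?h (w + s *s v)) < \<epsilon> / 2"
      unfolding yw by (simp add: H_def dist_norm)
    then show ?thesis using inG[OF that(2) ny(2)] unfolding yw by blast
  qed
  obtain N where N: "\<And>y. y \<in> V \<Longrightarrow> Q y \<noteq> 0 \<Longrightarrow> card (fibre y) = N" using generic_degree by blast
  obtain R where R: "R \<ge> 1" "\<And>z. z \<in> U \<Longrightarrow> \<phi> z \<in> cball w \<rho> \<Longrightarrow> norm (t - z $ i) \<le> R"
    using coord_bound[OF compact_cball \<rho>(2)] by blast
  have hb: "norm (?h y) \<le> R ^ N" if "y \<in> cball w \<rho>" "Q y \<noteq> 0" for y
  proof -
    have "norm (?h y) \<le> (\<Prod>z\<in>fibre y. R)"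
      unfolding coord_prod_def prod_norm[symmetric]
      using R(2) that by (intro prod_mono) (auto simp: fibre_def)
    then show ?thesis using N[of y] that \<rho>(2) by auto
  qed
  show ?thesis
  proof (intro exI[of _ \<eta>] conjI ballI impI \<eta>)
    fix w1 w2 assume ball: "w1 \<in> ball w \<eta>" "w2 \<in> ball w \<eta>" and Q12: "Q w1 \<noteq> 0" "Q w2 \<noteq> 0"
    have d12: "dist w w1 \<le> \<rho> / 2" "dist w w2 \<le> \<rho> / 2" using ball by (auto simp: \<eta>_def)
    obtain q1 where q1: "\<And>s. Q (w1 + s *s v) = poly q1 s" using polyfn_on_line[OF Q_poly] by blast
    obtain q2 where q2: "\<And>s. Q (w2 + s *s v) = poly q2 s" using polyfn_on_line[OF Q_poly] by blast
    define D where "D = (\<lambda>s. w1 + s *s v) -` V \<inter> (\<lambda>s. w2 + s *s v) -` V"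
    define f where "f s = ?h (w1 + s *s v) - ?h (w2 + s *s v)" for s
    have "norm (f 0) \<le> \<epsilon>"
    proof (rule maximum_principle_off_zeros[where D = D and r = r and q = "q1 * q2" and C = "R ^ N + R ^ N"])
      show "open D" unfolding D_def
        using continuous_open_preimage[OF continuous_line open_UNIV open_target] by (intro open_Int) auto
      show "cball 0 r \<subseteq> D"
      proof
        fix s :: complex assume "s \<in> cball 0 r"
        then have "norm s \<le> r" by simp
        then show "s \<in> D" using in\<rho>[OF d12(1)] in\<rho>[OF d12(2)] \<rho>(2) unfolding D_def by blast
      qed
      show "poly (q1 * q2) 0 \<noteq> 0" using Q12 q1[of 0] q2[of 0] by simp
      show "f holomorphic_on {s \<in> D. poly (q1 * q2) s \<noteq> 0}"
        unfolding f_def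
        by (intro holomorphic_on_diff holomorphic_on_subset[OF coord_prod_holomorphic_on_line])
          (auto simp: D_def q1 q2)
      show "norm (f s) \<le> R ^ N + R ^ N" if "norm s \<le> r" "poly (q1 * q2) s \<noteq> 0" for s
      proof -
        have "norm (?h (w1 + s *s v)) \<le> R ^ N" "norm (?h (w2 + s *s v)) \<le> R ^ N"
          using in\<rho>[OF d12(1) that(1)] in\<rho>[OF d12(2) that(1)] that(2) by (auto intro!: hb simp: q1 q2)
        then show ?thesis unfolding f_def by (intro norm_triangle_le_diff add_mono)
      qed
      show "poly (q1 * q2) s \<noteq> 0 \<and> norm (f s) \<le> \<epsilon>" if s: "norm s = r" for s
      proof
        show "poly (q1 * q2) s \<noteq> 0" using near[OF ball(1) s] near[OF ball(2) s] by (simp add: q1 q2)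
        have "norm (?h (w1 + s *s v) - ?h (w + s *s v) - (?h (w2 + s *s v) - ?h (w + s *s v))) \<le> \<epsilon> / 2 + \<epsilon> / 2"
          using near[OF ball(1) s] near[OF ball(2) s]
          by (intro norm_triangle_le_diff[OF add_mono] less_imp_le) blast+
        then show "norm (f s) \<le> \<epsilon>" by (simp add: f_def)
      qed
    qed (use r \<epsilon> in auto)
    then show "norm (?h w1 - ?h w2) \<le> \<epsilon>" by (simp add: f_def)
  qed
qed

lemma nearby_fibre_coordinate:
  assumes w: "w \<in> V" and z: "z \<in> fibre w" and \<delta>: "\<delta> > 0"
  shows "\<exists>\<eta>>0. ball w \<eta> \<subseteq> V \<and> (\<forall>y\<in>ball w \<eta>. Q y \<noteq> 0 \<longrightarrow> (\<exists>z'\<in>fibre y. norm (z $ i - z' $ i) < \<delta>))"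
proof -
  let ?h = "coord_prod i (z $ i)"
  obtain \<rho> where \<rho>: "\<rho> > 0" "cball w \<rho> \<subseteq> V" using w open_target open_contains_cball by blast
  obtain N where N: "\<And>y. y \<in> V \<Longrightarrow> Q y \<noteq> 0 \<Longrightarrow> card (fibre y) = N" using generic_degree by blast
  obtain R where R: "R \<ge> 1" "\<And>z'. z' \<in> U \<Longrightarrow> \<phi> z' \<in> cball w \<rho> \<Longrightarrow> norm (z $ i - z' $ i) \<le> R"
    using coord_bound[OF compact_cball \<rho>(2)] by blast
  define \<epsilon> where "\<epsilon> = \<delta> ^ N / 4"
  have \<epsilon>: "\<epsilon> > 0" using \<delta> by (simp add: \<epsilon>_def)
  obtain \<eta>0 where \<eta>0: "\<eta>0 > 0" "\<And>w1 w2. w1 \<in> ball w \<eta>0 \<Longrightarrow> w2 \<in> ball w \<eta>0 \<Longrightarrow> Q w1 \<noteq> 0 \<Longrightarrow> Q w2 \<noteq> 0 \<Longrightarrow>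
      norm (?h w1 - ?h w2) \<le> \<epsilon>"
    using coord_prod_nearly_constant[OF w \<epsilon>] by blast
  define \<eta> where "\<eta> = min \<eta>0 \<rho>"
  have \<eta>: "\<eta> > 0" using \<eta>0 \<rho> by (simp add: \<eta>_def)
  have zU: "z \<in> U" "\<phi> z = w" using z by (auto simp: fibre_def)
  have "continuous (at z) \<phi>" using continuous_map open_dom zU(1) by (simp add: continuous_on_eq_continuous_at)
  then obtain d where d: "d > 0" "\<And>z'. dist z' z < d \<Longrightarrow> dist (\<phi> z') (\<phi> z) < \<eta>"
    using \<eta> unfolding continuous_at_eps_delta by blast
  obtain z1 where z1: "z1 \<in> U" "dist z1 z < min d (\<epsilon> / R ^ N)" "Q (\<phi> z1) \<noteq> 0"
    using generic_preimages_dense[OF zU(1), of "min d (\<epsilon> / R ^ N)"] d(1) \<epsilon> R(1) by auto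
  define w1 where "w1 = \<phi> z1"
  have w1: "w1 \<in> ball w \<eta>" "Q w1 \<noteq> 0" using d(2)[of z1] z1 zU by (auto simp: w1_def dist_commute)
  have w1V: "w1 \<in> V" "w1 \<in> cball w \<rho>" using w1(1) \<rho>(2) by (auto simp: \<eta>_def)
  have fin: "finite (fibre w1)" using generic_sheets(1)[OF w1V(1) w1(2)] .
  have mem: "z1 \<in> fibre w1" using z1(1) by (simp add: fibre_def w1_def)
  have "norm (?h w1) \<le> \<epsilon>"
  proof -
    have "norm (?h w1) = norm (z $ i - z1 $ i) * (\<Prod>z'\<in>fibre w1 - {z1}. norm (z $ i - z' $ i))"
      unfolding coord_prod_def prod.remove[OF fin mem] norm_mult prod_norm ..
    also have "\<dots> \<le> (\<epsilon> / R ^ N) * (\<Prod>z'\<in>fibre w1 - {z1}. R)"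
    proof (intro mult_mono prod_mono)
      have "norm (z $ i - z1 $ i) \<le> norm (z - z1)" using Finite_Cartesian_Product.norm_nth_le[of "z - z1" i] by simp
      also have "\<dots> \<le> \<epsilon> / R ^ N" using z1(2) by (simp add: dist_norm norm_minus_commute)
      finally show "norm (z $ i - z1 $ i) \<le> \<epsilon> / R ^ N" .
      show "0 \<le> norm (z $ i - z' $ i) \<and> norm (z $ i - z' $ i) \<le> R" if "z' \<in> fibre w1 - {z1}" for z'
        using R(2)[of z'] that w1V(2) by (auto simp: fibre_def)
    qed (use \<epsilon> R(1) in \<open>auto intro!: prod_nonneg\<close>)
    also have "\<dots> \<le> (\<epsilon> / R ^ N) * R ^ N"
    proof -
      have "R ^ card (fibre w1 - {z1}) \<le> R ^ card (fibre w1)"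
        using R(1) fin by (intro power_increasing card_mono) auto
      then show ?thesis using N[OF w1V(1) w1(2)] \<epsilon> R(1) by (intro mult_left_mono) auto
    qed
    also have "\<dots> = \<epsilon>" using R(1) by simp
    finally show ?thesis .
  qed
  show ?thesis
  proof (intro exI[of _ \<eta>] conjI ballI impI \<eta>)
    show "ball w \<eta> \<subseteq> V" using \<rho>(2) by (auto simp: \<eta>_def)
    fix y assume y: "y \<in> ball w \<eta>" "Q y \<noteq> 0"
    then have yV: "y \<in> V" using \<rho>(2) by (auto simp: \<eta>_def)
    have "norm (?h y - ?h w1) \<le> \<epsilon>" using y w1 by (intro \<eta>0(2)) (auto simp: \<eta>_def)
    then have "norm (?h y) \<le> \<epsilon> + \<epsilon>" using \<open>norm (?h w1) \<le> \<epsilon>\<close> norm_triangle_sub[of "?h y" "?h w1"] by linarith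
    also have "\<dots> < \<delta> ^ N" using \<delta> by (simp add: \<epsilon>_def)
    finally have small: "norm (?h y) < \<delta> ^ N" .
    show "\<exists>z'\<in>fibre y. norm (z $ i - z' $ i) < \<delta>"
    proof (rule ccontr)
      assume "\<not> ?thesis"
      then have "(\<Prod>z'\<in>fibre y. \<delta>) \<le> (\<Prod>z'\<in>fibre y. norm (z $ i - z' $ i))"
        using \<delta> by (intro prod_mono) (auto simp: not_less)
      then have "\<delta> ^ N \<le> norm (?h y)" using N[OF yV y(2)] by (simp add: coord_prod_def prod_norm)
      then show False using small by simp
    qed
  qed
qed

lemma finite_fibre_coordinates:
  assumes w: "w \<in> V"
  shows "finite ((\<lambda>z. z $ i) ` fibre w)"
proof (rule ccontr)
  assume inf: "infinite ((\<lambda>z. z $ i) ` fibre w)"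
  obtain N where N: "\<And>y. y \<in> V \<Longrightarrow> Q y \<noteq> 0 \<Longrightarrow> card (fibre y) = N" using generic_degree by blast
  obtain A where A: "A \<subseteq> (\<lambda>z. z $ i) ` fibre w" "finite A" "card A = Suc N"
    using infinite_arbitrarily_large[OF inf, of "Suc N"] by blast
  obtain \<delta> where \<delta>: "\<delta> > 0" "\<And>a b. a \<in> A \<Longrightarrow> b \<in> A \<Longrightarrow> a \<noteq> b \<Longrightarrow> 2 * \<delta> \<le> dist a b"
  proof -
    define X where "X = insert 1 ((\<lambda>(a, b). dist a b) ` {(a, b) \<in> A \<times> A. a \<noteq> b})"
    have "finite {(a, b) \<in> A \<times> A. a \<noteq> b}" by (rule finite_subset[of _ "A \<times> A"]) (use A(2) in auto)
    then have fX: "finite X" by (simp add: X_def)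
    have pos: "0 < x" if "x \<in> X" for x using that unfolding X_def by auto
    have "X \<noteq> {}" by (simp add: X_def)
    then have "Min X > 0" by (rule pos[OF Min_in[OF fX]])
    have le: "Min X \<le> dist a b" if "a \<in> A" "b \<in> A" "a \<noteq> b" for a b
    proof (rule Min_le[OF fX])
      show "dist a b \<in> X" unfolding X_def using that by (intro insertI2 image_eqI[of _ _ "(a, b)"]) auto
    qed
    show ?thesis
    proof (rule that)
      show "0 < Min X / 2" using \<open>Min X > 0\<close> by simp
      show "2 * (Min X / 2) \<le> dist a b" if "a \<in> A" "b \<in> A" "a \<noteq> b" for a b using le[OF that] by simp
    qed
  qed
  have "\<forall>a\<in>A. \<exists>\<eta>>0. \<forall>y\<in>ball w \<eta>. Q y \<noteq> 0 \<longrightarrow> (\<exists>z'\<in>fibre y. norm (a - z' $ i) < \<delta>)"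
  proof
    fix a assume "a \<in> A"
    then obtain z where z: "z \<in> fibre w" "a = z $ i" using A(1) by blast
    show "\<exists>\<eta>>0. \<forall>y\<in>ball w \<eta>. Q y \<noteq> 0 \<longrightarrow> (\<exists>z'\<in>fibre y. norm (a - z' $ i) < \<delta>)"
      unfolding z(2) using nearby_fibre_coordinate[OF w z(1) \<delta>(1), of i] by blast
  qed
  from bchoice[OF this] obtain \<eta> where
    \<eta>: "\<forall>a\<in>A. \<eta> a > 0 \<and> (\<forall>y\<in>ball w (\<eta> a). Q y \<noteq> 0 \<longrightarrow> (\<exists>z'\<in>fibre y. norm (a - z' $ i) < \<delta>))"
    by (elim exE)
  define B where "B = (\<Inter>a\<in>A. ball w (\<eta> a))"
  have "open B" unfolding B_def using A(2) by (intro open_INT) auto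
  moreover have "w \<in> B" using \<eta> by (simp add: B_def)
  ultimately obtain y where y: "y \<in> B" "y \<in> V" "Q y \<noteq> 0" using generic_near[OF w] by blast
  have "\<forall>a\<in>A. \<exists>z'. z' \<in> fibre y \<and> norm (a - z' $ i) < \<delta>"
  proof
    fix a assume a: "a \<in> A"
    then have "y \<in> ball w (\<eta> a)" using y(1) unfolding B_def by blast
    then show "\<exists>z'. z' \<in> fibre y \<and> norm (a - z' $ i) < \<delta>" using \<eta> a y(3) by blast
  qed
  from bchoice[OF this] obtain g where g: "\<forall>a\<in>A. g a \<in> fibre y \<and> norm (a - g a $ i) < \<delta>" by (elim exE)
  have "inj_on g A"
  proof (rule inj_onI, rule ccontr)
    fix a b assume ab: "a \<in> A" "b \<in> A" "g a = g b" "a \<noteq> b"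
    have "dist a (g a $ i) < \<delta>" "dist b (g a $ i) < \<delta>"
      using g ab(1,2) unfolding ab(3) by (auto simp: dist_norm ab(3))
    then show False using \<delta>(2)[OF ab(1,2,4)] dist_triangle2[of a b "g a $ i"] by linarith
  qed
  then have "card A \<le> card (fibre y)"
    using g generic_sheets(1)[OF y(2,3)] by (intro card_inj_on_le[of g]) auto
  then show False using A(3) N[OF y(2,3)] by simp
qed

theorem finite_fibre:
  assumes "w \<in> V"
  shows "finite (fibre w)"
proof -
  have "finite ((\<lambda>f. \<chi> i. f i) ` (\<Pi>\<^sub>E i\<in>UNIV. (\<lambda>z. z $ i) ` fibre w))"
    by (intro finite_imageI finite_PiE finite_fibre_coordinates assms) auto
  moreover have "fibre w \<subseteq> (\<lambda>f. \<chi> i. f i) ` (\<Pi>\<^sub>E i\<in>UNIV. (\<lambda>z. z $ i) ` fibre w)"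
  proof
    fix z assume "z \<in> fibre w"
    then show "z \<in> (\<lambda>f. \<chi> i. f i) ` (\<Pi>\<^sub>E i\<in>UNIV. (\<lambda>z. z $ i) ` fibre w)"
      by (intro image_eqI[of _ _ "\<lambda>i. z $ i"]) auto
  qed
  ultimately show ?thesis by (rule rev_finite_subset)
qed

end

section \<open>S6\<close>

lemma has_derivative_vecI:
  fixes f :: "'a::real_normed_vector \<Rightarrow> complex ^ 'n"
  assumes "\<And>i. ((\<lambda>s. f s $ i) has_derivative (\<lambda>h. f' h $ i)) (at x within S)"
  shows "(f has_derivative f') (at x within S)"
  unfolding has_derivative_componentwise_within[of f]
proof
  fix b :: "complex ^ 'n" assume "b \<in> Basis"
  then obtain i u where b: "b = axis i u" by (auto simp: Basis_vec_def)
  show "((\<lambda>x. f x \<bullet> b) has_derivative (\<lambda>x. f' x \<bullet> b)) (at x within S)"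
    unfolding b inner_axis using assms[of i] by (rule has_derivative_inner_left)
qed

context proper_map_off_hypersurface
begin

definition isolating :: "(complex ^ 'a) set \<Rightarrow> complex ^ 'a \<Rightarrow> bool" where
  "isolating N a \<longleftrightarrow> open N \<and> a \<in> N \<and> compact (closure N) \<and> closure N \<subseteq> U \<and> fibre (\<phi> a) \<inter> closure N = {a}"

lemma isolating_fibre_subset:
  assumes N: "isolating N a" and W: "open W" "a \<in> W"
  shows "\<exists>\<epsilon>>0. \<forall>y\<in>ball (\<phi> a) \<epsilon>. fibre y \<inter> closure N \<subseteq> W"
proof -
  have N': "compact (closure N)" "closure N \<subseteq> U" "fibre (\<phi> a) \<inter> closure N = {a}"
    using N by (simp_all add: isolating_def)
  have "compact (closure N - W)" using N'(1) W(1) by (rule compact_diff)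
  moreover have "closure N - W \<subseteq> U" using N'(2) by blast
  moreover have "\<phi> z \<noteq> \<phi> a" if "z \<in> closure N - W" for z
  proof
    assume "\<phi> z = \<phi> a"
    then have "z \<in> fibre (\<phi> a) \<inter> closure N" using that N'(2) by (auto simp: fibre_def)
    then show False using N'(3) that W(2) by auto
  qed
  ultimately obtain \<epsilon> where \<epsilon>: "\<epsilon> > 0" "\<forall>z\<in>closure N - W. \<phi> z \<notin> ball (\<phi> a) \<epsilon>"
    using misses_nearby_values[of "closure N - W" "\<phi> a"] by blast
  have "fibre y \<inter> closure N \<subseteq> W" if "y \<in> ball (\<phi> a) \<epsilon>" for y
  proof
    fix z assume z: "z \<in> fibre y \<inter> closure N"
    then have "\<phi> z = y" by (simp add: fibre_def)
    then have "\<phi> z \<in> ball (\<phi> a) \<epsilon>" using that by simp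
    then show "z \<in> W" using \<epsilon>(2) z by blast
  qed
  then show ?thesis using \<epsilon>(1) by blast
qed

lemma isolating_count_constant:
  assumes N: "isolating N a" and aV: "\<phi> a \<in> V"
  shows "\<exists>\<epsilon>>0. ball (\<phi> a) \<epsilon> \<subseteq> V \<and>
    (\<exists>\<mu>. \<forall>y\<in>ball (\<phi> a) \<epsilon>. Q y \<noteq> 0 \<longrightarrow> card (fibre y \<inter> N) = \<mu>)"
proof -
  have N': "open N" "a \<in> N" "compact (closure N)" "closure N \<subseteq> U"
    using N by (simp_all add: isolating_def)
  obtain \<epsilon>1 where \<epsilon>1: "\<epsilon>1 > 0" "\<forall>y\<in>ball (\<phi> a) \<epsilon>1. fibre y \<inter> closure N \<subseteq> N"
    using isolating_fibre_subset[OF N N'(1,2)] by blast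
  from open_target aV obtain \<epsilon>2 where \<epsilon>2: "\<epsilon>2 > 0" "ball (\<phi> a) \<epsilon>2 \<subseteq> V" by (rule openE)
  define \<epsilon> where "\<epsilon> = min \<epsilon>1 \<epsilon>2"
  have \<epsilon>: "\<epsilon> > 0" "ball (\<phi> a) \<epsilon> \<subseteq> V" "\<And>y. y \<in> ball (\<phi> a) \<epsilon> \<Longrightarrow> fibre y \<inter> closure N \<subseteq> N"
    using \<epsilon>1 \<epsilon>2 by (auto simp: \<epsilon>_def)
  have NU: "N \<subseteq> U" using N'(4) closure_subset by blast
  interpret loc: proper_map_off_hypersurface \<phi> \<phi>' N "ball (\<phi> a) \<epsilon>" m Q
  proof
    show "open N" by fact
    show "open (ball (\<phi> a) \<epsilon>)" "convex (ball (\<phi> a) \<epsilon>)" by simp_all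
    show "(\<phi> has_derivative (*v) (\<phi>' z)) (at z)" if "z \<in> N" for z using that NU by (intro deriv) blast
    show "continuous_on N \<phi>'" using cont_deriv NU by (rule continuous_on_subset)
    show "polyfn m Q" "\<exists>w. Q w \<noteq> 0" by (fact Q_poly Q_nonzero)+
    show "Q (\<phi> z) = 0" if "z \<in> N" "det (\<phi>' z) = 0" for z using that NU by (intro critical) blast
    show "\<exists>z'\<in>N. dist z' z < \<epsilon>' \<and> det (\<phi>' z') \<noteq> 0" if "z \<in> N" "0 < \<epsilon>'" for z \<epsilon>'
    proof -
      from N'(1) that(1) obtain e where e: "e > 0" "ball z e \<subseteq> N" by (rule openE)
      from that(2) e(1) have "min e \<epsilon>' > 0" by simp
      from regular_dense[OF subsetD[OF NU that(1)] this]
      obtain z' where "z' \<in> U" "dist z' z < min e \<epsilon>'" "det (\<phi>' z') \<noteq> 0" by blast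
      moreover from this have "z' \<in> ball z e" by (simp add: dist_commute)
      ultimately show ?thesis using e(2) by (intro bexI[of _ z']) auto
    qed
    show "compact {z \<in> N. \<phi> z \<in> K}" if K: "compact K" "K \<subseteq> ball (\<phi> a) \<epsilon>" for K
    proof -
      have "closed (closure N \<inter> \<phi> -` K)"
        by (rule continuous_closed_preimage[OF continuous_on_subset[OF continuous_map N'(4)] closed_closure
              compact_imp_closed[OF K(1)]])
      then have "compact (closure N \<inter> (closure N \<inter> \<phi> -` K))" using N'(3) by (intro compact_Int_closed)
      moreover have "closure N \<inter> (closure N \<inter> \<phi> -` K) = {z \<in> N. \<phi> z \<in> K}"
      proof (intro equalityI subsetI)
        fix z assume z: "z \<in> closure N \<inter> (closure N \<inter> \<phi> -` K)"
        then have "z \<in> fibre (\<phi> z) \<inter> closure N" "\<phi> z \<in> ball (\<phi> a) \<epsilon>"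
          using N'(4) K(2) by (auto simp: fibre_def)
        then have "z \<in> N" using \<epsilon>(3) by blast
        then show "z \<in> {z \<in> N. \<phi> z \<in> K}" using z by blast
      next
        fix z assume "z \<in> {z \<in> N. \<phi> z \<in> K}"
        then show "z \<in> closure N \<inter> (closure N \<inter> \<phi> -` K)" using closure_subset by blast
      qed
      ultimately show ?thesis by simp
    qed
  qed
  have eq: "loc.fibre y = fibre y \<inter> N" for y
    using NU unfolding loc.fibre_def fibre_def by blast
  have "\<exists>\<mu>. \<forall>y\<in>ball (\<phi> a) \<epsilon>. Q y \<noteq> 0 \<longrightarrow> card (fibre y \<inter> N) = \<mu>"
    using loc.generic_degree unfolding eq .
  then show ?thesis using \<epsilon>(1,2) by blast
qed

lemma zero_of_multiplicity:
  assumes a: "a \<in> U" "\<phi> a \<in> V"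
  shows "\<exists>\<mu>\<ge>1. \<forall>N. isolating N a \<longrightarrow>
    (\<exists>\<epsilon>>0. ball (\<phi> a) \<epsilon> \<subseteq> V \<and> (\<forall>y\<in>ball (\<phi> a) \<epsilon>. Q y \<noteq> 0 \<longrightarrow> card (fibre y \<inter> N) = \<mu>))"
proof (cases "\<exists>N. isolating N a")
  case False
  then show ?thesis by blast
next
  case True
  then obtain N0 where N0: "isolating N0 a" by blast
  obtain \<epsilon>0 \<mu> where \<epsilon>0: "\<epsilon>0 > 0" "ball (\<phi> a) \<epsilon>0 \<subseteq> V"
    "\<And>y. y \<in> ball (\<phi> a) \<epsilon>0 \<Longrightarrow> Q y \<noteq> 0 \<Longrightarrow> card (fibre y \<inter> N0) = \<mu>"
    using isolating_count_constant[OF N0 a(2)] by blast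
  have oN0: "open N0" "a \<in> N0" using N0 by (simp_all add: isolating_def)
  have cont: "continuous (at a) \<phi>"
    using continuous_map open_dom a(1) by (simp add: continuous_on_eq_continuous_at)
  have "\<mu> \<ge> 1"
  proof -
    obtain d where d: "d > 0" "\<And>z'. dist z' a < d \<Longrightarrow> dist (\<phi> z') (\<phi> a) < \<epsilon>0"
      using cont \<epsilon>0(1) unfolding continuous_at_eps_delta by blast
    from oN0 obtain e where e: "e > 0" "ball a e \<subseteq> N0" by (rule openE)
    obtain z where z: "z \<in> U" "dist z a < min d e" "Q (\<phi> z) \<noteq> 0"
      using generic_preimages_dense[OF a(1), of "min d e"] d(1) e(1) by auto
    have y: "\<phi> z \<in> ball (\<phi> a) \<epsilon>0" using d(2)[of z] z(2) by (simp add: dist_commute)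
    have "z \<in> fibre (\<phi> z) \<inter> N0" using z e(2) by (auto simp: fibre_def dist_commute)
    moreover have "finite (fibre (\<phi> z) \<inter> N0)" using finite_fibre[of "\<phi> z"] y \<epsilon>0(2) by blast
    ultimately have "card (fibre (\<phi> z) \<inter> N0) > 0" using card_gt_0_iff by blast
    then show ?thesis using \<epsilon>0(3)[OF y z(3)] by simp
  qed
  moreover have "\<exists>\<epsilon>>0. ball (\<phi> a) \<epsilon> \<subseteq> V \<and> (\<forall>y\<in>ball (\<phi> a) \<epsilon>. Q y \<noteq> 0 \<longrightarrow> card (fibre y \<inter> N) = \<mu>)"
    if N: "isolating N a" for N
  proof -
    obtain \<epsilon>' \<nu> where \<epsilon>': "\<epsilon>' > 0" "ball (\<phi> a) \<epsilon>' \<subseteq> V"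
      "\<And>y. y \<in> ball (\<phi> a) \<epsilon>' \<Longrightarrow> Q y \<noteq> 0 \<Longrightarrow> card (fibre y \<inter> N) = \<nu>"
      using isolating_count_constant[OF N a(2)] by blast
    have oN: "open N" "a \<in> N" using N by (simp_all add: isolating_def)
    obtain \<epsilon>1 where \<epsilon>1: "\<epsilon>1 > 0" "\<forall>y\<in>ball (\<phi> a) \<epsilon>1. fibre y \<inter> closure N \<subseteq> N0"
      using isolating_fibre_subset[OF N oN0] by blast
    obtain \<epsilon>2 where \<epsilon>2: "\<epsilon>2 > 0" "\<forall>y\<in>ball (\<phi> a) \<epsilon>2. fibre y \<inter> closure N0 \<subseteq> N"
      using isolating_fibre_subset[OF N0 oN] by blast
    define \<epsilon> where "\<epsilon> = min (min \<epsilon>0 \<epsilon>') (min \<epsilon>1 \<epsilon>2)"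
    have "\<epsilon> > 0" using \<epsilon>0(1) \<epsilon>'(1) \<epsilon>1(1) \<epsilon>2(1) by (simp add: \<epsilon>_def)
    then obtain y where y: "y \<in> ball (\<phi> a) \<epsilon>" "Q y \<noteq> 0"
      using generic_near[OF a(2) open_ball, of "\<phi> a" \<epsilon>] by auto
    have yb: "y \<in> ball (\<phi> a) \<epsilon>0" "y \<in> ball (\<phi> a) \<epsilon>'" "y \<in> ball (\<phi> a) \<epsilon>1" "y \<in> ball (\<phi> a) \<epsilon>2"
      using y(1) by (auto simp: \<epsilon>_def)
    have "fibre y \<inter> N = fibre y \<inter> N0"
    proof
      show "fibre y \<inter> N \<subseteq> fibre y \<inter> N0" using \<epsilon>1(2) yb(3) closure_subset[of N] by blast
      show "fibre y \<inter> N0 \<subseteq> fibre y \<inter> N" using \<epsilon>2(2) yb(4) closure_subset[of N0] by blast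
    qed
    then have "\<nu> = \<mu>" using \<epsilon>'(3)[OF yb(2) y(2)] \<epsilon>0(3)[OF yb(1) y(2)] by simp
    then show ?thesis using \<epsilon>' by blast
  qed
  ultimately show ?thesis by blast
qed

definition multiplicity_at :: "complex ^ 'a \<Rightarrow> nat" where
  "multiplicity_at a = (SOME \<mu>. \<mu> \<ge> 1 \<and> (\<forall>N. isolating N a \<longrightarrow>
    (\<exists>\<epsilon>>0. ball (\<phi> a) \<epsilon> \<subseteq> V \<and> (\<forall>y\<in>ball (\<phi> a) \<epsilon>. Q y \<noteq> 0 \<longrightarrow> card (fibre y \<inter> N) = \<mu>))))"

lemma multiplicity_at:
  assumes a: "a \<in> U" "\<phi> a \<in> V"
  shows "multiplicity_at a \<ge> 1"
    and "isolating N a \<Longrightarrow>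
      \<exists>\<epsilon>>0. ball (\<phi> a) \<epsilon> \<subseteq> V \<and> (\<forall>y\<in>ball (\<phi> a) \<epsilon>. Q y \<noteq> 0 \<longrightarrow> card (fibre y \<inter> N) = multiplicity_at a)"
proof -
  have *: "multiplicity_at a \<ge> 1 \<and> (\<forall>N. isolating N a \<longrightarrow>
    (\<exists>\<epsilon>>0. ball (\<phi> a) \<epsilon> \<subseteq> V \<and> (\<forall>y\<in>ball (\<phi> a) \<epsilon>. Q y \<noteq> 0 \<longrightarrow> card (fibre y \<inter> N) = multiplicity_at a)))"
    unfolding multiplicity_at_def by (rule someI_ex[OF zero_of_multiplicity[OF a]])
  from * show "multiplicity_at a \<ge> 1" by (rule conjunct1)
  from conjunct2[OF *, THEN spec, of N]
  show "isolating N a \<Longrightarrow>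
      \<exists>\<epsilon>>0. ball (\<phi> a) \<epsilon> \<subseteq> V \<and> (\<forall>y\<in>ball (\<phi> a) \<epsilon>. Q y \<noteq> 0 \<longrightarrow> card (fibre y \<inter> N) = multiplicity_at a)"
    by (rule mp)
qed

lemma separated_isolating_balls:
  assumes w: "w \<in> V"
  shows "\<exists>r>0. (\<forall>a\<in>fibre w. isolating (ball a r) a) \<and>
    (\<forall>a\<in>fibre w. \<forall>b\<in>fibre w. a \<noteq> b \<longrightarrow> ball a r \<inter> ball b r = {})"
proof -
  have fin: "finite (fibre w)" using w by (rule finite_fibre)
  have "\<exists>r>0. cball a r \<subseteq> U \<and> (\<forall>b\<in>fibre w. b \<noteq> a \<longrightarrow> 2 * r < dist a b)" if "a \<in> fibre w" for a
  proof -
    have "a \<in> U" using that by (simp add: fibre_def)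
    then obtain r1 where r1: "r1 > 0" "cball a r1 \<subseteq> U" using open_dom open_contains_cball by blast
    obtain d where d: "d > 0" "\<forall>b\<in>fibre w. b \<noteq> a \<longrightarrow> d \<le> dist a b" using finite_set_avoid[OF fin] by blast
    show ?thesis
    proof (intro exI[of _ "min r1 (d / 3)"] conjI ballI impI)
      show "0 < min r1 (d / 3)" using r1 d by simp
      show "cball a (min r1 (d / 3)) \<subseteq> U" using r1(2) subset_cball[of "min r1 (d / 3)" r1 a] by (simp add: subset_trans)
      fix b assume "b \<in> fibre w" "b \<noteq> a"
      then have "d \<le> dist a b" using d(2) by blast
      moreover have "2 * min r1 (d / 3) \<le> 2 * (d / 3)" by simp
      ultimately show "2 * min r1 (d / 3) < dist a b" using d(1) by linarith
    qed
  qed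
  then have "\<forall>a\<in>fibre w. \<exists>r. r > 0 \<and> cball a r \<subseteq> U \<and> (\<forall>b\<in>fibre w. b \<noteq> a \<longrightarrow> 2 * r < dist a b)" by blast
  from bchoice[OF this] obtain r where
    r: "\<forall>a\<in>fibre w. r a > 0 \<and> cball a (r a) \<subseteq> U \<and> (\<forall>b\<in>fibre w. b \<noteq> a \<longrightarrow> 2 * r a < dist a b)"
    by (elim exE)
  define \<rho> where "\<rho> = Min (insert 1 (r ` fibre w))"
  have fin1: "finite (insert 1 (r ` fibre w))" using fin by simp
  have "0 < x" if "x \<in> insert 1 (r ` fibre w)" for x
  proof -
    from that consider "x = 1" | a where "a \<in> fibre w" "x = r a" by blast
    then show ?thesis using r by cases (simp, blast)
  qed
  from this[OF Min_in[OF fin1]] have \<rho>: "\<rho> > 0" unfolding \<rho>_def by simp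
  have le: "\<rho> \<le> r a" if "a \<in> fibre w" for a unfolding \<rho>_def by (rule Min_le[OF fin1]) (simp add: that)
  have far: "2 * \<rho> < dist a b" if "a \<in> fibre w" "b \<in> fibre w" "a \<noteq> b" for a b
  proof -
    have "2 * r a < dist a b"
      using bspec[OF bspec[OF r that(1), THEN conjunct2, THEN conjunct2] that(2)] that(3) by simp
    then show ?thesis using le[OF that(1)] by linarith
  qed
  show ?thesis
  proof (intro exI[of _ \<rho>] conjI ballI impI \<rho>)
    fix a assume a: "a \<in> fibre w"
    have cl: "closure (ball a \<rho>) = cball a \<rho>" using \<rho> by (rule closure_ball)
    have "cball a \<rho> \<subseteq> U"
      by (rule subset_trans[OF subset_cball[OF le[OF a]] bspec[OF r a, THEN conjunct2, THEN conjunct1]])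
    moreover have "fibre (\<phi> a) \<inter> cball a \<rho> = {a}"
    proof -
      have "\<phi> a = w" using a by (simp add: fibre_def)
      moreover have near: "b = a" if "b \<in> fibre w" "dist a b \<le> \<rho>" for b
      proof (rule ccontr)
        assume "b \<noteq> a"
        then have "2 * \<rho> < dist a b" using far[OF a that(1)] by blast
        then show False using that(2) \<rho> by linarith
      qed
      moreover have "fibre w \<inter> cball a \<rho> = {a}"
      proof (intro equalityI subsetI)
        fix b assume "b \<in> fibre w \<inter> cball a \<rho>"
        then have "b = a" by (intro near) simp_all
        then show "b \<in> {a}" by simp
      next
        fix b assume "b \<in> {a}"
        then show "b \<in> fibre w \<inter> cball a \<rho>" using a \<rho> by simp
      qed
      ultimately show ?thesis by (simp only:)
    qed
    ultimately show "isolating (ball a \<rho>) a" using \<rho> by (simp add: isolating_def cl)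
  next
    fix a b assume ab: "a \<in> fibre w" "b \<in> fibre w" "a \<noteq> b"
    show "ball a \<rho> \<inter> ball b \<rho> = {}"
    proof (rule equals0I)
      fix x assume "x \<in> ball a \<rho> \<inter> ball b \<rho>"
      then have "dist a x < \<rho>" "dist b x < \<rho>" by auto
      then show False using far[OF ab] dist_triangle2[of a b x] by linarith
    qed
  qed
qed

theorem multiplicities_sum_to_degree:
  assumes w: "w \<in> V" and y0: "y0 \<in> V" "Q y0 \<noteq> 0"
  shows "(\<Sum>a\<in>fibre w. multiplicity_at a) = card (fibre y0)"
proof -
  obtain r where r: "r > 0" "\<forall>a\<in>fibre w. isolating (ball a r) a"
    "\<forall>a\<in>fibre w. \<forall>b\<in>fibre w. a \<noteq> b \<longrightarrow> ball a r \<inter> ball b r = {}"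
    using separated_isolating_balls[OF w] by blast
  have fin: "finite (fibre w)" using w by (rule finite_fibre)
  have "\<forall>a\<in>fibre w. \<exists>\<epsilon>>0. \<forall>y\<in>ball w \<epsilon>. Q y \<noteq> 0 \<longrightarrow> card (fibre y \<inter> ball a r) = multiplicity_at a"
  proof
    fix a assume a: "a \<in> fibre w"
    then have aU: "a \<in> U" "\<phi> a = w" by (simp_all add: fibre_def)
    show "\<exists>\<epsilon>>0. \<forall>y\<in>ball w \<epsilon>. Q y \<noteq> 0 \<longrightarrow> card (fibre y \<inter> ball a r) = multiplicity_at a"
      using multiplicity_at(2)[OF aU(1) _ bspec[OF r(2) a]] w unfolding aU(2) by blast
  qed
  from bchoice[OF this] obtain \<epsilon> where
    \<epsilon>: "\<forall>a\<in>fibre w. \<epsilon> a > 0 \<and> (\<forall>y\<in>ball w (\<epsilon> a). Q y \<noteq> 0 \<longrightarrow> card (fibre y \<inter> ball a r) = multiplicity_at a)"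
    by (elim exE)
  define W where "W = (\<Union>a\<in>fibre w. ball a r)"
  have "open W" by (auto simp: W_def)
  moreover have "fibre w \<subseteq> W" using r(1) by (auto simp: W_def)
  ultimately have "\<exists>\<epsilon>>0. ball w \<epsilon> \<subseteq> V \<and> (\<forall>y\<in>ball w \<epsilon>. fibre y \<subseteq> W)"
    by (rule nearby_fibres_in_neighbourhood[OF w])
  then obtain \<eta> where \<eta>: "\<eta> > 0" "\<forall>y\<in>ball w \<eta>. fibre y \<subseteq> W" by blast
  define B where "B = ball w \<eta> \<inter> (\<Inter>a\<in>fibre w. ball w (\<epsilon> a))"
  have "open B" unfolding B_def using fin by (intro open_Int open_INT) auto
  moreover have "w \<in> B" using \<epsilon> \<eta>(1) by (simp add: B_def)
  ultimately obtain y where y: "y \<in> B" "y \<in> V" "Q y \<noteq> 0" using generic_near[OF w] by blast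
  have "fibre y = (\<Union>a\<in>fibre w. fibre y \<inter> ball a r)"
    using \<eta>(2) y(1) unfolding B_def W_def by blast
  then have "card (fibre y) = card (\<Union>a\<in>fibre w. fibre y \<inter> ball a r)" by (rule arg_cong)
  also have "\<dots> = (\<Sum>a\<in>fibre w. card (fibre y \<inter> ball a r))"
  proof (rule card_UN_disjoint[OF fin])
    show "\<forall>a\<in>fibre w. finite (fibre y \<inter> ball a r)" using finite_fibre[OF y(2)] by blast
    show "\<forall>a\<in>fibre w. \<forall>b\<in>fibre w. a \<noteq> b \<longrightarrow> fibre y \<inter> ball a r \<inter> (fibre y \<inter> ball b r) = {}"
      using r(3) by blast
  qed
  also have "\<dots> = (\<Sum>a\<in>fibre w. multiplicity_at a)"
  proof (rule sum.cong[OF refl])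
    fix a assume a: "a \<in> fibre w"
    then have "y \<in> ball w (\<epsilon> a)" using y(1) unfolding B_def by blast
    then show "card (fibre y \<inter> ball a r) = multiplicity_at a" using \<epsilon> a y(3) by blast
  qed
  finally show ?thesis using card_generic_fibre_constant[OF y(2,3) y0] by simp
qed

theorem multiplicity_one_imp_regular:
  assumes a: "a \<in> U" "\<phi> a \<in> V" and one: "multiplicity_at a = 1"
  shows "det (\<phi>' a) \<noteq> 0"
proof
  assume det: "det (\<phi>' a) = 0"
  have fa: "a \<in> fibre (\<phi> a)" using a by (simp add: fibre_def)
  obtain r where r: "r > 0" "\<forall>b\<in>fibre (\<phi> a). isolating (ball b r) b"
    using separated_isolating_balls[OF a(2)] by blast
  have iso: "isolating (ball a r) a" using r(2) fa by (rule bspec)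
  obtain \<epsilon> where \<epsilon>: "\<epsilon> > 0" "ball (\<phi> a) \<epsilon> \<subseteq> V"
    "\<And>y. y \<in> ball (\<phi> a) \<epsilon> \<Longrightarrow> Q y \<noteq> 0 \<Longrightarrow> card (fibre y \<inter> ball a r) = 1"
    using multiplicity_at(2)[OF a iso] one by auto
  obtain v where v: "v \<notin> range ((*v) (\<phi>' a))" "Q (\<phi> a + v) \<noteq> 0"
  proof -
    have lin: "linear ((*v) (\<phi>' a))" by (rule bounded_linear.linear[OF bounded_linear_matrix_mult])
    have "\<not> surj ((*v) (\<phi>' a))"
    proof
      assume "surj ((*v) (\<phi>' a))"
      then have "inj ((*v) (\<phi>' a))" by (intro linear_surjective_imp_injective[OF lin]) simp_all
      then show False using det det_nonzero_iff_inj[of "\<phi>' a"] inj_matrix_mult_iff[of "\<phi>' a"] by simp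
    qed
    then obtain u where u: "u \<notin> range ((*v) (\<phi>' a))" by blast
    have "closed (range ((*v) (\<phi>' a)))"
      using linear_subspace_image[OF lin subspace_UNIV] by (rule closed_subspace)
    then have "open (- range ((*v) (\<phi>' a)))" by (simp add: open_Compl)
    moreover have "u \<in> - range ((*v) (\<phi>' a))" using u by blast
    ultimately obtain e where e: "e > 0" "ball u e \<subseteq> - range ((*v) (\<phi>' a))" by (rule openE)
    from Q_nonzero obtain w1 where "Q w1 \<noteq> 0" by blast
    from polyfn_nonzero_dense[OF Q_poly this e(1), of "\<phi> a + u"]
    obtain y where y: "dist y (\<phi> a + u) < e" "Q y \<noteq> 0" by blast
    have "dist u (y - \<phi> a) < e" using y(1) by (simp add: dist_norm norm_minus_commute algebra_simps)
    then have "y - \<phi> a \<notin> range ((*v) (\<phi>' a))" using e(2) by auto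
    then show ?thesis using that[of "y - \<phi> a"] y(2) by simp
  qed
  obtain q where q: "\<And>s. Q (\<phi> a + s *s v) = poly q s" using polyfn_on_line[OF Q_poly] by blast
  have "poly q 1 \<noteq> 0" using v(2) by (simp flip: q)
  then have "q \<noteq> 0" by auto
  then obtain \<delta>1 where \<delta>1: "\<delta>1 > 0" "\<And>s. s \<noteq> 0 \<Longrightarrow> norm s < \<delta>1 \<Longrightarrow> poly q s \<noteq> 0"
    using poly_nonzero_near_0 by blast
  define \<delta> where "\<delta> = min \<delta>1 (\<epsilon> / (norm v + 1))"
  have c: "norm v + 1 > 0" by (simp add: add_nonneg_pos)
  have \<delta>: "\<delta> > 0" using \<delta>1(1) \<epsilon>(1) c by (simp add: \<delta>_def)
  have L: "\<phi> a + s *s v \<in> ball (\<phi> a) \<epsilon>" if "norm s < \<delta>" for s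
  proof -
    have "norm s * norm v \<le> norm s * (norm v + 1)" by (intro mult_left_mono) auto
    also have "\<dots> < \<epsilon> / (norm v + 1) * (norm v + 1)"
      using that c by (intro mult_strict_right_mono) (auto simp: \<delta>_def)
    also have "\<dots> = \<epsilon>" using c by simp
    finally show ?thesis using dist_line[of "\<phi> a" s v] by (simp add: dist_commute)
  qed
  have LQ: "Q (\<phi> a + s *s v) \<noteq> 0" if "norm s < \<delta>" "s \<noteq> 0" for s
    using \<delta>1(2)[of s] that by (simp add: q \<delta>_def)
  have fibre_a: "fibre (\<phi> a) \<inter> ball a r = {a}"
  proof
    show "fibre (\<phi> a) \<inter> ball a r \<subseteq> {a}"
      using iso closure_subset[of "ball a r"] unfolding isolating_def by blast
    show "{a} \<subseteq> fibre (\<phi> a) \<inter> ball a r" using r(1) fa by simp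
  qed
  have ex: "\<exists>z. fibre (\<phi> a + s *s v) \<inter> ball a r = {z}" if "norm s < \<delta>" for s
  proof (cases "s = 0")
    case True
    show ?thesis using fibre_a True by simp
  next
    case False
    from \<epsilon>(3)[OF L[OF that] LQ[OF that False]] show ?thesis by (simp add: card_1_singleton_iff)
  qed
  define G where "G s = (if s = 0 then a else (THE z. z \<in> fibre (\<phi> a + s *s v) \<inter> ball a r))" for s
  have G: "fibre (\<phi> a + s *s v) \<inter> ball a r = {G s}" if s: "norm s < \<delta>" for s
  proof (cases "s = 0")
    case True
    show ?thesis using fibre_a True by (simp add: G_def)
  next
    case False
    from ex[OF s] obtain z where z: "fibre (\<phi> a + s *s v) \<inter> ball a r = {z}" by (elim exE)
    then show ?thesis using False by (simp add: G_def)
  qed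
  have G0: "G 0 = a" by (simp add: G_def)
  have Gcont0: "isCont G 0"
    unfolding continuous_at_eps_delta
  proof (intro allI impI)
    fix e :: real assume e: "e > 0"
    obtain \<epsilon>' where \<epsilon>': "\<epsilon>' > 0" "\<forall>y\<in>ball (\<phi> a) \<epsilon>'. fibre y \<inter> closure (ball a r) \<subseteq> ball a e"
      using isolating_fibre_subset[OF iso open_ball, of a e] centre_in_ball[of a e] e by blast
    define d where "d = min \<delta> (\<epsilon>' / (norm v + 1))"
    have "d > 0" using \<delta> \<epsilon>'(1) c by (simp add: d_def)
    moreover have "dist (G s) (G 0) < e" if s: "dist s 0 < d" for s
    proof -
      have s': "norm s < \<delta>" using s by (simp add: d_def)
      have "norm s * norm v \<le> norm s * (norm v + 1)" by (intro mult_left_mono) auto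
      also have "\<dots> < \<epsilon>' / (norm v + 1) * (norm v + 1)"
        using s c by (intro mult_strict_right_mono) (auto simp: d_def)
      also have "\<dots> = \<epsilon>'" using c by simp
      finally have "\<phi> a + s *s v \<in> ball (\<phi> a) \<epsilon>'" using dist_line[of "\<phi> a" s v] by (simp add: dist_commute)
      then have "fibre (\<phi> a + s *s v) \<inter> closure (ball a r) \<subseteq> ball a e" using \<epsilon>'(2) by blast
      moreover have "G s \<in> fibre (\<phi> a + s *s v) \<inter> ball a r" using G[OF s'] by blast
      ultimately have "G s \<in> ball a e" using closure_subset[of "ball a r"] by blast
      then show ?thesis by (simp add: G0 dist_commute)
    qed
    ultimately show "\<exists>d>0. \<forall>s. dist s 0 < d \<longrightarrow> dist (G s) (G 0) < e" by blast
  qed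
  have Gderiv: "\<exists>D. \<forall>i. ((\<lambda>s. G s $ i) has_field_derivative D $ i) (at s0)"
    if s0: "norm s0 < \<delta>" "s0 \<noteq> 0" for s0
  proof -
    define w0 where "w0 = \<phi> a + s0 *s v"
    have w0: "w0 \<in> V" "Q w0 \<noteq> 0" using L[OF s0(1)] LQ[OF s0] \<epsilon>(2) by (auto simp: w0_def)
    from generic_sheets(2)[OF w0] obtain B g where B: "open B" "w0 \<in> B"
      "\<forall>z\<in>fibre w0. g z w0 = z \<and> (\<forall>y\<in>B. \<exists>A. (g z has_derivative (*v) A) (at y))"
      "\<forall>y\<in>B. inj_on (\<lambda>z. g z y) (fibre w0) \<and> fibre y = (\<lambda>z. g z y) ` fibre w0 \<and>
         (\<forall>z\<in>fibre y. det (\<phi>' z) \<noteq> 0)" by (elim exE conjE)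
    define z0 where "z0 = G s0"
    have "z0 \<in> fibre w0 \<inter> ball a r" unfolding w0_def G[OF s0(1)] z0_def by simp
    then have z0: "z0 \<in> fibre w0" "z0 \<in> ball a r" by simp_all
    have gz0: "g z0 w0 = z0" using bspec[OF B(3) z0(1)] by (rule conjunct1)
    have "\<exists>A. (g z0 has_derivative (*v) A) (at w0)"
      by (rule bspec[OF conjunct2[OF bspec[OF B(3) z0(1)]] B(2)])
    then obtain A where A: "(g z0 has_derivative (*v) A) (at w0)" by (elim exE)
    have "isCont (\<lambda>s. \<phi> a + s *s v) s0"
      using continuous_line[of UNIV "\<phi> a" v] by (simp add: continuous_on_eq_continuous_at)
    moreover have "isCont (g z0) (\<phi> a + s0 *s v)"
      using A unfolding w0_def by (rule has_derivative_continuous)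
    ultimately have "isCont (\<lambda>s. g z0 (\<phi> a + s *s v)) s0" by (rule isCont_o2)
    then have lim: "((\<lambda>s. g z0 (\<phi> a + s *s v)) \<longlongrightarrow> g z0 (\<phi> a + s0 *s v)) (nhds s0)"
      unfolding isCont_def by (rule iffD1[OF tendsto_at_iff_tendsto_nhds[of "\<lambda>s. g z0 (\<phi> a + s *s v)" s0]])
    have "g z0 (\<phi> a + s0 *s v) \<in> ball a r" using gz0 z0(2) by (simp add: w0_def)
    then have ev1: "\<forall>\<^sub>F s in nhds s0. g z0 (\<phi> a + s *s v) \<in> ball a r"
      by (rule topological_tendstoD[OF lim open_ball])
    have "open ((\<lambda>s. \<phi> a + s *s v) -` B)"
      using continuous_open_preimage[OF continuous_line open_UNIV B(1)] by simp
    then have ev2: "\<forall>\<^sub>F s in nhds s0. \<phi> a + s *s v \<in> B"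
      using B(2) eventually_nhds_in_open[of "(\<lambda>s. \<phi> a + s *s v) -` B" s0] by (simp add: w0_def)
    have ev3: "\<forall>\<^sub>F s in nhds s0. s \<in> ball 0 \<delta>"
      using s0(1) by (intro eventually_nhds_in_open) auto
    have ev: "\<forall>\<^sub>F s in nhds s0. G s = g z0 (\<phi> a + s *s v)"
      using ev1 ev2 ev3
    proof eventually_elim
      case (elim s)
      have "fibre (\<phi> a + s *s v) = (\<lambda>z. g z (\<phi> a + s *s v)) ` fibre w0"
        using bspec[OF B(4) elim(2)] by (elim conjE)
      then have "g z0 (\<phi> a + s *s v) \<in> fibre (\<phi> a + s *s v)" using z0(1) by simp
      then have "g z0 (\<phi> a + s *s v) \<in> fibre (\<phi> a + s *s v) \<inter> ball a r" using elim(1) by blast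
      moreover have "fibre (\<phi> a + s *s v) \<inter> ball a r = {G s}" using elim(3) by (intro G) simp
      ultimately have "g z0 (\<phi> a + s *s v) \<in> {G s}" by (simp only:)
      then show ?case by simp
    qed
    have "((\<lambda>s. G s $ i) has_field_derivative (A *v v) $ i) (at s0)" for i
    proof -
      have e: "\<forall>\<^sub>F s in nhds s0. G s $ i = g z0 (\<phi> a + s *s v) $ i"
        using ev by (rule eventually_mono) simp
      have "((\<lambda>s. g z0 (\<phi> a + s *s v) $ i) has_field_derivative (A *v v) $ i) (at s0)"
        using A unfolding w0_def by (rule has_field_derivative_along_line)
      then show ?thesis by (rule iffD2[OF DERIV_cong_ev[OF refl e refl]])
    qed
    then show ?thesis by blast
  qed
  have hol: "(\<lambda>s. G s $ i) holomorphic_on ball 0 \<delta>" for i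
  proof (rule no_isolated_singularity[where K = "{0}"])
    have d: "(\<lambda>s. G s $ i) field_differentiable (at s)" if "s \<in> ball 0 \<delta> - {0}" for s
    proof -
      have "norm s < \<delta>" "s \<noteq> 0" using that by auto
      from Gderiv[OF this] obtain D where "\<forall>i. ((\<lambda>s. G s $ i) has_field_derivative D $ i) (at s)" by (elim exE)
      then have "((\<lambda>s. G s $ i) has_field_derivative D $ i) (at s)" by (rule spec)
      then show ?thesis unfolding field_differentiable_def by (rule exI)
    qed
    show "(\<lambda>s. G s $ i) holomorphic_on ball 0 \<delta> - {0}"
      unfolding holomorphic_on_def by (rule ballI, rule field_differentiable_at_within, rule d)
    have "isCont (\<lambda>s. G s $ i) s" if "s \<in> ball 0 \<delta>" for s
    proof (cases "s = 0")
      case True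
      then show ?thesis using Gcont0 isCont_vec_nth by simp
    next
      case False
      then have "s \<in> ball 0 \<delta> - {0}" using that by simp
      then show ?thesis by (rule field_differentiable_imp_continuous_at[OF d])
    qed
    then show "continuous_on (ball 0 \<delta>) (\<lambda>s. G s $ i)" by (intro continuous_at_imp_continuous_on ballI)
  qed auto
  have "\<forall>i. \<exists>d. ((\<lambda>s. G s $ i) has_field_derivative d) (at 0)"
    using holomorphic_on_imp_differentiable_at[OF hol open_ball, of 0] \<delta>
    unfolding field_differentiable_def by simp
  from choice[OF this] obtain d where d: "\<forall>i. ((\<lambda>s. G s $ i) has_field_derivative d i) (at 0)" by (elim exE)
  have Gd: "(G has_derivative (\<lambda>s. \<chi> i. d i * s)) (at 0)"
  proof -
    have "((\<lambda>s. G s $ i) has_derivative (\<lambda>s. (\<chi> i. d i * s) $ i)) (at 0)" for i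
      using d unfolding has_field_derivative_def by simp
    then show ?thesis by (rule has_derivative_vecI)
  qed
  have "(\<phi> has_derivative (*v) (\<phi>' a)) (at (G 0))" unfolding G0 using a(1) by (rule deriv)
  from has_derivative_compose[OF Gd this]
  have comp: "((\<lambda>s. \<phi> (G s)) has_derivative (\<lambda>s. \<phi>' a *v (\<chi> i. d i * s))) (at 0)" .
  have "\<phi> (G s) = \<phi> a + s *s v" if "s \<in> ball 0 \<delta>" for s
  proof -
    have "norm s < \<delta>" using that by simp
    then have "G s \<in> fibre (\<phi> a + s *s v)" using G[of s] by blast
    then show ?thesis by (simp add: fibre_def)
  qed
  then have "((\<lambda>s. \<phi> a + s *s v) has_derivative (\<lambda>s. \<phi>' a *v (\<chi> i. d i * s))) (at 0)"
    by (intro has_derivative_transform_within_open[OF comp open_ball, of 0 \<delta>]) (use \<delta> in auto)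
  moreover have "((\<lambda>s. \<phi> a + s *s v) has_derivative (\<lambda>s. s *s v)) (at 0)"
    by (rule has_derivative_line)
  ultimately have "(\<lambda>s. \<phi>' a *v (\<chi> i. d i * s)) = (\<lambda>s. s *s v)" by (rule has_derivative_unique)
  from fun_cong[OF this, of 1] have "\<phi>' a *v (\<chi> i. d i) = v" by simp
  then show False using v(1) by auto
qed

end

section \<open>S7\<close>

lemma jacobian_det_eq_det:
  assumes "(f has_derivative (*v) A) (at z)"
  shows "jacobian_det f z = det A"
proof -
  have "frechet_derivative f (at z) = (*v) A" using frechet_derivative_at[OF assms] by (rule sym)
  then show ?thesis unfolding jacobian_det_def jacobian_def by simp
qed

lemma isolated_in_ball:
  assumes "a \<in> S" "r > 0" "\<And>b. b \<in> S \<Longrightarrow> b \<noteq> a \<Longrightarrow> b \<notin> ball a r"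
  shows "a isolated_in S"
proof -
  have "ball a r \<inter> S = {a}"
  proof
    show "ball a r \<inter> S \<subseteq> {a}" using assms(3) by blast
    show "{a} \<subseteq> ball a r \<inter> S" using assms(1,2) by simp
  qed
  then show ?thesis using assms(1) unfolding isolated_in_def by (intro conjI exI[of _ "ball a r"]) auto
qed

context proper_map_off_hypersurface
begin

lemma holomorphic_map: "holomorphic_map_on \<phi> U"
  unfolding holomorphic_map_on_def using deriv by blast

lemma jacobian_det_translate: "z \<in> U \<Longrightarrow> jacobian_det (\<lambda>z. \<phi> z - w) z = det (\<phi>' z)"
  using has_derivative_diff[OF deriv has_derivative_const] by (intro jacobian_det_eq_det) simp

lemma jacobian_det_map: "z \<in> U \<Longrightarrow> jacobian_det \<phi> z = det (\<phi>' z)"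
  using jacobian_det_translate[of z 0] by simp

lemma critical_values_iff:
  "w \<in> critical_values \<phi> U \<longleftrightarrow> (\<exists>z\<in>fibre w. det (\<phi>' z) = 0)"
  unfolding critical_values_def fibre_def using jacobian_det_map by auto

theorem has_multiplicity_generic:
  assumes "V = UNIV" "Q y0 \<noteq> 0"
  shows "has_multiplicity \<phi> U UNIV (card (fibre y0))"
  unfolding has_multiplicity_def fibre_def[symmetric]
proof (intro conjI ballI)
  fix w assume w: "w \<in> critical_values \<phi> U"
  have V: "w \<in> V" "y0 \<in> V" using assms by simp_all
  show fin: "finite (fibre w)" using V(1) by (rule finite_fibre)
  have ge: "multiplicity_at a \<ge> 1" if "a \<in> fibre w" for a
    using that V by (intro multiplicity_at(1)) (simp_all add: fibre_def)
  obtain a where a: "a \<in> fibre w" "det (\<phi>' a) = 0" using w unfolding critical_values_iff by blast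
  have "multiplicity_at a \<noteq> 1"
    using multiplicity_one_imp_regular[of a] a V by (auto simp: fibre_def)
  then have "1 < multiplicity_at a" using ge[OF a(1)] by simp
  then have "(\<Sum>a\<in>fibre w. 1) < (\<Sum>a\<in>fibre w. multiplicity_at a)"
    using fin ge a(1) by (intro sum_strict_mono_ex1) auto
  then show "card (fibre w) < card (fibre y0)"
    using multiplicities_sum_to_degree[OF V assms(2)] by simp
next
  fix w assume "w \<in> UNIV - critical_values \<phi> U"
  then have w: "\<forall>z\<in>fibre w. det (\<phi>' z) \<noteq> 0" by (simp add: critical_values_iff)
  have V: "w \<in> V" "y0 \<in> V" using assms by simp_all
  show "finite (fibre w)" using V(1) by (rule finite_fibre)
  show "card (fibre w) = card (fibre y0)" using V(1) w V(2) assms(2) by (rule card_regular_fibre)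
qed

lemma has_zero_multiplicity_at:
  assumes V: "V = UNIV" and a: "a \<in> U" "\<phi> a = 0"
  shows "has_zero_multiplicity \<phi> U a (multiplicity_at a)"
  unfolding has_zero_multiplicity_def
proof (intro conjI allI impI open_dom holomorphic_map)
  have z: "zeros_on \<phi> S = fibre 0 \<inter> S" if "S \<subseteq> U" for S
    using that by (auto simp: zeros_on_def fibre_def)
  have fa: "a \<in> fibre 0" using a by (simp add: fibre_def)
  have zV: "0 \<in> V" using V by simp
  obtain r where r: "r > 0"
    "\<forall>a\<in>fibre 0. \<forall>b\<in>fibre 0. a \<noteq> b \<longrightarrow> ball a r \<inter> ball b r = {}"
    using separated_isolating_balls[OF zV] by blast
  show "a isolated_in zeros_on \<phi> U"
  proof (rule isolated_in_ball[OF _ r(1)])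
    show "a \<in> zeros_on \<phi> U" using a by (simp add: zeros_on_def)
    fix b assume "b \<in> zeros_on \<phi> U" "b \<noteq> a"
    then have "ball a r \<inter> ball b r = {}" using r(2) fa by (simp add: z)
    moreover have "b \<in> ball b r" using r(1) by simp
    ultimately show "b \<notin> ball a r" by blast
  qed
  fix N assume N: "open N \<and> a \<in> N \<and> compact (closure N) \<and> closure N \<subseteq> U \<and> zeros_on \<phi> (closure N) = {a}"
  moreover from this z[of "closure N"] have "fibre 0 \<inter> closure N = {a}" by simp
  ultimately have "isolating N a" unfolding isolating_def a(2) by blast
  from multiplicity_at(2)[OF a(1) _ this] V obtain \<epsilon> where \<epsilon>: "\<epsilon> > 0"
    "\<And>y. y \<in> ball 0 \<epsilon> \<Longrightarrow> Q y \<noteq> 0 \<Longrightarrow> card (fibre y \<inter> N) = multiplicity_at a"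
    unfolding a(2) by auto
  have NU: "N \<subseteq> U" using N closure_subset by blast
  obtain w1 where "Q w1 \<noteq> 0" using Q_nonzero by blast
  then have "{w. Q w = 0} \<in> null_sets lebesgue"
    using negligible_polyfn_zeros[OF Q_poly] by (simp add: negligible_iff_null_sets)
  then have AE: "AE w in lebesgue. Q w \<noteq> 0" by (rule AE_I') auto
  have zw: "zeros_on (\<lambda>z. \<phi> z - w) N = fibre w \<inter> N" for w
    using NU by (auto simp: zeros_on_def fibre_def)
  have "AE w in lebesgue. w \<in> ball 0 \<epsilon> \<longrightarrow>
      (\<forall>z\<in>zeros_on (\<lambda>z. \<phi> z - w) N. jacobian_det (\<lambda>z. \<phi> z - w) z \<noteq> 0) \<and>
      finite (zeros_on (\<lambda>z. \<phi> z - w) N) \<and> card (zeros_on (\<lambda>z. \<phi> z - w) N) = multiplicity_at a"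
  proof (rule AE_mp[OF AE], rule AE_I2, intro impI conjI ballI)
    fix w z assume w: "Q w \<noteq> 0" "z \<in> zeros_on (\<lambda>z. \<phi> z - w) N"
    then have "z \<in> fibre w" by (simp add: zw)
    moreover from this have "z \<in> U" by (simp add: fibre_def)
    ultimately show "jacobian_det (\<lambda>z. \<phi> z - w) z \<noteq> 0"
      using regular[OF w(1)] jacobian_det_translate by simp
  next
    fix w assume w: "Q w \<noteq> 0" "w \<in> ball 0 \<epsilon>"
    have "w \<in> V" using V by simp
    then show "finite (zeros_on (\<lambda>z. \<phi> z - w) N)" unfolding zw using finite_fibre by blast
    show "card (zeros_on (\<lambda>z. \<phi> z - w) N) = multiplicity_at a" unfolding zw using \<epsilon>(2) w by blast
  qed
  then show "\<exists>\<epsilon>>0. AE w in lebesgue. w \<in> ball 0 \<epsilon> \<longrightarrow>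
      (\<forall>z\<in>zeros_on (\<lambda>z. \<phi> z - w) N. jacobian_det (\<lambda>z. \<phi> z - w) z \<noteq> 0) \<and>
      finite (zeros_on (\<lambda>z. \<phi> z - w) N) \<and> card (zeros_on (\<lambda>z. \<phi> z - w) N) = multiplicity_at a"
    using \<epsilon>(1) by blast
qed

theorem has_solution_count_zero:
  assumes "V = UNIV" "Q y0 \<noteq> 0"
  shows "has_solution_count \<phi> U 0 (card (fibre y0))"
proof -
  have V: "0 \<in> V" "y0 \<in> V" using assms by simp_all
  have z: "zeros_on \<phi> U = fibre 0" by (simp add: zeros_on_def fibre_def)
  have "\<forall>a\<in>fibre 0. has_zero_multiplicity \<phi> U a (multiplicity_at a)"
    using has_zero_multiplicity_at[OF assms(1)] by (simp add: fibre_def)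
  then show ?thesis
    unfolding has_solution_count_def diff_0_right z
    using finite_fibre[OF V(1)] multiplicities_sum_to_degree[OF V assms(2)]
    by (intro conjI exI[of _ multiplicity_at]) simp_all
qed

end

section \<open>S8\<close>

lemma mod_idx_add: "mod_idx (i + j) = (mod_idx i + mod_idx j :: 'k::finite mod_ring)"
  unfolding mod_idx_def by transfer (simp add: mod_simps)

lemma mod_idx_eq_iff: "(mod_idx i :: 'k::finite mod_ring) = mod_idx j \<longleftrightarrow> i mod CARD('k) = j mod CARD('k)"
  unfolding mod_idx_def by transfer (simp flip: of_nat_mod)

lemma bij_mod_idx: "bij_betw (mod_idx :: nat \<Rightarrow> 'k::finite mod_ring) {..<CARD('k)} UNIV"
proof -
  have inj: "inj_on (mod_idx :: nat \<Rightarrow> 'k mod_ring) {..<CARD('k)}"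
    by (rule inj_onI) (simp add: mod_idx_eq_iff)
  have "card ((mod_idx :: nat \<Rightarrow> 'k mod_ring) ` {..<CARD('k)}) = card (UNIV :: 'k mod_ring set)"
    using card_image[OF inj] by simp
  then have "(mod_idx :: nat \<Rightarrow> 'k mod_ring) ` {..<CARD('k)} = UNIV"
    by (intro card_subset_eq) auto
  then show ?thesis using inj by (simp add: bij_betw_def)
qed

lemma mod_idx_add_multiple: "mod_idx (i + CARD('k) * j) = (mod_idx i :: 'k::finite mod_ring)"
  by (simp add: mod_idx_eq_iff)

definition dlog :: "nat \<Rightarrow> nat \<Rightarrow> nat \<Rightarrow> 'k::finite mod_ring" where
  "dlog p g b = mod_idx (SOME e. b = g ^ e mod p)"

definition lift_cosets :: "nat \<Rightarrow> nat \<Rightarrow> complex \<Rightarrow> complex ^ ('k::finite mod_ring) \<Rightarrow> nat \<Rightarrow> complex" where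
  "lift_cosets p g x0 x b = (if b = 0 then x0 else x $ dlog p g b)"

definition fourier :: "nat \<Rightarrow> complex \<Rightarrow> (nat \<Rightarrow> complex) \<Rightarrow> nat \<Rightarrow> complex" where
  "fourier p z f t = (\<Sum>b<p. f b * z ^ (b * t))"

definition correlation :: "nat \<Rightarrow> (nat \<Rightarrow> complex) \<Rightarrow> (nat \<Rightarrow> complex) \<Rightarrow> nat \<Rightarrow> complex" where
  "correlation p f h d = (\<Sum>b<p. f ((b + d) mod p) * h b)"

lemma bij_add_mod: "bij_betw (\<lambda>d. (b + d) mod p) {..<p} {..<p :: nat}"
proof (cases "p = 0")
  case False
  have inj: "inj_on (\<lambda>d. (b + d) mod p) {..<p}"
  proof (rule inj_onI)
    fix x y assume "x \<in> {..<p}" "y \<in> {..<p}" "(b + x) mod p = (b + y) mod p"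
    then have "[b + x = b + y] (mod p)" by (simp add: cong_def)
    then have "[x = y] (mod p)" by (simp add: cong_add_lcancel_nat)
    then show "x = y" using \<open>x \<in> {..<p}\<close> \<open>y \<in> {..<p}\<close> by (simp add: cong_def)
  qed
  have "(\<lambda>d. (b + d) mod p) ` {..<p} \<subseteq> {..<p}" using False by auto
  then show ?thesis using inj endo_inj_surj[of "{..<p}" "\<lambda>d. (b + d) mod p"] by (simp add: bij_betw_def)
qed simp

lemma power_mod_exponent:
  fixes z :: complex
  assumes "z ^ p = 1"
  shows "z ^ (n mod p) = z ^ n"
proof -
  have "z ^ n = z ^ (p * (n div p) + n mod p)" by simp
  then show ?thesis unfolding power_add power_mult using assms by simp
qed

lemma root_power:
  fixes z :: complex
  assumes "z ^ p = 1"
  shows "(z ^ t) ^ p = 1"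
proof -
  have "(z ^ t) ^ p = (z ^ p) ^ t" by (simp add: power_mult[symmetric] mult.commute)
  then show ?thesis using assms by simp
qed

lemma fourier_correlation:
  assumes z: "z ^ p = 1" "z * z' = 1"
  shows "fourier p z (correlation p f h) t = fourier p z f t * fourier p z' h t"
proof -
  have inner: "(\<Sum>d<p. f ((b + d) mod p) * z ^ (d * t)) = fourier p z f t * z' ^ (b * t)" for b
  proof -
    have shift: "z ^ (d * t) = z ^ ((b + d) mod p * t) * z' ^ (b * t)" for d
    proof -
      have "z ^ ((b + d) mod p * t) = (z ^ t) ^ ((b + d) mod p)"
        by (simp add: power_mult[symmetric] mult.commute)
      also have "\<dots> = (z ^ t) ^ (b + d)" by (rule power_mod_exponent[OF root_power[OF z(1)]])
      also have "\<dots> = z ^ (b * t) * z ^ (d * t)"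
        by (simp add: power_add power_mult[symmetric] mult.commute)
      finally have "z ^ ((b + d) mod p * t) * z' ^ (b * t) = z ^ (d * t) * (z * z') ^ (b * t)"
        by (simp add: power_mult_distrib mult_ac)
      then show ?thesis using z(2) by simp
    qed
    have "(\<Sum>d<p. f ((b + d) mod p) * z ^ (d * t))
      = (\<Sum>d<p. f ((b + d) mod p) * z ^ ((b + d) mod p * t)) * z' ^ (b * t)"
      unfolding sum_distrib_right by (rule sum.cong[OF refl]) (subst shift, simp only: mult.assoc)
    also have "(\<Sum>d<p. f ((b + d) mod p) * z ^ ((b + d) mod p * t)) = fourier p z f t"
      unfolding fourier_def using sum.reindex_bij_betw[OF bij_add_mod[of b p], of "\<lambda>c. f c * z ^ (c * t)"] .
    finally show ?thesis .
  qed
  have "fourier p z (correlation p f h) t = (\<Sum>d<p. \<Sum>b<p. h b * (f ((b + d) mod p) * z ^ (d * t)))"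
    unfolding fourier_def correlation_def by (simp add: sum_distrib_right sum_distrib_left mult_ac)
  also have "\<dots> = (\<Sum>b<p. \<Sum>d<p. h b * (f ((b + d) mod p) * z ^ (d * t)))" by (rule sum.swap)
  also have "\<dots> = (\<Sum>b<p. h b * (fourier p z f t * z' ^ (b * t)))"
    by (simp only: sum_distrib_left[symmetric] inner)
  also have "\<dots> = fourier p z f t * fourier p z' h t"
    by (simp add: fourier_def[of p z'] sum_distrib_left mult_ac)
  finally show ?thesis .
qed

lemma sum_root_powers:
  assumes p: "prime p" and z: "z ^ p = 1" "z \<noteq> (1::complex)" and t: "t \<in> {1..<p}"
  shows "(\<Sum>d<p. z ^ (d * t)) = 0"
proof -
  have "z ^ t \<noteq> z ^ 0" using root_of_unity_powers_distinct[OF p z, of t 0] t by auto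
  then have ne: "z ^ t \<noteq> 1" by simp
  have "(\<Sum>d<p. z ^ (d * t)) = (\<Sum>d<p. (z ^ t) ^ d)"
    by (simp add: power_mult[symmetric] mult.commute)
  also have "\<dots> = 0" using geometric_sum[OF ne, of p] by (simp add: root_power[OF z(1)])
  finally show ?thesis .
qed

lemma uncertainty_fourier:
  assumes p: "prime p" and z: "z ^ p = 1" "z \<noteq> 1" and b: "b < p" "f b \<noteq> 0"
  shows "p + 1 \<le> card {b. b < p \<and> f b \<noteq> 0} + card {t. t < p \<and> fourier p z f t \<noteq> 0}"
  unfolding fourier_def by (rule uncertainty_principle_prime[where f = f and b = b]) (fact assms)+

lemma constant_of_fourier_zero:
  assumes p: "prime p" and z: "z ^ p = 1" "z \<noteq> 1"
    and f: "\<And>t. t \<in> {1..<p} \<Longrightarrow> fourier p z f t = 0" and d: "d < p"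
  shows "f d = f 0"
proof -
  have p0: "p > 0" using p prime_gt_0_nat by blast
  define c where "c = (\<Sum>b<p. f b) / of_nat p"
  define h where "h b = f b - c" for b
  have h0: "fourier p z h t = 0" if "t < p" for t
  proof (cases "t = 0")
    case True
    then show ?thesis using p0 by (simp add: fourier_def h_def sum_subtractf c_def)
  next
    case False
    then have t: "t \<in> {1..<p}" using that by simp
    have "fourier p z h t = fourier p z f t - c * (\<Sum>d<p. z ^ (d * t))"
      by (simp add: fourier_def h_def left_diff_distrib sum_subtractf sum_distrib_left)
    then show ?thesis using f[OF t] sum_root_powers[OF p z t] by simp
  qed
  have "h b = 0" if b: "b < p" for b
  proof (rule ccontr)
    assume "h b \<noteq> 0"
    with p z b have "p + 1 \<le> card {b. b < p \<and> h b \<noteq> 0} + card {t. t < p \<and> fourier p z h t \<noteq> 0}"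
      by (rule uncertainty_fourier)
    moreover have "{t. t < p \<and> fourier p z h t \<noteq> 0} = {}" using h0 by blast
    then have "card {t. t < p \<and> fourier p z h t \<noteq> 0} = 0" by (simp only: card.empty)
    moreover have "card {b. b < p \<and> h b \<noteq> 0} \<le> card {..<p}" by (intro card_mono) auto
    ultimately show False unfolding card_lessThan by linarith
  qed
  from this[OF d] this[OF p0] show ?thesis by (simp add: h_def)
qed

lemma correlation_orthogonal:
  fixes z :: complex
  assumes p: "prime p" and z: "z ^ p = 1" "z \<noteq> 1" "z * z' = 1"
    and point: "\<And>b. b < p \<Longrightarrow> f b * h b = 0" and corr: "\<And>d. d < p \<Longrightarrow> correlation p f h d = 0"
    and b: "b < p" "f b \<noteq> 0" and c: "c < p"
  shows "h c = 0"
proof (rule ccontr)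
  assume hc: "h c \<noteq> 0"
  have "z ^ p * z' ^ p = 1" using z(3) by (simp flip: power_mult_distrib)
  then have z': "z' ^ p = 1" "z' \<noteq> 1" using z by auto
  have disj: "fourier p z f t * fourier p z' h t = 0" for t
    unfolding fourier_correlation[OF z(1,3), symmetric] by (simp add: fourier_def corr)
  have u1: "p + 1 \<le> card {b. b < p \<and> f b \<noteq> 0} + card {t. t < p \<and> fourier p z f t \<noteq> 0}"
    using p z(1,2) b by (rule uncertainty_fourier)
  have u2: "p + 1 \<le> card {b. b < p \<and> h b \<noteq> 0} + card {t. t < p \<and> fourier p z' h t \<noteq> 0}"
    using p z' c hc by (rule uncertainty_fourier)
  have sum_le: "card {b. b < p \<and> P b} + card {b. b < p \<and> P' b} \<le> p" if "\<And>b. b < p \<Longrightarrow> \<not> (P b \<and> P' b)"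
    for P P' :: "nat \<Rightarrow> bool"
  proof -
    have "card {b. b < p \<and> P b} + card {b. b < p \<and> P' b} = card ({b. b < p \<and> P b} \<union> {b. b < p \<and> P' b})"
      using that by (intro card_Un_disjoint[symmetric]) auto
    also have "\<dots> \<le> card {..<p}" by (intro card_mono) auto
    finally show ?thesis by simp
  qed
  have "card {b. b < p \<and> f b \<noteq> 0} + card {b. b < p \<and> h b \<noteq> 0} \<le> p"
    using point by (intro sum_le) auto
  moreover have "card {t. t < p \<and> fourier p z f t \<noteq> 0} + card {t. t < p \<and> fourier p z' h t \<noteq> 0} \<le> p"
    using disj by (intro sum_le) auto
  ultimately show False using u1 u2 by linarith
qed

section \<open>S9\<close>

locale coset_setup =
  fixes p g m :: nat and k_ty :: "'k::finite itself"
  assumes p: "prime p" and k: "CARD('k) dvd p - 1" and g: "residue_primroot p g"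
    and m: "p - 1 \<in> power_coset p (CARD('k)) g m"
begin

abbreviation dl :: "nat \<Rightarrow> 'k mod_ring" where "dl \<equiv> dlog p g"

lemma p_gt_1: "1 < p" using p by (rule prime_gt_1_nat)

lemma bij_generator: "bij_betw (\<lambda>i. g ^ i mod p) {..<p - 1} {1..<p}"
proof -
  have "totatives p = {1..<p}" unfolding totatives_prime[OF p] by auto
  then show ?thesis
    using residue_primroot_is_generator[OF p_gt_1 g] unfolding totient_prime[OF p] by (simp only:)
qed

lemma mod_idx_exponent_unique:
  assumes "g ^ e mod p = g ^ e' mod p"
  shows "mod_idx e = (mod_idx e' :: 'k mod_ring)"
proof -
  have co: "coprime p g" and ord: "ord p g = p - 1"
    using g unfolding residue_primroot_def totient_prime[OF p] by blast+
  have "[g ^ e = g ^ e'] (mod p)" using assms by (simp add: cong_def)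
  then have "[e = e'] (mod p - 1)" using order_divides_expdiff[OF co, of e e'] ord by simp
  then have "[e = e'] (mod CARD('k))" using k by (rule cong_dvd_modulus_nat)
  then show ?thesis by (simp add: mod_idx_eq_iff cong_def)
qed

lemma dlog_power: "dl (g ^ e mod p) = mod_idx e"
proof -
  have "g ^ e mod p = g ^ (SOME e'. g ^ e mod p = g ^ e' mod p) mod p"
    by (rule someI) (rule refl)
  from mod_idx_exponent_unique[OF this] show ?thesis by (simp add: dlog_def)
qed

lemma dlog_cases:
  assumes "b \<in> {1..<p}"
  obtains e where "b = g ^ e mod p"
proof -
  have "b \<in> (\<lambda>i. g ^ i mod p) ` {..<p - 1}" using bij_generator assms by (simp add: bij_betw_def)
  then show ?thesis using that by blast
qed

lemma power_mod_in: "g ^ e mod p \<in> {1..<p}"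
proof -
  have "coprime p g" using g by (simp add: residue_primroot_def)
  then have "coprime p (g ^ e)" by simp
  then have "\<not> p dvd g ^ e" using coprime_common_divisor[of p "g ^ e" p] p_gt_1 by auto
  then have "g ^ e mod p \<noteq> 0" by (simp add: dvd_eq_mod_eq_0)
  then show ?thesis using p_gt_1 by simp
qed

lemma mult_mod_in:
  assumes "b \<in> {1..<p}" "c \<in> {1..<p}"
  shows "b * c mod p \<in> {1..<p}" and "dl (b * c mod p) = dl b + dl c"
proof -
  obtain e where eb: "b = g ^ e mod p" by (rule dlog_cases[OF assms(1)])
  obtain e' where ec: "c = g ^ e' mod p" by (rule dlog_cases[OF assms(2)])
  have bc: "b * c mod p = g ^ (e + e') mod p" unfolding eb ec by (simp add: power_add mod_mult_eq)
  show "b * c mod p \<in> {1..<p}" unfolding bc by (rule power_mod_in)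
  show "dl (b * c mod p) = dl b + dl c" unfolding bc dlog_power mod_idx_add by (simp only: eb ec dlog_power)
qed

lemma power_coset_eq: "power_coset p (CARD('k)) g i = {b \<in> {1..<p}. dl b = mod_idx i}"
proof (intro equalityI subsetI)
  fix b assume "b \<in> power_coset p (CARD('k)) g i"
  then obtain h where h: "h \<in> {1..<p}" "b = g ^ i * (h ^ CARD('k) mod p) mod p"
    by (auto simp: power_coset_def kth_powers_def)
  obtain e where e: "h = g ^ e mod p" by (rule dlog_cases[OF h(1)])
  have "b = g ^ (i + CARD('k) * e) mod p"
    unfolding h(2) e by (simp add: power_add power_mult power_mod mod_mult_right_eq mult.commute[of "CARD('k)"])
  then show "b \<in> {b \<in> {1..<p}. dl b = mod_idx i}"
    using power_mod_in[of "i + CARD('k) * e"] dlog_power[of "i + CARD('k) * e"]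
    by (simp add: mod_idx_add_multiple)
next
  fix b assume "b \<in> {b \<in> {1..<p}. dl b = mod_idx i}"
  then have b: "b \<in> {1..<p}" "dl b = mod_idx i" by auto
  obtain e where e: "b = g ^ e mod p" by (rule dlog_cases[OF b(1)])
  define e' where "e' = e + (p - 1) * i"
  have b': "b = g ^ e' mod p"
  proof -
    have co: "coprime p g" and ord: "ord p g = p - 1"
      using g unfolding residue_primroot_def totient_prime[OF p] by blast+
    have "[e = e'] (mod p - 1)" by (simp add: e'_def cong_def)
    then have "[g ^ e = g ^ e'] (mod p)" using order_divides_expdiff[OF co, of e e'] ord by simp
    then show ?thesis by (simp add: e cong_def)
  qed
  have "mod_idx e' = (mod_idx i :: 'k mod_ring)" using b(2) dlog_power[of e'] b' by simp
  then have cg: "e' mod CARD('k) = i mod CARD('k)" by (simp add: mod_idx_eq_iff)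
  have "1 \<le> p - 1" using p_gt_1 by linarith
  then have "1 * i \<le> (p - 1) * i" by (rule mult_le_mono1)
  then have "i \<le> e'" unfolding e'_def by linarith
  then have "CARD('k) dvd e' - i" using cg by (metis mod_eq_dvd_iff_nat)
  then obtain t where "e' - i = CARD('k) * t" by (rule dvdE)
  then have t: "e' = i + CARD('k) * t" using \<open>i \<le> e'\<close> by simp
  have "b = g ^ i * ((g ^ t mod p) ^ CARD('k) mod p) mod p"
    unfolding b' t by (simp add: power_add power_mult power_mod mod_mult_right_eq mult.commute[of "CARD('k)"])
  then show "b \<in> power_coset p (CARD('k)) g i"
    unfolding power_coset_def kth_powers_def using power_mod_in[of t] by blast
qed

lemma bij_mult_mod:
  assumes "d \<in> {1..<p}"
  shows "bij_betw (\<lambda>b. d * b mod p) {1..<p} {1..<p}"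
proof -
  have "inj_on (\<lambda>b. d * b mod p) {1..<p}"
  proof (rule inj_onI)
    fix x y assume xy: "x \<in> {1..<p}" "y \<in> {1..<p}" "d * x mod p = d * y mod p"
    have "\<not> p dvd d" using assms by (auto dest: dvd_imp_le)
    then have "coprime p d" by (rule prime_imp_coprime[OF p])
    then have "coprime d p" by (subst coprime_commute)
    then have "[x = y] (mod p)" using xy(3) cong_mult_lcancel_nat[of d p x y] by (simp add: cong_def)
    then show "x = y" using xy by (simp add: cong_def)
  qed
  moreover have "(\<lambda>b. d * b mod p) ` {1..<p} \<subseteq> {1..<p}" using mult_mod_in(1)[OF assms] by blast
  ultimately show ?thesis using endo_inj_surj[of "{1..<p}" "\<lambda>b. d * b mod p"] by (simp add: bij_betw_def)
qed

lemma card_dlog_fibre: "CARD('k) * card {b \<in> {1..<p}. dl b = a} = p - 1"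
proof -
  have eq: "card {b \<in> {1..<p}. dl b = a} = card {b \<in> {1..<p}. dl b = 0}" for a
  proof -
    obtain i where i: "a = mod_idx i" using bij_mod_idx[where 'k = 'k] by (auto simp: bij_betw_def)
    define d where "d = g ^ i mod p"
    have d: "d \<in> {1..<p}" "dl d = a" using power_mod_in dlog_power i by (auto simp: d_def)
    have img: "(\<lambda>b. d * b mod p) ` {b \<in> {1..<p}. dl b = 0} = {b \<in> {1..<p}. dl b = a}"
    proof (intro equalityI subsetI)
      fix c assume "c \<in> (\<lambda>b. d * b mod p) ` {b \<in> {1..<p}. dl b = 0}"
      then obtain b where b: "b \<in> {1..<p}" "dl b = 0" "c = d * b mod p" by blast
      then show "c \<in> {b \<in> {1..<p}. dl b = a}" using mult_mod_in[OF d(1) b(1)] d(2) by simp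
    next
      fix c assume c: "c \<in> {b \<in> {1..<p}. dl b = a}"
      then have "c \<in> (\<lambda>b. d * b mod p) ` {1..<p}" using bij_mult_mod[OF d(1)] by (simp add: bij_betw_def)
      then obtain b where b: "b \<in> {1..<p}" "c = d * b mod p" by blast
      then have "dl b = 0" using mult_mod_in(2)[OF d(1) b(1)] d(2) c by simp
      then show "c \<in> (\<lambda>b. d * b mod p) ` {b \<in> {1..<p}. dl b = 0}" using b by blast
    qed
    have "inj_on (\<lambda>b. d * b mod p) {b \<in> {1..<p}. dl b = 0}"
      using bij_mult_mod[OF d(1)] by (rule inj_on_subset[OF bij_betw_imp_inj_on]) blast
    from card_image[OF this] show ?thesis unfolding img .
  qed
  have "p - 1 = card (\<Union>a\<in>(UNIV :: 'k mod_ring set). {b \<in> {1..<p}. dl b = a})"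
  proof -
    have "(\<Union>a\<in>(UNIV :: 'k mod_ring set). {b \<in> {1..<p}. dl b = a}) = {1..<p}" by blast
    then show ?thesis by simp
  qed
  also have "\<dots> = (\<Sum>a\<in>(UNIV :: 'k mod_ring set). card {b \<in> {1..<p}. dl b = a})"
    by (intro card_UN_disjoint) auto
  also have "\<dots> = (\<Sum>a\<in>(UNIV :: 'k mod_ring set). card {b \<in> {1..<p}. dl b = 0})"
    by (rule sum.cong[OF refl eq])
  also have "\<dots> = CARD('k) * card {b \<in> {1..<p}. dl b = 0}"
    by (simp only: sum_constant CARD_mod_ring of_nat_id)
  finally show ?thesis unfolding eq[of a] by (rule sym)
qed

end

section \<open>S10\<close>

definition correlation_form ::
    "nat \<Rightarrow> nat \<Rightarrow> nat \<Rightarrow> complex \<Rightarrow> complex ^ ('k::finite mod_ring) \<Rightarrow> complex \<Rightarrow> complex ^ ('k mod_ring)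
      \<Rightarrow> 'k mod_ring \<Rightarrow> complex" where
  "correlation_form p g m x0 x y0 y a = x $ a * y0 + x0 * y $ (a + mod_idx m) +
    (\<Sum>i<CARD('k). \<Sum>j<CARD('k).
      of_nat (coset_succ_count p CARD('k) g i j) * (x $ (a + mod_idx j) * y $ (a + mod_idx i)))"

definition coset_fourier ::
    "nat \<Rightarrow> nat \<Rightarrow> complex \<Rightarrow> complex \<Rightarrow> complex ^ ('k::finite mod_ring) \<Rightarrow> 'k mod_ring \<Rightarrow> complex" where
  "coset_fourier p g z x0 x a = fourier p z (lift_cosets p g x0 x) (g ^ (SOME i. mod_idx i = a) mod p)"

context coset_setup
begin

lemma dlog_minus_1: "dl (p - 1) = mod_idx m"
  using m unfolding power_coset_eq by simp

lemma coset_succ_count_eq: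
  "coset_succ_count p CARD('k) g i j = card {b \<in> {1..<p - 1}. dl b = mod_idx i \<and> dl (b + 1) = mod_idx j}"
proof -
  have range: "(b + 1) mod p \<in> {1..<p} \<and> b \<in> {1..<p} \<longleftrightarrow> b \<in> {1..<p - 1}" for b
  proof (cases "b = p - 1")
    case True
    then show ?thesis using p_gt_1 by simp
  next
    case False
    then show ?thesis using p_gt_1 by (cases "b < p") auto
  qed
  have "{b \<in> power_coset p CARD('k) g i. (b + 1) mod p \<in> power_coset p CARD('k) g j}
      = {b \<in> {1..<p - 1}. dl b = mod_idx i \<and> dl (b + 1) = mod_idx j}"
    unfolding power_coset_eq
  proof (rule Collect_cong)
    fix b
    show "(b \<in> {b \<in> {1..<p}. dl b = mod_idx i} \<and> (b + 1) mod p \<in> {b \<in> {1..<p}. dl b = mod_idx j})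
      = (b \<in> {1..<p - 1} \<and> dl b = mod_idx i \<and> dl (b + 1) = mod_idx j)"
    proof (cases "b \<in> {1..<p - 1}")
      case True
      then have "b + 1 < p" by auto
      then have "(b + 1) mod p = b + 1" by (rule mod_less)
      moreover from this range[of b] True have "b \<in> {1..<p}" "b + 1 \<in> {1..<p}" by simp_all
      ultimately show ?thesis using True by (simp only: mem_Collect_eq simp_thms)
    next
      case False
      then show ?thesis unfolding mem_Collect_eq using range[of b] by blast
    qed
  qed
  then show ?thesis unfolding coset_succ_count_def by (rule arg_cong)
qed

lemma sum_consecutive_cosets:
  fixes f :: "'k mod_ring \<Rightarrow> 'k mod_ring \<Rightarrow> complex"
  shows "(\<Sum>b\<in>{1..<p - 1}. f (dl b) (dl (b + 1))) =
    (\<Sum>i<CARD('k). \<Sum>j<CARD('k). of_nat (coset_succ_count p CARD('k) g i j) * f (mod_idx i) (mod_idx j))"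
proof -
  let ?c = "\<lambda>u v. card {b \<in> {1..<p - 1}. dl b = u \<and> dl (b + 1) = v}"
  have "(\<Sum>b\<in>{1..<p - 1}. f (dl b) (dl (b + 1)))
    = (\<Sum>q\<in>UNIV \<times> UNIV. \<Sum>b\<in>{b \<in> {1..<p - 1}. (dl b, dl (b + 1)) = q}. f (dl b) (dl (b + 1)))"
    by (rule sum.group[symmetric]) auto
  also have "\<dots> = (\<Sum>(u, v)\<in>UNIV \<times> UNIV. of_nat (?c u v) * f u v)"
  proof (rule sum.cong[OF refl], clarify)
    fix u v :: "'k mod_ring"
    have "(\<Sum>b\<in>{b \<in> {1..<p - 1}. (dl b, dl (b + 1)) = (u, v)}. f (dl b) (dl (b + 1)))
      = (\<Sum>b\<in>{b \<in> {1..<p - 1}. (dl b, dl (b + 1)) = (u, v)}. f u v)"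
      by (rule sum.cong) auto
    then show "(\<Sum>b\<in>{b \<in> {1..<p - 1}. (dl b, dl (b + 1)) = (u, v)}. f (dl b) (dl (b + 1)))
      = of_nat (?c u v) * f u v" by simp
  qed
  also have "\<dots> = (\<Sum>u\<in>UNIV. \<Sum>v\<in>UNIV. of_nat (?c u v) * f u v)"
    by (rule sum.cartesian_product[symmetric])
  also have "\<dots> = (\<Sum>i<CARD('k). \<Sum>v\<in>UNIV. of_nat (?c (mod_idx i) v) * f (mod_idx i) v)"
    by (rule sum.reindex_bij_betw[OF bij_mod_idx, symmetric])
  also have "\<dots> = (\<Sum>i<CARD('k). \<Sum>j<CARD('k). of_nat (?c (mod_idx i) (mod_idx j)) * f (mod_idx i) (mod_idx j))"
    by (rule sum.cong[OF refl sum.reindex_bij_betw[OF bij_mod_idx, symmetric]])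
  finally show ?thesis unfolding coset_succ_count_eq .
qed

lemma correlation_lift:
  fixes x y :: "complex ^ ('k mod_ring)"
  assumes d: "d \<in> {1..<p}"
  shows "correlation p (lift_cosets p g x0 x) (lift_cosets p g y0 y) d = correlation_form p g m x0 x y0 y (dl d)"
proof -
  let ?L = "lift_cosets p g x0 x" and ?M = "lift_cosets p g y0 y"
  have s1: "{..<p} = insert 0 {1..<p}" using p_gt_1 by auto
  have s2: "{1..<p} = insert (p - 1) {1..<p - 1}" using p_gt_1 by auto
  have last: "?L ((d * (p - 1) mod p + d) mod p) * ?M (d * (p - 1) mod p) = x0 * y $ (dl d + mod_idx m)"
  proof -
    have "(d * (p - 1) mod p + d) mod p = (d * (p - 1) + d) mod p" by (rule mod_add_left_eq)
    also have "d * (p - 1) + d = d * p" using p_gt_1 by (simp add: algebra_simps)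
    finally have 1: "(d * (p - 1) mod p + d) mod p = 0" by simp
    have pm: "p - 1 \<in> {1..<p}" using p_gt_1 by auto
    show ?thesis unfolding 1 using mult_mod_in[OF d pm] dlog_minus_1 by (simp add: lift_cosets_def)
  qed
  have rest: "?L ((d * b mod p + d) mod p) * ?M (d * b mod p) = x $ (dl d + dl (b + 1)) * y $ (dl d + dl b)"
    if b: "b \<in> {1..<p - 1}" for b
  proof -
    have "(d * b mod p + d) mod p = (d * b + d) mod p" by (rule mod_add_left_eq)
    also have "d * b + d = d * (b + 1)" by simp
    finally have 1: "(d * b mod p + d) mod p = d * (b + 1) mod p" .
    have b1: "b + 1 \<in> {1..<p}" and b0: "b \<in> {1..<p}" using b by auto
    show ?thesis unfolding 1 lift_cosets_def using mult_mod_in[OF d b1] mult_mod_in[OF d b0] by simp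
  qed
  have "correlation p ?L ?M d = x $ dl d * y0 + (\<Sum>b\<in>{1..<p}. ?L ((b + d) mod p) * ?M b)"
    unfolding correlation_def s1 using d by (simp add: lift_cosets_def)
  also have "(\<Sum>b\<in>{1..<p}. ?L ((b + d) mod p) * ?M b)
    = (\<Sum>b\<in>{1..<p}. ?L ((d * b mod p + d) mod p) * ?M (d * b mod p))"
    by (rule sum.reindex_bij_betw[OF bij_mult_mod[OF d], symmetric])
  also have "\<dots> = x0 * y $ (dl d + mod_idx m) +
      (\<Sum>b\<in>{1..<p - 1}. ?L ((d * b mod p + d) mod p) * ?M (d * b mod p))"
    unfolding s2 last[symmetric] by (rule sum.insert) simp_all
  also have "(\<Sum>b\<in>{1..<p - 1}. ?L ((d * b mod p + d) mod p) * ?M (d * b mod p))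
      = (\<Sum>b\<in>{1..<p - 1}. x $ (dl d + dl (b + 1)) * y $ (dl d + dl b))"
    by (rule sum.cong[OF refl rest])
  also have "\<dots> = (\<Sum>i<CARD('k). \<Sum>j<CARD('k). of_nat (coset_succ_count p CARD('k) g i j) *
      (x $ (dl d + mod_idx j) * y $ (dl d + mod_idx i)))"
    by (rule sum_consecutive_cosets[of "\<lambda>u v. x $ (dl d + v) * y $ (dl d + u)"])
  finally show ?thesis unfolding correlation_form_def by (simp only: add.assoc)
qed

lemma dlog_surj: "\<exists>d\<in>{1..<p}. dl d = a"
proof -
  obtain i where i: "a = mod_idx i" using bij_mod_idx[where 'k = 'k] by (auto simp: bij_betw_def)
  then show ?thesis using power_mod_in[of i] dlog_power[of i] by (intro bexI[of _ "g ^ i mod p"]) simp_all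
qed

lemma fourier_lift:
  fixes x :: "complex ^ ('k mod_ring)"
  assumes z: "z ^ p = 1" and t: "t \<in> {1..<p}"
  shows "fourier p z (lift_cosets p g x0 x) t = coset_fourier p g z x0 x (dl t)"
proof -
  let ?L = "lift_cosets p g x0 x"
  define i where "i = (SOME i. mod_idx i = dl t)"
  obtain j where "dl t = mod_idx j" using bij_mod_idx[where 'k = 'k] by (auto simp: bij_betw_def)
  then have i: "mod_idx i = dl t" unfolding i_def by (intro someI[of "\<lambda>i. mod_idx i = dl t" j, OF sym])
  define t0 where "t0 = g ^ i mod p"
  have t0: "t0 \<in> {1..<p}" "dl t0 = dl t" using power_mod_in dlog_power i by (auto simp: t0_def)
  have "t \<in> (\<lambda>b. t0 * b mod p) ` {1..<p}" using bij_mult_mod[OF t0(1)] t by (simp add: bij_betw_def)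
  then obtain u where u: "u \<in> {1..<p}" "t = t0 * u mod p" by blast
  have e: "dl t = dl t0 + dl u" unfolding u(2) by (rule mult_mod_in(2)[OF t0(1) u(1)])
  have "dl t0 + dl u = dl t0 + 0"
    by (rule trans[OF e[symmetric]]) (subst t0(2), rule add_0_right[symmetric])
  then have du: "dl u = 0" by (simp only: add_left_cancel)
  have s1: "{..<p} = insert 0 {1..<p}" using p_gt_1 by auto
  have inv: "?L b = ?L (u * b mod p)" if "b \<in> {1..<p}" for b
    using mult_mod_in[OF u(1) that] that by (simp add: lift_cosets_def du)
  have pw: "z ^ (b * t) = z ^ ((u * b mod p) * t0)" for b
  proof -
    have "(b * t) mod p = (b * (t0 * u)) mod p" unfolding u(2) by (rule mod_mult_right_eq)
    also have "b * (t0 * u) = (u * b) * t0" by (simp only: mult_ac)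
    also have "((u * b) * t0) mod p = ((u * b mod p) * t0) mod p" by (rule mod_mult_left_eq[symmetric])
    finally have "(b * t) mod p = ((u * b mod p) * t0) mod p" .
    then show ?thesis
      by (simp only: power_mod_exponent[OF z, of "b * t", symmetric]
          power_mod_exponent[OF z, of "(u * b mod p) * t0", symmetric])
  qed
  have "fourier p z ?L t = x0 + (\<Sum>b\<in>{1..<p}. ?L b * z ^ (b * t))"
    unfolding fourier_def s1 by (simp add: lift_cosets_def)
  also have "(\<Sum>b\<in>{1..<p}. ?L b * z ^ (b * t)) = (\<Sum>b\<in>{1..<p}. ?L (u * b mod p) * z ^ ((u * b mod p) * t0))"
    by (intro sum.cong refl arg_cong2[where f = "(*)"] inv pw)
  also have "\<dots> = (\<Sum>b\<in>{1..<p}. ?L b * z ^ (b * t0))"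
    by (rule sum.reindex_bij_betw[OF bij_mult_mod[OF u(1)]])
  also have "x0 + \<dots> = fourier p z ?L t0"
    unfolding fourier_def s1 by (simp add: lift_cosets_def)
  finally show ?thesis unfolding coset_fourier_def t0_def i_def .
qed

definition coset_size :: nat where "coset_size = (p - 1) div CARD('k)"

lemma coset_size: "CARD('k) * coset_size = p - 1" "coset_size \<ge> 1"
proof -
  show 1: "CARD('k) * coset_size = p - 1" unfolding coset_size_def using k by simp
  have "coset_size \<noteq> 0"
  proof
    assume "coset_size = 0"
    then show False using 1 p_gt_1 by simp
  qed
  then show "coset_size \<ge> 1" by simp
qed

lemma card_support_lift:
  fixes x :: "complex ^ ('k mod_ring)"
  shows "card {b. b < p \<and> lift_cosets p g x0 x b \<noteq> 0} =
    (if x0 = 0 then 0 else 1) + coset_size * card {a. x $ a \<noteq> 0}"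
proof -
  let ?S = "\<lambda>a. {b \<in> {1..<p}. dl b = a}"
  have cs: "card (?S a) = coset_size" for a
  proof -
    have "CARD('k) * card (?S a) = CARD('k) * coset_size"
      using card_dlog_fibre[of a] coset_size(1) by simp
    then show ?thesis by simp
  qed
  have eq: "{b. b < p \<and> lift_cosets p g x0 x b \<noteq> 0} = (if x0 = 0 then {} else {0}) \<union> (\<Union>a\<in>{a. x $ a \<noteq> 0}. ?S a)"
    using p_gt_1 by (auto simp: lift_cosets_def split: if_splits)
  have "card (\<Union>a\<in>{a. x $ a \<noteq> 0}. ?S a) = (\<Sum>a\<in>{a. x $ a \<noteq> 0}. card (?S a))"
    by (rule card_UN_disjoint) auto
  also have "\<dots> = coset_size * card {a. x $ a \<noteq> 0}" by (simp only: cs sum_constant of_nat_id mult.commute)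
  finally have un: "card (\<Union>a\<in>{a. x $ a \<noteq> 0}. ?S a) = coset_size * card {a. x $ a \<noteq> 0}" .
  show ?thesis unfolding eq
  proof (subst card_Un_disjoint)
    show "finite (\<Union>a\<in>{a. x $ a \<noteq> 0}. ?S a)" by auto
  qed (use un in auto)
qed

lemma lift_nonzero:
  fixes x :: "complex ^ ('k mod_ring)"
  assumes "x0 \<noteq> 0 \<or> x \<noteq> 0"
  shows "\<exists>b<p. lift_cosets p g x0 x b \<noteq> 0"
proof (cases "x0 = 0")
  case False
  then show ?thesis using p_gt_1 by (intro exI[of _ 0]) (simp add: lift_cosets_def)
next
  case True
  then obtain a where a: "x $ a \<noteq> 0" using assms by (auto simp: vec_eq_iff)
  obtain d where "d \<in> {1..<p}" "dl d = a" using dlog_surj by blast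
  then show ?thesis using a by (intro exI[of _ d]) (simp add: lift_cosets_def)
qed

lemma coset_uncertainty:
  fixes x :: "complex ^ ('k mod_ring)"
  assumes z: "z ^ p = 1" "z \<noteq> 1" and nz: "x0 \<noteq> 0 \<or> x \<noteq> 0"
  shows "CARD('k) * coset_size + 1 \<le> (if x0 = 0 then 0 else 1) +
    coset_size * (card {a. x $ a \<noteq> 0} + card {a. coset_fourier p g z x0 x a \<noteq> 0})"
proof -
  let ?L = "lift_cosets p g x0 x"
  define w :: "complex ^ ('k mod_ring)" where "w = (\<chi> a. coset_fourier p g z x0 x a)"
  obtain b where b: "b < p" "?L b \<noteq> 0" using lift_nonzero[OF nz] by (elim exE conjE)
  have spec: "fourier p z ?L t = lift_cosets p g (fourier p z ?L 0) w t" if "t < p" for t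
  proof (cases "t = 0")
    case False
    then have "t \<in> {1..<p}" using that by simp
    from fourier_lift[OF z(1) this, of x0 x] show ?thesis
      using False by (simp only: lift_cosets_def[of p g "fourier p z ?L 0"] if_False w_def vec_lambda_beta simp_thms)
  next
    case True
    then show ?thesis by (simp only: lift_cosets_def[of p g "fourier p z ?L 0" w 0] refl if_True)
  qed
  have "(t < p \<and> fourier p z ?L t \<noteq> 0) = (t < p \<and> lift_cosets p g (fourier p z ?L 0) w t \<noteq> 0)" for t
    by (rule conj_cong[OF refl arg_cong[OF spec]])
  then have "{t. t < p \<and> fourier p z ?L t \<noteq> 0} = {t. t < p \<and> lift_cosets p g (fourier p z ?L 0) w t \<noteq> 0}"
    by (rule Collect_cong)
  moreover have "p + 1 \<le> card {b. b < p \<and> ?L b \<noteq> 0} + card {t. t < p \<and> fourier p z ?L t \<noteq> 0}"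
    using p z b by (rule uncertainty_fourier)
  ultimately have "p + 1 \<le> ((if x0 = 0 then 0 else 1) + coset_size * card {a. x $ a \<noteq> 0}) +
      ((if fourier p z ?L 0 = 0 then 0 else 1) + coset_size * card {a. w $ a \<noteq> 0})"
    by (simp only: card_support_lift)
  also have "\<dots> \<le> ((if x0 = 0 then 0 else 1) + coset_size * card {a. x $ a \<noteq> 0}) + (1 + coset_size * card {a. w $ a \<noteq> 0})"
    by simp
  finally have "p + 1 \<le> \<dots>" .
  moreover have "CARD('k) * coset_size + 1 = p" using coset_size(1) p_gt_1 by linarith
  ultimately show ?thesis unfolding distrib_left w_def vec_lambda_beta by linarith
qed

end

section \<open>S11\<close>

definition vanishes_on ::
    "nat \<Rightarrow> nat \<Rightarrow> complex \<Rightarrow> ('k::finite mod_ring + 'k mod_ring) set \<Rightarrow> complex \<Rightarrow> complex ^ ('k mod_ring) \<Rightarrow> bool" where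
  "vanishes_on p g z S x0 x \<longleftrightarrow>
    (\<forall>a. Inl a \<in> S \<longrightarrow> x $ a = 0) \<and> (\<forall>a. Inr a \<in> S \<longrightarrow> coset_fourier p g z x0 x a = 0)"

lemma lift_cosets_lin:
  "lift_cosets p g (c * x0 + d * y0) (c *s x + d *s y) b = c * lift_cosets p g x0 x b + d * lift_cosets p g y0 y b"
  by (simp add: lift_cosets_def)

lemma fourier_lin: "fourier p z (\<lambda>b. c * f b + d * h b) t = c * fourier p z f t + d * fourier p z h t"
  by (simp add: fourier_def algebra_simps sum.distrib sum_distrib_left)

lemma coset_fourier_lin:
  "coset_fourier p g z (c * x0 + d * y0) (c *s x + d *s y) a =
    c * coset_fourier p g z x0 x a + d * coset_fourier p g z y0 y a"
  unfolding coset_fourier_def fourier_lin[symmetric] by (simp add: fourier_def lift_cosets_lin)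

lemma card_sum_set:
  fixes S :: "('a::finite + 'b::finite) set"
  shows "card S = card {a. Inl a \<in> S} + card {a. Inr a \<in> S}"
proof -
  have "S = Inl ` {a. Inl a \<in> S} \<union> Inr ` {a. Inr a \<in> S}"
  proof (intro equalityI subsetI)
    fix s assume "s \<in> S"
    then show "s \<in> Inl ` {a. Inl a \<in> S} \<union> Inr ` {a. Inr a \<in> S}" by (cases s) auto
  qed auto
  then have "card S = card (Inl ` {a. Inl a \<in> S} \<union> Inr ` {a. Inr a \<in> S})" by (rule arg_cong)
  also have "\<dots> = card (Inl ` {a. Inl a \<in> S} :: ('a + 'b) set) + card (Inr ` {a. Inr a \<in> S} :: ('a + 'b) set)"
    by (rule card_Un_disjoint) auto
  also have "\<dots> = card {a. Inl a \<in> S} + card {a. Inr a \<in> S}"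
    by (simp add: card_image inj_on_def)
  finally show ?thesis .
qed

lemma card_nonzero: "card {a::'b::finite. f a \<noteq> (0::complex)} + card {a. f a = 0} = CARD('b)"
proof -
  have "card {a. f a \<noteq> 0} + card {a. f a = 0} = card ({a. f a \<noteq> 0} \<union> {a. f a = 0})"
    by (rule card_Un_disjoint[symmetric]) auto
  also have "{a. f a \<noteq> 0} \<union> {a. f a = 0} = UNIV" by blast
  finally show ?thesis .
qed

context coset_setup
begin

abbreviation zero_set :: "complex \<Rightarrow> complex \<Rightarrow> complex ^ ('k mod_ring) \<Rightarrow> ('k mod_ring + 'k mod_ring) set" where
  "zero_set z x0 x \<equiv> {s. case s of Inl a \<Rightarrow> x $ a = 0 | Inr a \<Rightarrow> coset_fourier p g z x0 x a = 0}"

lemma vanishes_on_iff: "vanishes_on p g z S x0 x \<longleftrightarrow> S \<subseteq> zero_set z x0 x"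
proof
  assume "vanishes_on p g z S x0 x"
  then show "S \<subseteq> zero_set z x0 x" by (auto simp: vanishes_on_def split: sum.splits)
next
  assume *: "S \<subseteq> zero_set z x0 x"
  show "vanishes_on p g z S x0 x"
    unfolding vanishes_on_def using subsetD[OF *] by fastforce
qed

lemma card_zero_set:
  assumes z: "z ^ p = 1" "z \<noteq> 1" and nz: "x0 \<noteq> 0 \<or> x \<noteq> 0"
  shows "coset_size * card (zero_set z x0 x) + 1 \<le> (if x0 = 0 then 0 else 1) + coset_size * CARD('k)"
proof -
  have "card {a. x $ a \<noteq> 0} + card {a. x $ a = 0} = CARD('k)"
    "card {a. coset_fourier p g z x0 x a \<noteq> 0} + card {a. coset_fourier p g z x0 x a = 0} = CARD('k)"
    using card_nonzero[of "\<lambda>a. x $ a"] card_nonzero[of "coset_fourier p g z x0 x"] by simp_all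
  moreover have "card (zero_set z x0 x) = card {a. x $ a = 0} + card {a. coset_fourier p g z x0 x a = 0}"
    by (subst card_sum_set) simp
  ultimately have "coset_size * (card {a. x $ a \<noteq> 0} + card {a. coset_fourier p g z x0 x a \<noteq> 0})
      + coset_size * card (zero_set z x0 x) = coset_size * CARD('k) + coset_size * CARD('k)"
    unfolding distrib_left[symmetric] by simp
  then show ?thesis using coset_uncertainty[OF z nz] by (simp add: mult.commute)
qed

lemma vanishing_unique:
  fixes x :: "complex ^ ('k mod_ring)"
  assumes z: "z ^ p = 1" "z \<noteq> 1" and S: "vanishes_on p g z S 0 x" "CARD('k) \<le> card S"
  shows "x = 0"
proof (rule ccontr)
  assume "x \<noteq> 0"
  then have "coset_size * card (zero_set z 0 x) + 1 \<le> coset_size * CARD('k)"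
    using card_zero_set[OF z, of 0 x] by simp
  moreover have "card S \<le> card (zero_set z 0 x)"
    using S(1) unfolding vanishes_on_iff by (intro card_mono) auto
  then have "coset_size * CARD('k) \<le> coset_size * card (zero_set z 0 x)" using S(2) by (intro mult_le_mono2) simp
  ultimately show False by simp
qed

lemma card_zero_set_le:
  assumes z: "z ^ p = 1" "z \<noteq> 1"
  shows "card (zero_set z 1 x) \<le> CARD('k)"
proof -
  have "coset_size * card (zero_set z 1 x) \<le> coset_size * CARD('k)"
    using card_zero_set[OF z, of 1 x] by simp
  then show ?thesis using coset_size(2) by simp
qed

lemma vanishing_exact:
  assumes z: "z ^ p = 1" "z \<noteq> 1" and S: "vanishes_on p g z S 1 x" "card S = CARD('k)"
  shows "zero_set z 1 x = S"
proof (rule card_seteq[symmetric])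
  show "S \<subseteq> zero_set z 1 x" using S(1) by (simp add: vanishes_on_iff)
  show "card (zero_set z 1 x) \<le> card S" using card_zero_set_le[OF z] S(2) by simp
qed simp

lemma vanishing_exists:
  fixes S :: "('k mod_ring + 'k mod_ring) set"
  assumes z: "z ^ p = 1" "z \<noteq> 1" and S: "card S = CARD('k)"
  shows "\<exists>x :: complex ^ ('k mod_ring). vanishes_on p g z S 1 x"
proof -
  define E :: "'k mod_ring option \<Rightarrow> complex \<times> (complex ^ ('k mod_ring))"
    where "E b = (case b of None \<Rightarrow> (1, 0) | Some c \<Rightarrow> (0, axis c 1))" for b
  define A where "A s b = (case s of Inl a \<Rightarrow> snd (E b) $ a | Inr a \<Rightarrow> coset_fourier p g z (fst (E b)) (snd (E b)) a)"
    for s and b :: "'k mod_ring option"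
  have "card S < card (UNIV :: 'k mod_ring option set)" using S by (simp add: card_UNIV_option)
  from homogeneous_system_nontrivial_solution[OF _ _ this, of A] obtain c where
    c: "\<exists>b. c b \<noteq> 0" "\<And>s. s \<in> S \<Longrightarrow> (\<Sum>b\<in>UNIV. A s b * c b) = 0" by auto
  define x0 where "x0 = c None"
  define x where "x = (\<chi> a. c (Some a))"
  have sumopt: "(\<Sum>b\<in>UNIV. h b) = h None + (\<Sum>a\<in>UNIV. h (Some a))" for h :: "'k mod_ring option \<Rightarrow> complex"
    unfolding UNIV_option_conv by (subst sum.insert) (auto simp: sum.reindex inj_on_def)
  have lift: "lift_cosets p g x0 x b = (\<Sum>q\<in>UNIV. lift_cosets p g (fst (E q)) (snd (E q)) b * c q)" for b
    unfolding sumopt by (simp add: lift_cosets_def E_def x0_def x_def axis_def if_distrib[of "\<lambda>x. x * _"] cong: if_cong)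
  have cf: "coset_fourier p g z x0 x a = (\<Sum>q\<in>UNIV. coset_fourier p g z (fst (E q)) (snd (E q)) a * c q)" for a
    unfolding coset_fourier_def fourier_def lift sum_distrib_right
    by (subst sum.swap) (simp add: mult_ac)
  have van: "vanishes_on p g z S x0 x"
    unfolding vanishes_on_def
  proof (intro conjI allI impI)
    fix a assume "Inl a \<in> S"
    from c(2)[OF this] show "x $ a = 0"
      unfolding sumopt by (simp add: A_def E_def x_def axis_def if_distrib[of "\<lambda>x. x * _"] cong: if_cong)
  next
    fix a assume "Inr a \<in> S"
    from c(2)[OF this] show "coset_fourier p g z x0 x a = 0" unfolding cf by (simp add: A_def)
  qed
  have "x0 \<noteq> 0"
  proof
    assume "x0 = 0"
    then have "x = 0" using van S by (intro vanishing_unique[OF z, of S]) simp_all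
    have "c b = 0" for b
    proof (cases b)
      case None
      then show ?thesis using \<open>x0 = 0\<close> by (simp add: x0_def)
    next
      case (Some a)
      then show ?thesis using \<open>x = 0\<close> by (simp add: x_def vec_eq_iff)
    qed
    then show False using c(1) by blast
  qed
  have "vanishes_on p g z S 1 ((1 / x0) *s x)"
    using van \<open>x0 \<noteq> 0\<close> coset_fourier_lin[of p g z "1 / x0" x0 0 0 x 0]
    by (simp add: vanishes_on_def)
  then show ?thesis by blast
qed

lemma correlation_zero: "correlation p f h 0 = (\<Sum>b<p. f b * h b)"
  unfolding correlation_def by (rule sum.cong) auto

lemma sum_lift_product:
  fixes x y :: "complex ^ ('k mod_ring)"
  assumes "\<And>a. x $ a * y $ a + u $ a * v $ a = 0"
  shows "(\<Sum>b<p. lift_cosets p g x0 x b * lift_cosets p g y0 y b + lift_cosets p g u0 u b * lift_cosets p g v0 v b)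
    = x0 * y0 + u0 * v0"
proof -
  have "(\<Sum>b<p. lift_cosets p g x0 x b * lift_cosets p g y0 y b + lift_cosets p g u0 u b * lift_cosets p g v0 v b)
    = (\<Sum>b\<in>{0}. lift_cosets p g x0 x b * lift_cosets p g y0 y b + lift_cosets p g u0 u b * lift_cosets p g v0 v b)"
    using p_gt_1 assms by (intro sum.mono_neutral_right) (auto simp: lift_cosets_def)
  then show ?thesis by (simp add: lift_cosets_def)
qed

lemma correlation_form_nondegenerate:
  fixes x y :: "complex ^ ('k mod_ring)" and z z' :: complex
  assumes z: "z ^ p = 1" "z \<noteq> 1" "z * z' = 1"
    and 0: "x0 * y0 = 0" "\<And>a. x $ a * y $ a = 0" "\<And>a. correlation_form p g m x0 x y0 y a = 0"
  shows "(x0 = 0 \<and> x = 0) \<or> (y0 = 0 \<and> y = 0)"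
proof (rule ccontr)
  assume "\<not> ?thesis"
  then have nz: "x0 \<noteq> 0 \<or> x \<noteq> 0" "y0 \<noteq> 0 \<or> y \<noteq> 0" by auto
  obtain b where b: "b < p" "lift_cosets p g x0 x b \<noteq> 0" using lift_nonzero[OF nz(1)] by blast
  obtain c where c: "c < p" "lift_cosets p g y0 y c \<noteq> 0" using lift_nonzero[OF nz(2)] by blast
  have point: "lift_cosets p g x0 x e * lift_cosets p g y0 y e = 0" for e
    using 0(1,2) by (simp add: lift_cosets_def)
  have corr: "correlation p (lift_cosets p g x0 x) (lift_cosets p g y0 y) d = 0" if "d < p" for d
  proof (cases "d = 0")
    case True
    then show ?thesis unfolding True correlation_zero point by simp
  next
    case False
    then have "d \<in> {1..<p}" using that by simp
    then show ?thesis using correlation_lift 0(3) by simp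
  qed
  have "lift_cosets p g y0 y c = 0"
    by (rule correlation_orthogonal[of p z z' "lift_cosets p g x0 x" "lift_cosets p g y0 y" b c])
      (rule p z point b c(1) | erule corr)+
  with c(2) show False by simp
qed

end

locale coset_roots = coset_setup p g m k_ty
  for p g m :: nat and k_ty :: "'k::finite itself" +
  fixes z z' :: complex
  assumes z: "z ^ p = 1" "z \<noteq> 1" and zz': "z * z' = 1"
begin

lemma z': "z' ^ p = 1" "z' \<noteq> 1"
proof -
  have "z ^ p * z' ^ p = 1" using zz' by (simp flip: power_mult_distrib)
  then show "z' ^ p = 1" "z' \<noteq> 1" using z zz' by auto
qed

lemma fourier_correlation_lift:
  fixes x y :: "complex ^ ('k mod_ring)"
  assumes "t \<in> {1..<p}"
  shows "fourier p z (correlation p (lift_cosets p g x0 x) (lift_cosets p g y0 y)) t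
    = coset_fourier p g z x0 x (dl t) * coset_fourier p g z' y0 y (dl t)"
  unfolding fourier_correlation[OF z(1) zz'] fourier_lift[OF z(1) assms] fourier_lift[OF z'(1) assms] ..

lemma correlation_zero_lift:
  fixes x y u v :: "complex ^ ('k mod_ring)"
  assumes "\<And>a. x $ a * y $ a + u $ a * v $ a = 0"
  shows "correlation p (lift_cosets p g x0 x) (lift_cosets p g y0 y) 0
    + correlation p (lift_cosets p g u0 u) (lift_cosets p g v0 v) 0 = x0 * y0 + u0 * v0"
  unfolding correlation_zero sum.distrib[symmetric] by (rule sum_lift_product) (rule assms)

lemma correlation_lift_0: "correlation p (lift_cosets p g 0 (0 :: complex ^ ('k mod_ring))) h d = 0"
proof -
  have "lift_cosets p g 0 (0 :: complex ^ ('k mod_ring)) b = 0" for b by (simp only: lift_cosets_def zero_index if_cancel)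
  then show ?thesis by (simp only: correlation_def mult_zero_left sum.neutral_const)
qed

definition special_solution :: "complex ^ ('k mod_ring) \<Rightarrow> complex ^ ('k mod_ring) \<Rightarrow> bool" where
  "special_solution x y \<longleftrightarrow> (\<forall>a. x $ a * y $ a = 0) \<and> (\<forall>a. correlation_form p g m 1 x 1 y a = 1)"

lemma special_solution_correlation:
  assumes "special_solution x y" "d < p"
  shows "correlation p (lift_cosets p g 1 x) (lift_cosets p g 1 y) d = 1"
proof (cases "d = 0")
  case True
  show ?thesis unfolding True
    using correlation_zero_lift[of x y 0 0 1 1 0 0] assms(1)
    by (simp add: special_solution_def correlation_lift_0)
next
  case False
  then have "d \<in> {1..<p}" using assms(2) by simp
  from correlation_lift[OF this] show ?thesis using assms(1) by (simp add: special_solution_def)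
qed

lemma special_solution_iff:
  "special_solution x y \<longleftrightarrow> (\<forall>a. x $ a * y $ a = 0) \<and>
    (\<forall>a. coset_fourier p g z 1 x a * coset_fourier p g z' 1 y a = 0)"
proof
  assume s: "special_solution x y"
  have "coset_fourier p g z 1 x a * coset_fourier p g z' 1 y a = 0" for a
  proof -
    obtain t where t: "t \<in> {1..<p}" "dl t = a" using dlog_surj by blast
    have "fourier p z (correlation p (lift_cosets p g 1 x) (lift_cosets p g 1 y)) t = (\<Sum>d<p. z ^ (d * t))"
      unfolding fourier_def by (rule sum.cong[OF refl]) (simp add: special_solution_correlation[OF s])
    then show ?thesis
      unfolding fourier_correlation_lift[OF t(1)] t(2) sum_root_powers[OF p z t(1)] .
  qed
  then show "(\<forall>a. x $ a * y $ a = 0) \<and> (\<forall>a. coset_fourier p g z 1 x a * coset_fourier p g z' 1 y a = 0)"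
    using s by (simp add: special_solution_def)
next
  assume *: "(\<forall>a. x $ a * y $ a = 0) \<and> (\<forall>a. coset_fourier p g z 1 x a * coset_fourier p g z' 1 y a = 0)"
  let ?C = "correlation p (lift_cosets p g 1 x) (lift_cosets p g 1 y)"
  have 0: "?C 0 = 1"
    using correlation_zero_lift[of x y 0 0 1 1 0 0] * by (simp add: correlation_lift_0)
  have F0: "fourier p z ?C t = 0" if "t \<in> {1..<p}" for t
    using * by (simp only: fourier_correlation_lift[OF that])
  have "correlation_form p g m 1 x 1 y a = 1" for a
  proof -
    obtain d where d: "d \<in> {1..<p}" "dl d = a" using dlog_surj by blast
    then have "d < p" by simp
    have "?C d = ?C 0" by (rule constant_of_fourier_zero[OF p z _ \<open>d < p\<close>]) (rule F0)
    then show ?thesis unfolding correlation_lift[OF d(1)] d(2) 0 .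
  qed
  then show "special_solution x y" using * by (simp add: special_solution_def)
qed

lemma card_UNIV_sum: "card (UNIV :: ('k mod_ring + 'k mod_ring) set) = 2 * CARD('k)"
  using card_UNIV_sum[where 'a = "'k mod_ring" and 'b = "'k mod_ring"] by simp

lemma card_complement:
  fixes S :: "('k mod_ring + 'k mod_ring) set"
  shows "card (- S) = 2 * CARD('k) - card S"
  unfolding Compl_eq_Diff_UNIV by (subst card_Diff_subset) (simp_all add: card_UNIV_sum)

lemma special_solution_zero_sets:
  assumes "special_solution x y"
  shows "card (zero_set z 1 x) = CARD('k)" and "zero_set z' 1 y = - zero_set z 1 x"
proof -
  have un: "- zero_set z 1 x \<subseteq> zero_set z' 1 y"
  proof
    fix s assume "s \<in> - zero_set z 1 x"
    then show "s \<in> zero_set z' 1 y"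
      using assms unfolding special_solution_iff by (cases s) auto
  qed
  have le: "card (zero_set z 1 x) \<le> CARD('k)" "card (zero_set z' 1 y) \<le> CARD('k)"
    using card_zero_set_le[OF z] card_zero_set_le[OF z'] by blast+
  have "card (- zero_set z 1 x) \<le> card (zero_set z' 1 y)" using un by (intro card_mono) auto
  then show c: "card (zero_set z 1 x) = CARD('k)" using le unfolding card_complement by linarith
  have "- zero_set z 1 x = zero_set z' 1 y"
    using un by (rule card_seteq[rotated]) (use le(2) c in \<open>simp_all add: card_complement\<close>)
  then show "zero_set z' 1 y = - zero_set z 1 x" by (rule sym)
qed

lemma special_solution_unique:
  assumes "special_solution x y" "special_solution u v" and eq: "zero_set z 1 x = zero_set z 1 u"
  shows "x = u \<and> y = v"
proof -
  have diff: "w = w'"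
    if r: "r ^ p = 1" "r \<noteq> 1" and e: "zero_set r 1 w = zero_set r 1 w'" and c: "CARD('k) \<le> card (zero_set r 1 w)"
    for r and w w' :: "complex ^ ('k mod_ring)"
  proof -
    have "vanishes_on p g r (zero_set r 1 w) 1 w" "vanishes_on p g r (zero_set r 1 w) 1 w'"
      unfolding vanishes_on_iff using e by auto
    then have "vanishes_on p g r (zero_set r 1 w) 0 (w - w')"
      using coset_fourier_lin[of p g r 1 1 "-1" 1 w w'] by (simp add: vanishes_on_def)
    from vanishing_unique[OF r this c] show ?thesis by simp
  qed
  have "x = u" using special_solution_zero_sets(1)[OF assms(1)] by (intro diff[OF z eq]) simp
  moreover have "y = v"
  proof (rule diff[OF z'])
    show "zero_set z' 1 y = zero_set z' 1 v"
      using special_solution_zero_sets(2)[OF assms(1)] special_solution_zero_sets(2)[OF assms(2)] eq by simp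
    show "CARD('k) \<le> card (zero_set z' 1 y)"
      unfolding special_solution_zero_sets(2)[OF assms(1)] card_complement special_solution_zero_sets(1)[OF assms(1)] by simp
  qed
  ultimately show ?thesis by blast
qed

lemma special_solution_exists:
  assumes S: "card S = CARD('k)"
  shows "\<exists>x y. special_solution x y \<and> zero_set z 1 x = S"
proof -
  obtain x where x: "vanishes_on p g z S 1 x" using vanishing_exists[OF z S] by blast
  have "card (- S) = CARD('k)" unfolding card_complement S by simp
  then obtain y where y: "vanishes_on p g z' (- S) 1 y" using vanishing_exists[OF z'] by blast
  have "special_solution x y"
    unfolding special_solution_iff
  proof (intro conjI allI)
    fix a
    show "x $ a * y $ a = 0" using x y by (cases "Inl a \<in> S") (simp_all add: vanishes_on_def)
    show "coset_fourier p g z 1 x a * coset_fourier p g z' 1 y a = 0"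
      using x y by (cases "Inr a \<in> S") (simp_all add: vanishes_on_def)
  qed
  moreover have "zero_set z 1 x = S" by (rule vanishing_exact[OF z x S])
  ultimately show ?thesis by blast
qed

lemma bij_betw_special_solutions:
  "bij_betw (\<lambda>(x, y). zero_set z 1 x) {(x, y). special_solution x y} {S. card S = CARD('k)}"
proof (rule bij_betw_imageI)
  show "inj_on (\<lambda>(x, y). zero_set z 1 x) {(x, y). special_solution x y}"
  proof (rule inj_onI, clarify)
    fix x y u v assume "special_solution x y" "special_solution u v" "zero_set z 1 x = zero_set z 1 u"
    then show "x = u \<and> y = v" by (rule special_solution_unique)
  qed
  show "(\<lambda>(x, y). zero_set z 1 x) ` {(x, y). special_solution x y} = {S. card S = CARD('k)}"
  proof (intro equalityI subsetI)
    fix S assume "S \<in> (\<lambda>(x, y). zero_set z 1 x) ` {(x, y). special_solution x y}"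
    then obtain x y where "special_solution x y" "S = zero_set z 1 x" by blast
    then show "S \<in> {S. card S = CARD('k)}" using special_solution_zero_sets(1) by simp
  next
    fix S :: "('k mod_ring + 'k mod_ring) set" assume "S \<in> {S. card S = CARD('k)}"
    then obtain x y where "special_solution x y" "zero_set z 1 x = S"
      using special_solution_exists[of S] by blast
    then show "S \<in> (\<lambda>(x, y). zero_set z 1 x) ` {(x, y). special_solution x y}"
      by (intro image_eqI[of _ _ "(x, y)"]) simp_all
  qed
qed

lemma card_special_solutions: "card {(x, y). special_solution x y} = (2 * CARD('k)) choose CARD('k)"
proof -
  have "card {S. S \<subseteq> (UNIV :: ('k mod_ring + 'k mod_ring) set) \<and> card S = CARD('k)}
    = card (UNIV :: ('k mod_ring + 'k mod_ring) set) choose CARD('k)"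
    by (rule n_subsets) simp
  then show ?thesis using bij_betw_same_card[OF bij_betw_special_solutions]
    by (simp only: card_UNIV_sum subset_UNIV simp_thms)
qed

lemma special_solution_nondegenerate:
  fixes u v :: "complex ^ ('k mod_ring)"
  assumes s: "special_solution x y"
    and point: "\<And>a. u $ a * y $ a + x $ a * v $ a = 0"
    and corr: "\<And>a. correlation_form p g m 0 u 1 y a + correlation_form p g m 1 x 0 v a = 0"
  shows "u = 0 \<and> v = 0"
proof -
  define S where "S = zero_set z 1 x"
  have S: "zero_set z 1 x = S" "zero_set z' 1 y = - S" "card S = CARD('k)"
    using special_solution_zero_sets[OF s] by (simp_all add: S_def)
  have xS: "x $ a = 0 \<longleftrightarrow> Inl a \<in> S" "coset_fourier p g z 1 x a = 0 \<longleftrightarrow> Inr a \<in> S" for a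
    unfolding S(1)[symmetric] by simp_all
  have yS: "y $ a = 0 \<longleftrightarrow> Inl a \<in> - S" "coset_fourier p g z' 1 y a = 0 \<longleftrightarrow> Inr a \<in> - S" for a
    unfolding S(2)[symmetric] by simp_all
  define C where "C d = correlation p (lift_cosets p g 0 u) (lift_cosets p g 1 y) d
    + correlation p (lift_cosets p g 1 x) (lift_cosets p g 0 v) d" for d
  have C0: "C d = 0" if "d < p" for d
  proof (cases "d = 0")
    case True
    show ?thesis unfolding True C_def correlation_zero_lift[OF point] by simp
  next
    case False
    then have "d \<in> {1..<p}" using that by simp
    then show ?thesis unfolding C_def using corr by (simp add: correlation_lift)
  qed
  have four: "coset_fourier p g z 0 u a * coset_fourier p g z' 1 y a
      + coset_fourier p g z 1 x a * coset_fourier p g z' 0 v a = 0" for a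
  proof -
    obtain t where t: "t \<in> {1..<p}" "dl t = a" using dlog_surj by blast
    have "fourier p z C t = 0" unfolding fourier_def by (rule sum.neutral) (simp add: C0)
    moreover have "fourier p z C t = fourier p z (correlation p (lift_cosets p g 0 u) (lift_cosets p g 1 y)) t
      + fourier p z (correlation p (lift_cosets p g 1 x) (lift_cosets p g 0 v)) t"
      unfolding fourier_def C_def by (simp add: distrib_right sum.distrib)
    ultimately show ?thesis unfolding fourier_correlation_lift[OF t(1)] t(2) by simp
  qed
  have "vanishes_on p g z S 0 u"
    unfolding vanishes_on_def
  proof (intro conjI allI impI)
    fix a assume "Inl a \<in> S"
    then show "u $ a = 0" using point[of a] xS(1)[of a] yS(1)[of a] by simp
  next
    fix a assume "Inr a \<in> S"
    then show "coset_fourier p g z 0 u a = 0" using four[of a] xS(2)[of a] yS(2)[of a] by simp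
  qed
  then have "u = 0" using S(3) by (intro vanishing_unique[OF z, of S]) simp_all
  have "vanishes_on p g z' (- S) 0 v"
    unfolding vanishes_on_def
  proof (intro conjI allI impI)
    fix a assume "Inl a \<in> - S"
    then show "v $ a = 0" using point[of a] xS(1)[of a] yS(1)[of a] by simp
  next
    fix a assume "Inr a \<in> - S"
    then show "coset_fourier p g z' 0 v a = 0" using four[of a] xS(2)[of a] yS(2)[of a] by simp
  qed
  then have "v = 0" using S(3) by (intro vanishing_unique[OF z', of "- S"]) (simp_all add: card_complement)
  with \<open>u = 0\<close> show ?thesis by blast
qed

end

section \<open>S12\<close>

lemma polynomial_map_derivative:
  fixes F :: "complex ^ 'm \<Rightarrow> complex ^ 'n"
  assumes F: "\<And>i. polyfn d (\<lambda>z. F z $ i)"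
  shows "\<exists>F'. (\<forall>i j. polyfn d (\<lambda>z. F' z $ i $ j)) \<and> continuous_on UNIV F' \<and>
    (\<forall>z. (F has_derivative (*v) (F' z)) (at z))"
proof -
  have "\<forall>i. \<exists>f'. (\<forall>j. polyfn d (f' j)) \<and>
      (\<forall>z. ((\<lambda>z. F z $ i) has_derivative (\<lambda>h. \<Sum>j\<in>UNIV. f' j z * h $ j)) (at z))"
    using polyfn_has_derivative[OF F] by blast
  from choice[OF this] obtain f' where f':
    "\<And>i j. polyfn d (f' i j)"
    "\<And>i z. ((\<lambda>z. F z $ i) has_derivative (\<lambda>h. \<Sum>j\<in>UNIV. f' i j z * h $ j)) (at z)"
    by blast
  define F' :: "complex ^ 'm \<Rightarrow> complex ^ 'm ^ 'n" where "F' z = (\<chi> i j. f' i j z)" for z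
  have "continuous_on UNIV F'"
    unfolding F'_def by (intro continuous_on_vec_lambda polyfn_continuous[OF f'(1)])
  moreover have "(F has_derivative (*v) (F' z)) (at z)" for z
  proof (rule has_derivative_vecI)
    fix i
    show "((\<lambda>z. F z $ i) has_derivative (\<lambda>h. (F' z *v h) $ i)) (at z)"
      using f'(2)[of i z] by (simp add: F'_def matrix_vector_mult_def)
  qed
  moreover have "polyfn d (\<lambda>z. F' z $ i $ j)" for i j using f'(1)[of i j] by (simp add: F'_def)
  ultimately show ?thesis by blast
qed

lemma polynomial_map_off_hypersurface:
  fixes F :: "complex ^ 'n \<Rightarrow> complex ^ 'n"
  assumes F: "\<And>i. polyfn d (\<lambda>z. F z $ i)"
    and poly: "\<And>i j. polyfn d (\<lambda>z. F' z $ i $ j)" and cont: "continuous_on UNIV F'"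
    and deriv: "\<And>z. (F has_derivative (*v) (F' z)) (at z)"
    and proper: "\<And>K. compact K \<Longrightarrow> compact {z. F z \<in> K}"
    and reg: "det (F' z0) \<noteq> 0"
  shows "\<exists>m Q. proper_map_off_hypersurface F F' UNIV UNIV m Q"
proof -
  have J: "polyfn (d * CARD('n)) (\<lambda>z. det (F' z))"
    using polyfn_det[of d "\<lambda>i j z. F' z $ i $ j"] poly by (simp add: vec_lambda_eta)
  have dense: "\<exists>z'\<in>UNIV. dist z' z < \<epsilon> \<and> det (F' z') \<noteq> 0" if "\<epsilon> > 0" for z \<epsilon>
    using polyfn_nonzero_dense[OF J reg that] by blast
  have "\<exists>m Q. polyfn m Q \<and> (\<exists>w :: complex ^ 'n. Q w \<noteq> 0) \<and> (\<forall>z\<in>UNIV. det (F' z) = 0 \<longrightarrow> Q (F z) = 0)"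
  proof (rule critical_values_in_hypersurface[where e = 0 and M = "\<lambda>_. 1" and d = 0 and D = "max d (d * CARD('n))"])
    show "\<exists>P. polyfn (max d (d * CARD('n))) P \<and> (\<forall>z\<in>UNIV. 1 ^ 0 * F z $ i = P z)" for i
      by (rule exI[of _ "\<lambda>z. F z $ i"]) (simp add: polyfn_mono[OF F])
    show "\<exists>P. polyfn (max d (d * CARD('n))) P \<and> (\<forall>z\<in>UNIV. 1 ^ 0 * det (F' z) = P z)"
      by (rule exI[of _ "\<lambda>z. det (F' z)"]) (simp add: polyfn_mono[OF J])
    show "continuous_on UNIV (\<lambda>z. det (F' z))" by (rule polyfn_continuous[OF J])
    show "continuous_on UNIV F"
      using deriv by (intro continuous_at_imp_continuous_on ballI) (rule has_derivative_continuous)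
      show "\<exists>z'\<in>UNIV. dist z' z < \<epsilon> \<and> det (F' z') \<noteq> 0" if "\<epsilon> > 0" for z \<epsilon> by (rule dense[OF that])
  qed (auto intro: polyfn_const)
  then obtain m Q where Q: "polyfn m Q" "\<exists>w. Q w \<noteq> 0" "\<forall>z\<in>UNIV. det (F' z) = 0 \<longrightarrow> Q (F z) = 0"
    by blast
  have "proper_map_off_hypersurface F F' UNIV UNIV m Q"
  proof unfold_locales
    show "compact {z \<in> UNIV. F z \<in> K}" if "compact K" for K using proper[OF that] by simp
  qed (use deriv cont Q dense in auto)
  then show ?thesis by blast
qed

definition join :: "complex ^ 'b \<Rightarrow> complex ^ 'b \<Rightarrow> complex ^ ('b + 'b)" where
  "join x y = (\<chi> s. case s of Inl a \<Rightarrow> x $ a | Inr a \<Rightarrow> y $ a)"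

definition left_part :: "complex ^ ('b + 'b) \<Rightarrow> complex ^ 'b" where "left_part z = (\<chi> a. z $ Inl a)"

definition right_part :: "complex ^ ('b + 'b) \<Rightarrow> complex ^ 'b" where "right_part z = (\<chi> a. z $ Inr a)"

lemma join_nth [simp]: "join x y $ Inl a = x $ a" "join x y $ Inr a = y $ a"
  by (simp_all add: join_def)

lemma part_nth [simp]: "left_part z $ a = z $ Inl a" "right_part z $ a = z $ Inr a"
  by (simp_all add: left_part_def right_part_def)

lemma join_eq_iff: "join x y = z \<longleftrightarrow> x = left_part z \<and> y = right_part z"
  unfolding vec_eq_iff split_sum_all by auto

lemma join_parts [simp]: "join (left_part z) (right_part z) = z"
  "left_part (join x y) = x" "right_part (join x y) = y"
  using join_eq_iff[of "left_part z" "right_part z" z] join_eq_iff[of x y "join x y"] by auto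

lemma has_derivative_nth: "((\<lambda>z. z $ i) has_derivative (\<lambda>h. h $ i)) F"
  by (rule bounded_linear_imp_has_derivative[OF bounded_linear_vec_nth])

lemma norm_vec_le_sum: "norm (z :: complex ^ 'n) \<le> (\<Sum>i\<in>UNIV. norm (z $ i))"
  unfolding norm_vec_def by (rule L2_set_le_sum) simp

context coset_roots
begin

definition lifted_map ::
    "complex ^ ('k mod_ring + 'k mod_ring) \<Rightarrow> complex ^ ('k mod_ring + 'k mod_ring)" where
  "lifted_map q = join (\<chi> a. q $ Inl a * q $ Inr a)
    (\<chi> a. correlation_form p g m 1 (left_part q) 1 (right_part q) a)"

definition lifted_deriv ::
    "complex ^ ('k mod_ring + 'k mod_ring) \<Rightarrow> complex ^ ('k mod_ring + 'k mod_ring) \<Rightarrow> complex ^ ('k mod_ring + 'k mod_ring)" where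
  "lifted_deriv q h = join (\<chi> a. h $ Inl a * q $ Inr a + q $ Inl a * h $ Inr a)
    (\<chi> a. correlation_form p g m 0 (left_part h) 1 (right_part q) a
        + correlation_form p g m 1 (left_part q) 0 (right_part h) a)"

lemma polyfn_lifted_map: "polyfn 2 (\<lambda>q. lifted_map q $ s)"
proof -
  have 1: "polyfn 1 (\<lambda>q. q $ r)" for r :: "'k mod_ring + 'k mod_ring" using polyfn_coord[of 0 r] by simp
  have 2: "polyfn 2 (\<lambda>q. q $ r * q $ r')" for r r' :: "'k mod_ring + 'k mod_ring"
    using polyfn_mult[OF 1[of r] 1[of r']] by (simp add: numeral_2_eq_2)
  have 3: "polyfn 2 (\<lambda>q. q $ r)" for r :: "'k mod_ring + 'k mod_ring" by (rule polyfn_mono[OF 1]) simp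
  show ?thesis
  proof (cases s)
    case (Inl a)
    then show ?thesis using 2[of "Inl a" "Inr a"] by (simp add: lifted_map_def)
  next
    case (Inr a)
    have "polyfn 2 (\<lambda>q. correlation_form p g m 1 (left_part q) 1 (right_part q) a)"
      unfolding correlation_form_def part_nth mult_1_left mult_1_right
      by (intro polyfn_add polyfn_sum polyfn_cmult 2 3)
    then show ?thesis unfolding Inr by (simp add: lifted_map_def)
  qed
qed

lemma lifted_map_has_derivative: "(lifted_map has_derivative lifted_deriv q) (at q)"
proof (rule has_derivative_vecI)
  fix s
  show "((\<lambda>q. lifted_map q $ s) has_derivative (\<lambda>h. lifted_deriv q h $ s)) (at q)"
  proof (cases s)
    case (Inl a)
    show ?thesis unfolding Inl lifted_map_def lifted_deriv_def join_nth vec_lambda_beta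
      by (rule has_derivative_eq_rhs, (rule has_derivative_mult has_derivative_nth)+) (simp add: algebra_simps)
  next
    case (Inr a)
    show ?thesis
      unfolding Inr lifted_map_def lifted_deriv_def join_nth vec_lambda_beta correlation_form_def part_nth
      by (rule has_derivative_eq_rhs, (rule has_derivative_add has_derivative_sum has_derivative_mult
            has_derivative_nth has_derivative_const)+)
        (simp add: fun_eq_iff algebra_simps sum.distrib)
  qed
qed

definition form_size :: "complex \<Rightarrow> complex ^ ('k mod_ring) \<Rightarrow> complex \<Rightarrow> complex ^ ('k mod_ring) \<Rightarrow> real" where
  "form_size x0 x y0 y = norm (x0 * y0) + (\<Sum>a\<in>UNIV. norm (x $ a * y $ a))
    + (\<Sum>a\<in>UNIV. norm (correlation_form p g m x0 x y0 y a))"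

lemma correlation_form_scale:
  "correlation_form p g m (s * x0) (s *s x) (t * y0) (t *s y) a = (s * t) * correlation_form p g m x0 x y0 y a"
  unfolding correlation_form_def by (simp add: algebra_simps sum_distrib_left)

lemma form_size_scale:
  "form_size (s * x0) (s *s x) (t * y0) (t *s y) = norm s * norm t * form_size x0 x y0 y"
  unfolding form_size_def correlation_form_scale
  by (simp add: norm_mult algebra_simps sum_distrib_left)

lemma form_size_pos:
  assumes "x0 \<noteq> 0 \<or> x \<noteq> 0" "y0 \<noteq> 0 \<or> y \<noteq> 0"
  shows "form_size x0 x y0 y > 0"
proof (rule ccontr)
  assume "\<not> ?thesis"
  moreover have nn: "norm (x0 * y0) \<ge> 0" "(\<Sum>a\<in>UNIV. norm (x $ a * y $ a)) \<ge> 0"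
    "(\<Sum>a\<in>UNIV. norm (correlation_form p g m x0 x y0 y a)) \<ge> 0" by (auto intro: sum_nonneg)
  ultimately have "norm (x0 * y0) = 0" "(\<Sum>a\<in>UNIV. norm (x $ a * y $ a)) = 0"
    "(\<Sum>a\<in>UNIV. norm (correlation_form p g m x0 x y0 y a)) = 0"
    unfolding form_size_def by linarith+
  then have "x0 * y0 = 0" "x $ a * y $ a = 0" "correlation_form p g m x0 x y0 y a = 0" for a
    by (simp_all add: sum_nonneg_eq_0_iff)
  from correlation_form_nondegenerate[OF z zz' this] show False using assms by blast
qed

lemma form_size_bound:
  "\<exists>\<delta>>0. \<forall>x y. \<delta> * (norm (1 :: complex, x) * norm (1 :: complex, y)) \<le> form_size 1 x 1 y"
proof -
  define S :: "(complex \<times> (complex ^ ('k mod_ring))) set" where "S = sphere 0 1"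
  define T where "T q = form_size (fst (fst q)) (snd (fst q)) (fst (snd q)) (snd (snd q))" for q
  have "continuous_on (S \<times> S) T"
    unfolding T_def form_size_def correlation_form_def by (intro continuous_intros)
  moreover have "compact (S \<times> S)" unfolding S_def by (intro compact_Times compact_sphere)
  moreover have "(1, 0) \<in> S" by (simp add: S_def norm_Pair)
  then have "S \<times> S \<noteq> {}" by blast
  ultimately obtain q where q: "q \<in> S \<times> S" "\<forall>r\<in>S \<times> S. T q \<le> T r"
    using continuous_attains_inf[of "S \<times> S" T] by blast
  have Tq: "T q > 0"
    unfolding T_def
  proof (rule form_size_pos)
    show "fst (fst q) \<noteq> 0 \<or> snd (fst q) \<noteq> 0" using q(1) by (cases q) (auto simp: S_def norm_Pair)
    show "fst (snd q) \<noteq> 0 \<or> snd (snd q) \<noteq> 0" using q(1) by (cases q) (auto simp: S_def norm_Pair)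
  qed
  have "T q * (norm (1 :: complex, x) * norm (1 :: complex, y)) \<le> form_size 1 x 1 y" for x y
  proof -
    define r where "r = norm (1 :: complex, x)"
    define s where "s = norm (1 :: complex, y)"
    have pos: "r > 0" "s > 0" unfolding r_def s_def by (simp_all add: zero_prod_def)
    have sc: "(complex_of_real (1 / t), complex_of_real (1 / t) *s u) \<in> S" if "t = norm (1 :: complex, u)" "t > 0" for t u
    proof -
      have "(complex_of_real (1 / t), complex_of_real (1 / t) *s u) = (1 / t) *\<^sub>R (1, u)"
        unfolding scaleR_Pair prod.inject vec_eq_iff vector_smult_component vector_scaleR_component
        by (simp add: scaleR_conv_of_real)
      moreover have "norm ((1 / t) *\<^sub>R (1 :: complex, u)) = 1"
        unfolding norm_scaleR that(1)[symmetric] using that(2) by simp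
      ultimately show ?thesis unfolding S_def mem_sphere_0 by (simp only:)
    qed
    have "((complex_of_real (1 / r), complex_of_real (1 / r) *s x), (complex_of_real (1 / s), complex_of_real (1 / s) *s y)) \<in> S \<times> S"
      using sc[OF r_def pos(1)] sc[OF s_def pos(2)] by simp
    from q(2)[rule_format, OF this] have "T q \<le> (1 / r) * (1 / s) * form_size 1 x 1 y"
      using form_size_scale[of "complex_of_real (1 / r)" 1 x "complex_of_real (1 / s)" 1 y] pos
      by (simp add: T_def norm_divide)
    then show ?thesis unfolding r_def[symmetric] s_def[symmetric] using pos by (simp add: field_simps)
  qed
  then show ?thesis using Tq by blast
qed

lemma lifted_map_proper:
  assumes "compact K"
  shows "compact {q. lifted_map q \<in> K}"
proof -
  obtain \<delta> where \<delta>: "\<delta> > 0" "\<And>x y. \<delta> * (norm (1 :: complex, x) * norm (1 :: complex, y)) \<le> form_size 1 x 1 y"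
    using form_size_bound by blast
  obtain B where B: "\<And>w. w \<in> K \<Longrightarrow> norm w \<le> B" using compact_imp_bounded[OF assms] by (auto simp: bounded_iff)
  define C where "C = 1 + CARD('k) * B + CARD('k) * B"
  have bound: "norm (q $ s) \<le> C / \<delta>" if "lifted_map q \<in> K" for q s
  proof -
    have nw: "norm (lifted_map q $ s) \<le> B" for s
      using Finite_Cartesian_Product.norm_nth_le[of "lifted_map q" s] B[OF that] by linarith
    define x where "x = left_part q"
    define y where "y = right_part q"
    have "(\<Sum>a\<in>UNIV. norm (x $ a * y $ a)) \<le> (\<Sum>a\<in>(UNIV :: 'k mod_ring set). B)"
      using nw[of "Inl _"] by (intro sum_mono) (simp add: lifted_map_def x_def y_def)
    moreover have "(\<Sum>a\<in>UNIV. norm (correlation_form p g m 1 x 1 y a)) \<le> (\<Sum>a\<in>(UNIV :: 'k mod_ring set). B)"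
      using nw[of "Inr _"] by (intro sum_mono) (simp add: lifted_map_def x_def y_def)
    ultimately have "form_size 1 x 1 y \<le> 1 + real CARD('k) * B + real CARD('k) * B"
      unfolding form_size_def by (intro add_mono) simp_all
    then have "form_size 1 x 1 y \<le> C" by (simp only: C_def)
    then have le: "\<delta> * (norm (1 :: complex, x) * norm (1 :: complex, y)) \<le> C" using \<delta>(2)[of x y] by linarith
    have ge: "norm (1 :: complex, u) \<ge> 1" "norm (1 :: complex, u) \<ge> norm u" for u :: "complex ^ ('k mod_ring)"
      using norm_fst_le[of "1 :: complex" u] norm_snd_le[of u "1 :: complex"] by simp_all
    have "norm x \<le> norm (1 :: complex, x) * norm (1 :: complex, y)"
      using mult_mono[OF ge(2)[of x] ge(1)[of y]] by simp
    moreover have "norm y \<le> norm (1 :: complex, x) * norm (1 :: complex, y)"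
      using mult_mono[OF ge(1)[of x] ge(2)[of y]] by simp
    moreover have "norm (1 :: complex, x) * norm (1 :: complex, y) \<le> C / \<delta>"
      using le \<delta>(1) by (simp add: field_simps)
    ultimately have xy: "norm x \<le> C / \<delta>" "norm y \<le> C / \<delta>" by linarith+
    show ?thesis
    proof (cases s)
      case (Inl a)
      then show ?thesis using Finite_Cartesian_Product.norm_nth_le[of x a] xy(1) by (simp add: x_def)
    next
      case (Inr a)
      then show ?thesis using Finite_Cartesian_Product.norm_nth_le[of y a] xy(2) by (simp add: y_def)
    qed
  qed
  have "bounded {q. lifted_map q \<in> K}"
  proof (rule boundedI)
    fix q assume "q \<in> {q. lifted_map q \<in> K}"
    then have "(\<Sum>s\<in>UNIV. norm (q $ s)) \<le> (\<Sum>s\<in>(UNIV :: ('k mod_ring + 'k mod_ring) set). C / \<delta>)"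
      using bound by (intro sum_mono) simp
    then show "norm q \<le> (\<Sum>s\<in>(UNIV :: ('k mod_ring + 'k mod_ring) set). C / \<delta>)"
      using norm_vec_le_sum[of q] by linarith
  qed
  moreover have "closed {q. lifted_map q \<in> K}"
  proof -
    have "continuous_on UNIV lifted_map"
      using lifted_map_has_derivative by (intro continuous_at_imp_continuous_on ballI) (rule has_derivative_continuous)
    from continuous_closed_preimage[OF this closed_UNIV compact_imp_closed[OF assms]]
    show ?thesis by (simp add: vimage_def)
  qed
  ultimately show ?thesis by (simp add: compact_eq_bounded_closed)
qed

lemma lifted_map_special_iff: "lifted_map q = join 0 1 \<longleftrightarrow> special_solution (left_part q) (right_part q)"
  unfolding vec_eq_iff split_sum_all special_solution_def by (simp add: lifted_map_def)

lemma card_special_fibre: "card {q. lifted_map q = join 0 1} = (2 * CARD('k)) choose CARD('k)"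
proof -
  have "bij_betw (\<lambda>(x, y). join x y) {(x, y). special_solution x y} {q. lifted_map q = join 0 1}"
    by (rule bij_betw_byWitness[where f' = "\<lambda>q. (left_part q, right_part q)"])
      (auto simp: lifted_map_special_iff)
  from bij_betw_same_card[OF this] show ?thesis unfolding card_special_solutions by (rule sym)
qed

lemma special_fibre_regular:
  assumes "lifted_map q = join 0 1" "lifted_deriv q h = 0"
  shows "h = 0"
proof -
  have "left_part h = 0 \<and> right_part h = 0"
  proof (rule special_solution_nondegenerate)
    show "special_solution (left_part q) (right_part q)" using assms(1) by (simp add: lifted_map_special_iff)
    fix a
    show "left_part h $ a * right_part q $ a + left_part q $ a * right_part h $ a = 0"
      using arg_cong[OF assms(2), of "\<lambda>w. w $ Inl a"] by (simp add: lifted_deriv_def)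
    show "correlation_form p g m 0 (left_part h) 1 (right_part q) a
      + correlation_form p g m 1 (left_part q) 0 (right_part h) a = 0"
      using arg_cong[OF assms(2), of "\<lambda>w. w $ Inr a"] by (simp add: lifted_deriv_def)
  qed
  then have "join (left_part h) (right_part h) = join 0 0" by simp
  then show ?thesis by (simp add: join_eq_iff vec_eq_iff split_sum_all)
qed

lemma card_regular_lifted_fibre:
  assumes reg: "\<And>q h. lifted_map q = w \<Longrightarrow> lifted_deriv q h = 0 \<Longrightarrow> h = 0"
  shows "card {q. lifted_map q = w} = (2 * CARD('k)) choose CARD('k)"
proof -
  obtain F' where F': "\<And>i j. polyfn 2 (\<lambda>q. F' q $ i $ j)" "continuous_on UNIV F'"
    "\<And>q. (lifted_map has_derivative (*v) (F' q)) (at q)"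
    using polynomial_map_derivative[of 2 lifted_map, OF polyfn_lifted_map] by blast
  have mv: "F' q *v h = lifted_deriv q h" for q h
    using has_derivative_unique[OF F'(3) lifted_map_has_derivative] by (rule fun_cong)
  have det: "det (F' q) \<noteq> 0 \<longleftrightarrow> (\<forall>h. lifted_deriv q h = 0 \<longrightarrow> h = 0)" for q
    unfolding det_nonzero_iff_inj mv ..
  have "(2 * CARD('k)) choose CARD('k) \<noteq> 0" by simp
  then have "{q. lifted_map q = join 0 1} \<noteq> {}" unfolding card_special_fibre[symmetric] by (metis card.empty)
  then obtain z0 where "lifted_map z0 = join 0 1" by blast
  then have "det (F' z0) \<noteq> 0" unfolding det using special_fibre_regular by blast
  then obtain n Q where "proper_map_off_hypersurface lifted_map F' UNIV UNIV n Q"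
    using polynomial_map_off_hypersurface[of 2 lifted_map F', OF polyfn_lifted_map F' lifted_map_proper] by blast
  then interpret proper_map_off_hypersurface lifted_map F' UNIV UNIV n Q .
  obtain w1 where w1: "Q w1 \<noteq> 0" using Q_nonzero by blast
  have fib: "fibre v = {q. lifted_map q = v}" for v by (simp add: fibre_def)
  have "\<forall>q\<in>fibre w. det (F' q) \<noteq> 0" unfolding fib det using reg by blast
  then have "card (fibre w) = card (fibre w1)" using w1 by (intro card_regular_fibre) simp_all
  moreover have "\<forall>q\<in>fibre (join 0 1). det (F' q) \<noteq> 0" unfolding fib det using special_fibre_regular by blast
  then have "card (fibre (join 0 1)) = card (fibre w1)" using w1 by (intro card_regular_fibre) simp_all
  ultimately show ?thesis unfolding fib card_special_fibre by simp
qed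

end

section \<open>S13\<close>

definition embed :: "complex ^ 'b \<Rightarrow> complex ^ ('b + 'b)" where
  "embed c = join c (\<chi> a. 1 / c $ a)"

definition embed_deriv :: "complex ^ 'b \<Rightarrow> complex ^ 'b \<Rightarrow> complex ^ ('b + 'b)" where
  "embed_deriv c h = join h (\<chi> a. - h $ a * (1 / c $ a) ^ 2)"

lemma embed_has_derivative:
  assumes "c \<in> cstar_space"
  shows "(embed has_derivative embed_deriv c) (at c)"
proof (rule has_derivative_vecI)
  fix s
  show "((\<lambda>c. embed c $ s) has_derivative (\<lambda>h. embed_deriv c h $ s)) (at c)"
  proof (cases s)
    case (Inl a)
    then show ?thesis by (simp add: embed_def embed_deriv_def has_derivative_nth)
  next
    case (Inr a)
    have "((\<lambda>c. inverse (c $ a)) has_derivative (\<lambda>h. - (inverse (c $ a) * h $ a * inverse (c $ a)))) (at c)"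
      using assms by (intro Deriv.has_derivative_inverse[OF _ has_derivative_nth]) (simp add: cstar_space_def)
    then show ?thesis
      unfolding Inr embed_def embed_deriv_def join_nth vec_lambda_beta
      by (simp add: power2_eq_square divide_inverse mult_ac)
  qed
qed

lemma polyfn_embed:
  fixes G :: "complex ^ ('b::finite + 'b) \<Rightarrow> complex"
  assumes "polyfn d G"
  shows "\<exists>P. polyfn (d * (CARD('b) + 1)) P \<and>
    (\<forall>c\<in>cstar_space. (\<Prod>i\<in>UNIV. c $ i) ^ d * G (embed c) = P c)"
  using assms
proof (induction rule: polyfn.induct)
  have M: "polyfn (card A) (\<lambda>c. \<Prod>i\<in>A. c $ i)" for A :: "'b set"
  proof -
    have "polyfn 1 (\<lambda>c. c $ i)" for i :: 'b using polyfn_coord[of 0 i] by simp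
    from polyfn_prod[of A "\<lambda>_. 1" "\<lambda>i c. c $ i", OF this] show ?thesis by simp
  qed
  have Md: "polyfn (CARD('b) * d) (\<lambda>c :: complex ^ 'b. (\<Prod>i\<in>UNIV. c $ i) ^ d)" for d
    by (intro polyfn_power M)
  {
    case (polyfn_const d e)
    show ?case
    proof (intro exI conjI ballI)
      show "polyfn (d * (CARD('b) + 1)) (\<lambda>c :: complex ^ 'b. e * (\<Prod>i\<in>UNIV. c $ i) ^ d)"
        by (intro polyfn_cmult polyfn_mono[OF Md]) simp
    qed simp
  next
    case (polyfn_coord d s)
    show ?case
    proof (cases s)
      case (Inl a)
      show ?thesis
      proof (intro exI conjI ballI)
        have "polyfn (CARD('b) * Suc d + 1) (\<lambda>c :: complex ^ 'b. (\<Prod>i\<in>UNIV. c $ i) ^ Suc d * c $ a)"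
          unfolding One_nat_def by (intro polyfn.polyfn_mult Md polyfn.polyfn_coord)
        then show "polyfn (Suc d * (CARD('b) + 1)) (\<lambda>c :: complex ^ 'b. (\<Prod>i\<in>UNIV. c $ i) ^ Suc d * c $ a)"
          by (rule polyfn_mono) simp
      qed (simp add: Inl embed_def)
    next
      case (Inr a)
      show ?thesis
      proof (intro exI conjI ballI)
        have "polyfn (CARD('b) * d + card (UNIV - {a})) (\<lambda>c :: complex ^ 'b. (\<Prod>i\<in>UNIV. c $ i) ^ d * (\<Prod>i\<in>UNIV - {a}. c $ i))"
          by (intro polyfn.polyfn_mult Md M)
        then show "polyfn (Suc d * (CARD('b) + 1)) (\<lambda>c :: complex ^ 'b. (\<Prod>i\<in>UNIV. c $ i) ^ d * (\<Prod>i\<in>UNIV - {a}. c $ i))"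
          by (rule polyfn_mono) (simp add: card_Diff_singleton mult.commute)
      next
        fix c :: "complex ^ 'b" assume "c \<in> cstar_space"
        then have "c $ a \<noteq> 0" by (simp add: cstar_space_def)
        moreover have "(\<Prod>i\<in>UNIV. c $ i) = c $ a * (\<Prod>i\<in>UNIV - {a}. c $ i)" by (rule prod.remove) auto
        ultimately show "(\<Prod>i\<in>UNIV. c $ i) ^ Suc d * embed c $ s = (\<Prod>i\<in>UNIV. c $ i) ^ d * (\<Prod>i\<in>UNIV - {a}. c $ i)"
          by (simp add: Inr embed_def)
      qed
    qed
  next
    case (polyfn_add d f h)
    then obtain P R where P: "polyfn (d * (CARD('b) + 1)) P" "\<forall>c\<in>cstar_space. (\<Prod>i\<in>UNIV. c $ i) ^ d * f (embed c) = P c"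
      and R: "polyfn (d * (CARD('b) + 1)) R" "\<forall>c\<in>cstar_space. (\<Prod>i\<in>UNIV. c $ i) ^ d * h (embed c) = R c"
      by blast
    show ?case
      by (intro exI conjI ballI, rule polyfn.polyfn_add[OF P(1) R(1)]) (use P(2) R(2) in \<open>simp add: distrib_left\<close>)
  next
    case (polyfn_mult d f e h)
    then obtain P R where P: "polyfn (d * (CARD('b) + 1)) P" "\<forall>c\<in>cstar_space. (\<Prod>i\<in>UNIV. c $ i) ^ d * f (embed c) = P c"
      and R: "polyfn (e * (CARD('b) + 1)) R" "\<forall>c\<in>cstar_space. (\<Prod>i\<in>UNIV. c $ i) ^ e * h (embed c) = R c"
      by blast
    show ?case
    proof (intro exI conjI ballI)
      show "polyfn ((d + e) * (CARD('b) + 1)) (\<lambda>c. P c * R c)"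
        unfolding distrib_right[of d e] by (rule polyfn.polyfn_mult[OF P(1) R(1)])
      fix c :: "complex ^ 'b" assume c: "c \<in> cstar_space"
      show "(\<Prod>i\<in>UNIV. c $ i) ^ (d + e) * (f (embed c) * h (embed c)) = P c * R c"
        unfolding P(2)[rule_format, OF c, symmetric] R(2)[rule_format, OF c, symmetric]
        by (simp only: power_add mult_ac)
    qed
  }
qed

lemma region_cstar_space: "region (cstar_space :: (complex ^ 'n) set)"
  unfolding region_def
proof (intro conjI)
  have "open (\<Inter>a\<in>UNIV. {c :: complex ^ 'n. c $ a \<noteq> 0})"
    by (intro open_INT ballI open_Collect_neq continuous_intros) simp
  moreover have "(\<Inter>a\<in>UNIV. {c :: complex ^ 'n. c $ a \<noteq> 0}) = cstar_space" by (auto simp: cstar_space_def)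
  ultimately show "open (cstar_space :: (complex ^ 'n) set)" by simp
  have "cstar_space = (\<lambda>w :: complex ^ 'n. \<chi> a. exp (w $ a)) ` UNIV"
  proof (intro equalityI subsetI)
    fix c :: "complex ^ 'n" assume "c \<in> cstar_space"
    then have "c = (\<chi> a. exp ((\<chi> a. Ln (c $ a)) $ a))" by (simp add: cstar_space_def vec_eq_iff)
    then show "c \<in> (\<lambda>w. \<chi> a. exp (w $ a)) ` UNIV" by (rule image_eqI) simp
  qed (auto simp: cstar_space_def)
  moreover have "connected ((\<lambda>w :: complex ^ 'n. \<chi> a. exp (w $ a)) ` UNIV)"
    by (intro connected_continuous_image continuous_on_vec_lambda continuous_intros connected_UNIV)
  ultimately show "connected (cstar_space :: (complex ^ 'n) set)" by simp
  have "(1 :: complex ^ 'n) \<in> cstar_space" by (simp add: cstar_space_def)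
  then show "(cstar_space :: (complex ^ 'n) set) \<noteq> {}" by blast
qed

lemma sum_UNIV_sum_type: "(\<Sum>s\<in>(UNIV :: ('a::finite + 'b::finite) set). f s) = (\<Sum>a\<in>UNIV. f (Inl a)) + (\<Sum>b\<in>UNIV. f (Inr b))"
  unfolding UNIV_Plus_UNIV[symmetric] by (subst sum.Plus) auto

context coset_roots
begin

lemma lifted_map_embed:
  assumes "c \<in> cstar_space"
  shows "lifted_map (embed c) = join 1 (chi_map p g m c)"
proof -
  have "lifted_map (embed c) $ s = join 1 (chi_map p g m c) $ s" for s
    using assms
    by (cases s) (simp_all add: lifted_map_def embed_def chi_map_def correlation_form_def cstar_space_def divide_inverse)
  then show ?thesis by (simp add: vec_eq_iff)
qed

lemma lifted_map_join_1:
  assumes "lifted_map q = join 1 y"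
  shows "left_part q \<in> cstar_space" and "embed (left_part q) = q" and "chi_map p g m (left_part q) = y"
proof -
  have 1: "q $ Inl a * q $ Inr a = 1" for a
    using arg_cong[OF assms, of "\<lambda>w. w $ Inl a"] by (simp add: lifted_map_def)
  then have ne: "q $ Inl a \<noteq> 0" for a by (metis mult_zero_left zero_neq_one)
  then show U: "left_part q \<in> cstar_space" by (simp add: cstar_space_def)
  have "1 / q $ Inl a = q $ Inr a" for a
    using 1[of a] ne[of a] by (simp add: divide_eq_eq mult.commute)
  then show e: "embed (left_part q) = q"
    unfolding embed_def join_eq_iff by (simp add: vec_eq_iff)
  have "join 1 (chi_map p g m (left_part q)) = join 1 y" 
    using trans[OF lifted_map_embed[OF U, symmetric] trans[OF arg_cong[OF e, of lifted_map] assms]] .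
  from arg_cong[OF this, of right_part] show "chi_map p g m (left_part q) = y" by simp
qed

lemma chi_map_eq: "chi_map p g m c = right_part (lifted_map (embed c))"
  by (simp add: vec_eq_iff lifted_map_def embed_def chi_map_def correlation_form_def divide_inverse)

definition chi_deriv :: "complex ^ ('k mod_ring) \<Rightarrow> complex ^ ('k mod_ring) \<Rightarrow> complex ^ ('k mod_ring)" where
  "chi_deriv c h = right_part (lifted_deriv (embed c) (embed_deriv c h))"

lemma chi_map_has_derivative:
  assumes "c \<in> cstar_space"
  shows "(chi_map p g m has_derivative chi_deriv c) (at c)"
proof -
  have R: "(right_part has_derivative right_part) (at q)" for q :: "complex ^ ('k mod_ring + 'k mod_ring)"
    by (rule has_derivative_vecI) (simp add: has_derivative_nth)
  have "((\<lambda>c. right_part (lifted_map (embed c))) has_derivative (\<lambda>h. right_part (lifted_deriv (embed c) (embed_deriv c h)))) (at c)"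
    by (rule has_derivative_compose[OF has_derivative_compose[OF embed_has_derivative[OF assms] lifted_map_has_derivative] R])
  then show ?thesis unfolding chi_map_eq[abs_def] chi_deriv_def[abs_def] .
qed

lemma chi_deriv_matrix:
  "\<exists>G. (\<forall>a b. polyfn 4 (G a b)) \<and> (\<forall>c h. (\<chi> a b. G a b (embed c)) *v h = chi_deriv c h)"
proof -
  obtain F' where F': "\<And>i j. polyfn 2 (\<lambda>q. F' q $ i $ j)"
    "\<And>q. (lifted_map has_derivative (*v) (F' q)) (at q)"
    using polynomial_map_derivative[of 2 lifted_map, OF polyfn_lifted_map] by blast
  have mv: "F' q *v h = lifted_deriv q h" for q h
    using has_derivative_unique[OF F'(2) lifted_map_has_derivative] by (rule fun_cong)
  define G where "G a b q = F' q $ Inr a $ Inl b - F' q $ Inr a $ Inr b * (q $ Inr b) ^ 2" for a b q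
  have 2: "polyfn 2 (\<lambda>q. (q $ Inr b) ^ 2)" for b
    using polyfn_power[OF polyfn_coord[of 0 "Inr b"], of 2] by simp
  have "polyfn 4 (G a b)" for a b
    unfolding G_def
    by (rule polyfn_diff, rule polyfn_mono[OF F'(1)], simp, rule polyfn_mono[OF polyfn_mult[OF F'(1) 2]]) simp
  moreover have "(\<chi> a b. G a b (embed c)) *v h = chi_deriv c h" for c h
  proof -
    have "((\<chi> a b. G a b (embed c)) *v h) $ a = chi_deriv c h $ a" for a
      unfolding chi_deriv_def mv[symmetric] part_nth matrix_vector_mult_def vec_lambda_beta sum_UNIV_sum_type G_def
      by (simp add: embed_def embed_deriv_def sum.distrib[symmetric] algebra_simps)
    then show ?thesis by (simp add: vec_eq_iff)
  qed
  ultimately show ?thesis by blast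
qed

lemma lifted_deriv_inj:
  assumes c: "c \<in> cstar_space" and inj: "\<And>h. chi_deriv c h = 0 \<Longrightarrow> h = 0" and 0: "lifted_deriv (embed c) w = 0"
  shows "w = 0"
proof -
  have "right_part w $ a = - left_part w $ a * (1 / c $ a) ^ 2" for a
  proof -
    have "w $ Inl a * (1 / c $ a) + c $ a * w $ Inr a = 0"
      using arg_cong[OF 0, of "\<lambda>w. w $ Inl a"] by (simp add: lifted_deriv_def embed_def)
    then have "c $ a * (w $ Inr a + w $ Inl a * (1 / c $ a) ^ 2) = 0"
      using c by (simp add: cstar_space_def field_simps power2_eq_square)
    then have "w $ Inr a + w $ Inl a * (1 / c $ a) ^ 2 = 0" using c by (simp add: cstar_space_def)
    then show ?thesis by (simp add: eq_neg_iff_add_eq_0)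
  qed
  then have w: "embed_deriv c (left_part w) = w"
    unfolding embed_deriv_def join_eq_iff by (simp add: vec_eq_iff)
  then have "chi_deriv c (left_part w) = 0"
    unfolding chi_deriv_def w 0 by (simp add: vec_eq_iff)
  then have "left_part w = 0" by (rule inj)
  then show ?thesis using w by (simp add: embed_deriv_def vec_eq_iff split_sum_all)
qed

lemma chi_regular_point:
  "\<exists>c\<in>cstar_space. \<forall>h. chi_deriv c h = 0 \<longrightarrow> h = 0"
proof -
  let ?n = "\<lambda>i j. coset_succ_count p CARD('k) g i j"
  define N where "N = (\<Sum>i<CARD('k). \<Sum>j<CARD('k). real (?n i j))"
  define t where "t = 2 + 4 * N"
  have N0: "N \<ge> 0" unfolding N_def by (intro sum_nonneg) simp
  then have t: "t \<ge> 2" "N / t \<le> 1 / 4" unfolding t_def by (simp_all add: field_simps)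
  define c :: "complex ^ ('k mod_ring)" where "c = (\<chi> a. of_real t)"
  have "c \<in> cstar_space" using t by (simp add: cstar_space_def c_def)
  moreover have "h = 0" if 0: "chi_deriv c h = 0" for h
  proof -
    define B where "B = Max (range (\<lambda>a. norm (h $ a)))"
    have B: "norm (h $ a) \<le> B" for a unfolding B_def by (rule Max_ge) auto
    have "B \<in> range (\<lambda>a. norm (h $ a))" unfolding B_def by (rule Max_in) auto
    then obtain a where a: "B = norm (h $ a)" by blast
    have B0: "B \<ge> 0" unfolding a by simp
    define E where "E = (\<Sum>i<CARD('k). \<Sum>j<CARD('k). of_nat (?n i j) * (h $ (a + mod_idx j) - h $ (a + mod_idx i)))"
    have ct: "complex_of_real t \<noteq> 0" using t by simp
    define S1 where "S1 = (\<Sum>i<CARD('k). \<Sum>j<CARD('k). of_nat (?n i j) * (h $ (a + mod_idx j) * (1 / of_real t)))"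
    define S2 where "S2 = (\<Sum>i<CARD('k). \<Sum>j<CARD('k). of_nat (?n i j) * (of_real t * (- h $ (a + mod_idx i) * (1 / of_real t) ^ 2)))"
    have "S1 + S2 = E * (1 / of_real t)"
      unfolding S1_def S2_def E_def sum_distrib_right sum.distrib[symmetric]
      using ct by (intro sum.cong refl) (simp add: field_simps power2_eq_square)
    moreover have "chi_deriv c h $ a = h $ a - h $ (a + mod_idx m) * (1 / of_real t) ^ 2 + (S1 + S2)"
      unfolding chi_deriv_def lifted_deriv_def embed_def embed_deriv_def correlation_form_def c_def S1_def S2_def
        part_nth join_nth vec_lambda_beta join_parts
      by simp
    ultimately have "h $ a - h $ (a + mod_idx m) * (1 / of_real t) ^ 2 + E * (1 / of_real t) = chi_deriv c h $ a"
      by (simp only:)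
    then have "h $ a = h $ (a + mod_idx m) * (1 / of_real t) ^ 2 - E * (1 / of_real t)"
      unfolding 0 by (simp add: algebra_simps)
    then have "B \<le> norm (h $ (a + mod_idx m) * (1 / of_real t) ^ 2) + norm (E * (1 / of_real t))"
      unfolding a using norm_triangle_ineq4 by (simp only:)
    also have "norm (h $ (a + mod_idx m) * (1 / of_real t) ^ 2) \<le> B * (1 / 4)"
    proof -
      have "(1 / t) ^ 2 \<le> (1 / 2) ^ 2" using t by (intro power_mono) (simp_all add: field_simps)
      then have "(1 / t) ^ 2 \<le> 1 / 4" by (simp add: power2_eq_square)
      moreover have "norm (h $ (a + mod_idx m) * (1 / of_real t) ^ 2) = norm (h $ (a + mod_idx m)) * (1 / t) ^ 2"
        using t by (simp add: norm_mult norm_power norm_divide)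
      ultimately show ?thesis using B[of "a + mod_idx m"] B0 by (simp only:) (intro mult_mono, simp_all)
    qed
    also have "norm (E * (1 / of_real t)) \<le> B * (1 / 2)"
    proof -
      have "norm E \<le> (\<Sum>i<CARD('k). \<Sum>j<CARD('k). real (?n i j) * (2 * B))"
        unfolding E_def
      proof (intro order.trans[OF norm_sum] sum_mono)
        fix i j
        have "norm (h $ (a + mod_idx j) - h $ (a + mod_idx i)) \<le> 2 * B"
          using norm_triangle_ineq4[of "h $ (a + mod_idx j)" "h $ (a + mod_idx i)"]
            B[of "a + mod_idx j"] B[of "a + mod_idx i"] by linarith
        then show "norm (of_nat (?n i j) * (h $ (a + mod_idx j) - h $ (a + mod_idx i))) \<le> real (?n i j) * (2 * B)"
          by (simp only: norm_mult norm_of_nat) (intro mult_left_mono, simp_all)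
      qed
      also have "\<dots> = N * (2 * B)" by (simp only: N_def sum_distrib_right)
      finally have "norm E / t \<le> N * (2 * B) / t" using t by (intro divide_right_mono) simp_all
      also have "\<dots> = (N / t) * (2 * B)" by simp
      also have "\<dots> \<le> (1 / 4) * (2 * B)" using t(2) B0 by (intro mult_right_mono) simp_all
      finally show ?thesis using t by (simp add: norm_mult norm_divide)
    qed
    finally have "B \<le> 0" by simp
    then have "norm (h $ a) = 0" for a using B[of a] by (meson norm_ge_zero order.antisym order.trans)
    then show "h = 0" by (simp add: vec_eq_iff)
  qed
  ultimately show ?thesis by blast
qed

lemma chi_map_proper:
  fixes K :: "(complex ^ ('k mod_ring)) set"
  assumes "compact K"
  shows "compact {c \<in> cstar_space. chi_map p g m c \<in> K}"
proof -
  have cont: "continuous_on S (join 1 :: complex ^ ('k mod_ring) \<Rightarrow> _)" "continuous_on S' (left_part :: _ \<Rightarrow> complex ^ ('k mod_ring))" for S S'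
  proof -
    have "continuous_on S (\<lambda>y. case s of Inl a \<Rightarrow> (1 :: complex ^ ('k mod_ring)) $ a | Inr a \<Rightarrow> y $ a)" for s
      by (cases s) (auto intro!: continuous_intros)
    then show "continuous_on S (join 1 :: complex ^ ('k mod_ring) \<Rightarrow> _)"
      unfolding join_def[abs_def] by (rule continuous_on_vec_lambda)
    show "continuous_on S' (left_part :: _ \<Rightarrow> complex ^ ('k mod_ring))"
      unfolding left_part_def[abs_def] by (intro continuous_on_vec_lambda continuous_intros)
  qed
  have "compact (left_part ` {q. lifted_map q \<in> join 1 ` K})"
    by (intro compact_continuous_image cont lifted_map_proper assms)
  also have "left_part ` {q. lifted_map q \<in> join 1 ` K} = {c \<in> cstar_space. chi_map p g m c \<in> K}"
  proof (intro equalityI subsetI)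
    fix c assume "c \<in> left_part ` {q. lifted_map q \<in> join 1 ` K}"
    then obtain q y where q: "c = left_part q" "lifted_map q = join 1 y" "y \<in> K" by blast
    have "c \<in> cstar_space \<and> q = embed c \<and> chi_map p g m c = y" using lifted_map_join_1[OF q(2)] q(1) by simp
    then show "c \<in> {c \<in> cstar_space. chi_map p g m c \<in> K}" using q(3) by simp
  next
    fix c assume c: "c \<in> {c \<in> cstar_space. chi_map p g m c \<in> K}"
    then have "lifted_map (embed c) \<in> join 1 ` K" using lifted_map_embed[of c] by simp
    then show "c \<in> left_part ` {q. lifted_map q \<in> join 1 ` K}"
      by (intro image_eqI[of _ _ "embed c"]) (simp_all add: embed_def)
  qed
  finally show ?thesis .
qed

theorem chi_map_degree:
  "proper_holomorphic_map (chi_map p g m :: complex ^ ('k mod_ring) \<Rightarrow> _) cstar_space UNIV \<and>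
    has_multiplicity (chi_map p g m :: complex ^ ('k mod_ring) \<Rightarrow> _) cstar_space UNIV ((2 * CARD('k)) choose CARD('k)) \<and>
    has_solution_count (chi_map p g m :: complex ^ ('k mod_ring) \<Rightarrow> _) cstar_space 0 ((2 * CARD('k)) choose CARD('k))"
proof -
  let ?U = "cstar_space :: (complex ^ ('k mod_ring)) set"
  let ?\<phi> = "chi_map p g m :: complex ^ ('k mod_ring) \<Rightarrow> _"
  let ?M = "\<lambda>c :: complex ^ ('k mod_ring). \<Prod>i\<in>UNIV. c $ i"
  let ?n = "CARD('k mod_ring)"
  obtain G where G: "\<And>a b. polyfn 4 (G a b)" "\<And>c h. (\<chi> a b. G a b (embed c)) *v h = chi_deriv c h"
    using chi_deriv_matrix by blast
  define \<phi>' where "\<phi>' c = (\<chi> a b. G a b (embed c))" for c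
  have mv: "(*v) (\<phi>' c) = chi_deriv c" for c unfolding \<phi>'_def using G(2) by (intro ext)
  have det: "det (\<phi>' c) \<noteq> 0 \<longleftrightarrow> (\<forall>h. chi_deriv c h = 0 \<longrightarrow> h = 0)" for c
    unfolding det_nonzero_iff_inj mv ..
  have openU: "open ?U" using region_cstar_space[where 'n = "'k mod_ring"] by (simp add: region_def)
  have M0: "?M c \<noteq> 0 \<longleftrightarrow> c \<in> ?U" for c by (simp add: cstar_space_def)
  have "polyfn 1 (\<lambda>c. c $ i)" for i :: "'k mod_ring" using polyfn_coord[of 0 i] by simp
  from polyfn_prod[of UNIV "\<lambda>_. 1" "\<lambda>i c. c $ i", OF this] have Mp: "polyfn ?n ?M" by simp
  have deriv: "(?\<phi> has_derivative (*v) (\<phi>' c)) (at c)" if "c \<in> ?U" for c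
    unfolding mv using that by (rule chi_map_has_derivative)
  have contE: "continuous_on ?U embed"
    by (intro continuous_at_imp_continuous_on ballI) (rule has_derivative_continuous[OF embed_has_derivative])
  have cont: "continuous_on ?U \<phi>'"
    unfolding \<phi>'_def
    by (intro continuous_on_vec_lambda continuous_on_compose2[OF polyfn_continuous[OF G(1)] contE]) (rule subset_UNIV)
  define J where "J q = det (\<chi> a b. G a b q)" for q
  have Jp: "polyfn (4 * ?n) J" unfolding J_def by (rule polyfn_det[OF G(1)])
  have J: "det (\<phi>' c) = J (embed c)" for c by (simp only: J_def \<phi>'_def)
  define d where "d = 2 + 4 * ?n"
  have J2: "polyfn d J" by (rule polyfn_mono[OF Jp]) (simp add: d_def)
  have \<phi>2: "polyfn d (\<lambda>q. lifted_map q $ Inr a)" for a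
    by (rule polyfn_mono[OF polyfn_lifted_map]) (simp add: d_def)
  obtain P where P: "polyfn (d * (?n + 1)) P" "\<And>c. c \<in> ?U \<Longrightarrow> ?M c ^ d * det (\<phi>' c) = P c"
    using polyfn_embed[OF J2] unfolding J by blast
  obtain c1 where c1: "c1 \<in> ?U" "det (\<phi>' c1) \<noteq> 0" using chi_regular_point unfolding det by blast
  have dense: "\<exists>c'\<in>?U. dist c' c < \<epsilon> \<and> det (\<phi>' c') \<noteq> 0" if "\<epsilon> > 0" for c \<epsilon>
  proof -
    have "?M c1 * P c1 \<noteq> 0" unfolding P(2)[OF c1(1), symmetric] using c1 M0[of c1] by simp
    from polyfn_nonzero_dense[OF polyfn_mult[OF Mp P(1)] this that] obtain c' where
      c': "dist c' c < \<epsilon>" "?M c' * P c' \<noteq> 0" by blast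
    then have c'U: "c' \<in> ?U" using M0[of c'] by simp
    have "?M c' ^ d * det (\<phi>' c') \<noteq> 0" unfolding P(2)[OF c'U] using c'(2) by simp
    then have "det (\<phi>' c') \<noteq> 0" by simp
    then show ?thesis using c'(1) c'U by blast
  qed
  have "\<exists>n Q. polyfn n Q \<and> (\<exists>w :: complex ^ ('k mod_ring). Q w \<noteq> 0) \<and> (\<forall>c\<in>?U. det (\<phi>' c) = 0 \<longrightarrow> Q (?\<phi> c) = 0)"
  proof (rule critical_values_in_hypersurface[OF openU Mp])
    show "?M c \<noteq> 0" if "c \<in> ?U" for c using that M0[of c] by simp
    show "\<exists>P. polyfn (d * (?n + 1)) P \<and> (\<forall>c\<in>?U. ?M c ^ d * ?\<phi> c $ a = P c)" for a
      using polyfn_embed[OF \<phi>2[of a]] unfolding chi_map_eq part_nth .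
    show "\<exists>P. polyfn (d * (?n + 1)) P \<and> (\<forall>c\<in>?U. ?M c ^ d * det (\<phi>' c) = P c)" using P by blast
    show "continuous_on ?U ?\<phi>"
      by (intro continuous_at_imp_continuous_on ballI) (rule has_derivative_continuous[OF deriv])
    show "continuous_on ?U (\<lambda>c. det (\<phi>' c))"
      unfolding J by (rule continuous_on_compose2[OF polyfn_continuous[OF Jp] contE]) (rule subset_UNIV)
    show "\<exists>c'\<in>?U. dist c' c < \<epsilon> \<and> det (\<phi>' c') \<noteq> 0" if "\<epsilon> > 0" for c \<epsilon> using that by (rule dense)
  qed
  then obtain n Q where Q: "polyfn n Q" "\<exists>w. Q w \<noteq> 0" "\<forall>c\<in>?U. det (\<phi>' c) = 0 \<longrightarrow> Q (?\<phi> c) = 0"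
    by blast
  have Qc: "Q (?\<phi> c) = 0" if "c \<in> ?U" "det (\<phi>' c) = 0" for c using Q(3) that by blast
  interpret proper_map_off_hypersurface ?\<phi> \<phi>' ?U UNIV n Q
    by unfold_locales (fact openU open_UNIV Q(1,2) convex_UNIV cont | erule deriv chi_map_proper dense | erule (1) Qc)+
  obtain y where y: "Q y \<noteq> 0" using Q(2) by blast
  have "card (fibre y) = card {q. lifted_map q = join 1 y}"
  proof (rule bij_betw_same_card[of embed])
    show "bij_betw embed (fibre y) {q. lifted_map q = join 1 y}"
    proof (rule bij_betw_byWitness[where f' = left_part])
      show "\<forall>c\<in>fibre y. left_part (embed c) = c" by (simp add: embed_def)
      show "\<forall>q\<in>{q. lifted_map q = join 1 y}. embed (left_part q) = q" using lifted_map_join_1 by fastforce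
      show "embed ` fibre y \<subseteq> {q. lifted_map q = join 1 y}" using lifted_map_embed by (auto simp: fibre_def)
      show "left_part ` {q. lifted_map q = join 1 y} \<subseteq> fibre y" using lifted_map_join_1 by (fastforce simp: fibre_def)
    qed
  qed
  also have "card {q. lifted_map q = join 1 y} = (2 * CARD('k)) choose CARD('k)"
  proof (rule card_regular_lifted_fibre)
    fix q w assume q: "lifted_map q = join 1 y" "lifted_deriv q w = 0"
    define c where "c = left_part q"
    have c: "c \<in> ?U" "q = embed c" "?\<phi> c = y" using lifted_map_join_1[OF q(1)] by (simp_all add: c_def)
    have "det (\<phi>' c) \<noteq> 0" using Qc[OF c(1)] y c(3) by auto
    then have inj: "h = 0" if "chi_deriv c h = 0" for h using that unfolding det by blast
    show "w = 0" by (rule lifted_deriv_inj[OF c(1) inj]) (use q(2) c(2) in simp_all)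
  qed
  finally have card: "card (fibre y) = (2 * CARD('k)) choose CARD('k)" .
  have "proper_holomorphic_map ?\<phi> ?U UNIV"
    unfolding proper_holomorphic_map_def
    by (intro conjI allI impI region_cstar_space holomorphic_map chi_map_proper)
      (auto simp: region_def)
  then show ?thesis
    using has_multiplicity_generic[OF refl y] has_solution_count_zero[OF refl y] unfolding card by blast
qed

end

lemma exists_root_of_unity:
  assumes "p > 1"
  shows "\<exists>z :: complex. z ^ p = 1 \<and> z \<noteq> 1"
proof (rule ccontr)
  assume "\<not> ?thesis"
  then have "{z :: complex. z ^ p = 1} \<subseteq> {1}" by blast
  then have "card {z :: complex. z ^ p = 1} \<le> card {1 :: complex}" by (intro card_mono) auto
  then show False using card_roots_unity_eq[of p] assms by simp
qed

theorem theorem7p1: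
  fixes p k g m :: nat
    and \<phi> :: "complex ^ ('k::finite mod_ring) \<Rightarrow> complex ^ ('k mod_ring)"
  assumes "k = CARD('k)"
    and "prime p"
    and "k dvd p - 1"
    and "residue_primroot p g"
    and "m < k"
    and "p - 1 \<in> power_coset p k g m"
    and "\<phi> = chi_map p g m"
  shows "proper_holomorphic_map \<phi> cstar_space UNIV \<and>
         has_multiplicity \<phi> cstar_space UNIV ((2 * k) choose k) \<and>
         has_solution_count \<phi> cstar_space 0 ((2 * k) choose k)"
proof -
  obtain z :: complex where z: "z ^ p = 1" "z \<noteq> 1"
    using exists_root_of_unity[OF prime_gt_1_nat[OF assms(2)]] by blast
  have "z \<noteq> 0" using z(1) prime_gt_0_nat[OF assms(2)] by (auto simp: power_0_left)
  then have "coset_roots TYPE('k) p g m z (1 / z)"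
    using assms z by unfold_locales simp_all
  from coset_roots.chi_map_degree[OF this] show ?thesis unfolding assms(1) assms(7) .
qed

end
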